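(* Fix $r\ge 2$, $2\le s\le r$ and $M>0$, and suppose $\boldsymbol\gamma\in\mathbb R^n$ satisfies $\|\boldsymbol\gamma\|_\infty\le M$. Let $H_n\sim\mathsf{H}_{[r]}(n,\boldsymbol B)$ with $\boldsymbol B=(\boldsymbol\beta_2,\ldots,\boldsymbol\beta_r)$. Then under $H_0:\boldsymbol\beta_s=\boldsymbol\gamma$, as $n\to\infty$, $$\lambda_{n,s}:=\frac{2\log\Lambda_{n,s}-n}{\sqrt{2n}}\xrightarrow{D}\mathcal N(0,1),$$ where $\log\Lambda_{n,s}=\ell_{n,s}(\boldsymbol\gamma)-\ell_{n,s}(\hat{\boldsymbol\beta}_s)$.
   Context: $[n]=\{1,\ldots,n\}$ and $\binom{[n]}{s}$ is the collection of $s$-element subsets of $[n]$. The $r$-layered hypergraph $\boldsymbol\beta$-model $\mathsf{H}_{[r]}(n,\boldsymbol B)$, with $\boldsymbol\beta_s=(\beta_{s,v})_{v\in[n]}\in\mathbb R^n$, is the random hypergraph on $[n]$ in which, for every $2\le s\le r$, each hyperedge $\{v_1,\ldots,v_s\}\in\binom{[n]}{s}$ is present independently with probability $\frac{e^{\beta_{s,v_1}+\cdots+\beta_{s,v_s}}}{1+e^{\beta_{s,v_1}+\cdots+\beta_{s,v_s}}}$. The $s$-degree $d_s(v)$ is the number of hyperedges of size $s$ in $H_n$ containing $v$. The negative log-likelihood of layer $s$ is $$\ell_{n,s}(\boldsymbol\beta)=\sum_{\{v_1,\ldots,v_s\}\in\binom{[n]}{s}}\log(1+e^{\beta_{v_1}+\cdots+\beta_{v_s}})-\sum_{v=1}^n\beta_v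 d_s(v),\quad\boldsymbol\beta\in\mathbb R^n,$$ and $\hat{\boldsymbol\beta}_s$ is its minimizer (the ML estimate), which exists and is unique with probability $1-o(1)$ (define it arbitrarily otherwise). $\boldsymbol\gamma$ may depend on $n$; $M$ is fixed. $\xrightarrow{D}$ is convergence in distribution. *)

theory Defs
  imports "HOL-Probability.Probability"
begin

text \<open>
  A vector of \<open>\<real>\<^sup>n\<close> is a function \<^typ>\<open>nat \<Rightarrow> real\<close> read on the index set \<open>{1..n}\<close>.
  Where uniqueness matters, vectors are taken in \<^term>\<open>extensional {1..n}\<close>, so that
  equality of functions is equality of vectors.
\<close>

text \<open>A hypergraph on the vertex set \<open>{1..n}\<close> is identified with its set of hyperedges.\<close>

type_synonym hypergraph = "nat set set"

definition layered_hyperedges :: "nat \<Rightarrow> nat \<Rightarrow> nat set set" where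
  "layered_hyperedges r n = {e. e \<subseteq> {1..n} \<and> 2 \<le> card e \<and> card e \<le> r}"

text \<open>\<open>B s v\<close> is the parameter of vertex \<open>v\<close> in layer \<open>s\<close>.\<close>

definition hyperedge_prob :: "(nat \<Rightarrow> nat \<Rightarrow> real) \<Rightarrow> nat set \<Rightarrow> real" where
  "hyperedge_prob B e =
     exp (\<Sum>v\<in>e. B (card e) v) / (1 + exp (\<Sum>v\<in>e. B (card e) v))"

definition hypergraph_beta_model ::
    "nat \<Rightarrow> nat \<Rightarrow> (nat \<Rightarrow> nat \<Rightarrow> real) \<Rightarrow> hypergraph pmf" where
  "hypergraph_beta_model r n B =
     map_pmf (\<lambda>X. {e \<in> layered_hyperedges r n. X e})
       (Pi_pmf (layered_hyperedges r n) False (\<lambda>e. bernoulli_pmf (hyperedge_prob B e)))"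

definition s_degree :: "nat \<Rightarrow> hypergraph \<Rightarrow> nat \<Rightarrow> nat" where
  "s_degree s H v = card {e \<in> H. card e = s \<and> v \<in> e}"

definition neg_log_lik :: "nat \<Rightarrow> nat \<Rightarrow> hypergraph \<Rightarrow> (nat \<Rightarrow> real) \<Rightarrow> real" where
  "neg_log_lik n s H \<beta> =
     (\<Sum>e\<in>{e. e \<subseteq> {1..n} \<and> card e = s}. ln (1 + exp (\<Sum>v\<in>e. \<beta> v)))
     - (\<Sum>v=1..n. \<beta> v * real (s_degree s H v))"

definition is_ml_estimate :: "nat \<Rightarrow> nat \<Rightarrow> hypergraph \<Rightarrow> (nat \<Rightarrow> real) \<Rightarrow> bool" where
  "is_ml_estimate n s H \<beta> \<longleftrightarrow>
     is_arg_min (neg_log_lik n s H) (\<lambda>x. x \<in> extensional {1..n}) \<beta>"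

text \<open>
  A version of the maximum likelihood estimator: a function of the observed hypergraph
  that is the minimizer whenever there is exactly one, and unconstrained otherwise.
\<close>

definition is_ml_estimator ::
    "nat \<Rightarrow> nat \<Rightarrow> nat \<Rightarrow> (hypergraph \<Rightarrow> nat \<Rightarrow> real) \<Rightarrow> bool" where
  "is_ml_estimator r n s est \<longleftrightarrow>
     (\<forall>H. H \<subseteq> layered_hyperedges r n \<longrightarrow>
        (\<exists>!\<beta>. is_ml_estimate n s H \<beta>) \<longrightarrow> is_ml_estimate n s H (est H))"

definition log_lik_ratio ::
    "nat \<Rightarrow> nat \<Rightarrow> (nat \<Rightarrow> real) \<Rightarrow> (hypergraph \<Rightarrow> nat \<Rightarrow> real) \<Rightarrow> hypergraph \<Rightarrow> real" where
  "log_lik_ratio n s \<gamma> est H = neg_log_lik n s H \<gamma> - neg_log_lik n s H (est H)"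

definition lr_statistic ::
    "nat \<Rightarrow> nat \<Rightarrow> (nat \<Rightarrow> real) \<Rightarrow> (hypergraph \<Rightarrow> nat \<Rightarrow> real) \<Rightarrow> hypergraph \<Rightarrow> real" where
  "lr_statistic n s \<gamma> est H =
     (2 * log_lik_ratio n s \<gamma> est H - real n) / sqrt (2 * real n)"

end

theory Submission
  imports Defs
begin

text \<open>
  Let \<open>Z\<close> be the vector of centred \<open>s\<close>-degrees, so that \<open>Z\<close> is the score at \<open>\<gamma>\<close> and its covariance is the
  Fisher information matrix \<open>A\<close>. The off-diagonal entries of \<open>A\<close> are smaller than the diagonal entries
  \<open>a v\<close> by a factor of order \<open>n\<close>, so that \<open>\<epsilon> v = Z v / a v\<close> is nearly the Newton step. After this step
  the remaining score \<open>r\<close> is, with high probability, so small that, by strong convexity, the minimiser exists, is unique, and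
  improves the likelihood at \<open>\<gamma> + \<epsilon>\<close> by \<open>O(1)\<close> only. The likelihood gain of the explicit step is
  \<open>(\<Sum>v. Z v * \<epsilon> v) / 2 + F\<close> where \<open>F = O(1)\<close> in \<open>L\<^sup>1\<close>: its mean is bounded by Taylor expansion and its
  variance by the Efron--Stein inequality. For \<open>s = 2\<close> the cubic terms of \<open>F\<close> are of order \<open>\<surd>n\<close> in
  absolute value, and it is the Efron--Stein inequality that captures their cancellation.

  There remains the central limit theorem for \<open>(\<Sum>v. (Z v)\<^sup>2 / a v - n) / \<surd>(2n)\<close>, which is a quadratic
  form in the independent hyperedge indicators. It is proved by Stein's method for the characteristic
  function \<open>\<phi>\<close>, that is, by showing that \<open>\<phi>' + t \<phi>\<close> tends to zero.
\<close>

section \<open>Independent Bernoulli variables\<close>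

text \<open>The yardstick is the number \<open>D\<close> of hyperedges through a vertex, which is at
  least \<open>n / s\<close>. The squared scores left after the step sum to \<open>O(D)\<close> in
  mean, against \<open>n * D\<close> at \<gamma>, while the convexity modulus is of order
  \<open>D\<close>; so stopping after one step costs \<open>O(D) / D\<close>, which the
  normalisation \<open>\<surd>(2n)\<close> removes. The cubic cancellation has two sources. For the
  mean, the signed third moment of a linear predictor is of order \<open>D^-2\<close>, whereas the
  absolute one is only \<open>D^(-3/2)\<close>. For the variance, a flip changes the two halves of
  \<open>F\<close> by nearly equal amounts, and their difference is the small remaining score. The
  indicators of all layers stay in the probability space, because an estimator may depend on the
  whole hypergraph where the minimiser is not unique. The law has finite support, so every function
  is integrable. All constants depend on \<open>s\<close>, \<open>c\<close> and \<open>M\<close>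
  only, which allows \<gamma> to vary with \<open>n\<close> and gives the rate
  \<open>n^(-1/2)\<close> for each fixed \<open>t\<close>.\<close>

definition bernoulli_product :: "'a set \<Rightarrow> ('a \<Rightarrow> real) \<Rightarrow> ('a \<Rightarrow> bool) pmf" where
  "bernoulli_product I p = Pi_pmf I False (\<lambda>e. bernoulli_pmf (p e))"

lemma finite_set_bernoulli_product:
  assumes "finite I"
  shows "finite (set_pmf (bernoulli_product I p))"
  unfolding bernoulli_product_def set_Pi_pmf[OF assms]
  by (intro finite_PiE_dflt assms) simp

text \<open>Conditioning on the value at \<open>x\<close>: the source of the resampling identity
  below and of the induction for the Efron-Stein inequality.\<close>

lemma expectation_bernoulli_product_insert:
  fixes f :: "('a \<Rightarrow> bool) \<Rightarrow> 'b::{banach, second_countable_topology}"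
  assumes I: "finite I" "x \<notin> I" and p: "0 \<le> p x" "p x \<le> 1"
  shows "measure_pmf.expectation (bernoulli_product (insert x I) p) f =
    p x *\<^sub>R measure_pmf.expectation (bernoulli_product I p) (\<lambda>X. f (X(x := True))) +
    (1 - p x) *\<^sub>R measure_pmf.expectation (bernoulli_product I p) (\<lambda>X. f (X(x := False)))"
proof -
  have "bernoulli_product (insert x I) p =
    bernoulli_pmf (p x) \<bind> (\<lambda>y. map_pmf (\<lambda>X. X(x := y)) (bernoulli_product I p))"
    unfolding bernoulli_product_def by (subst Pi_pmf_insert'[OF I]) (simp add: map_pmf_def)
  then show ?thesis
    using p finite_set_bernoulli_product[OF I(1)]
    by (simp, subst pmf_expectation_bind[where A = UNIV]) (auto simp: UNIV_bool)
qed

lemma bernoulli_variance_identity: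
  fixes p a b :: real
  shows "p * a^2 + (1 - p) * b^2 = (p * a + (1 - p) * b)^2 + p * (1 - p) * (a - b)^2"
  by (simp add: power2_eq_square algebra_simps)

locale bernoulli_family =
  fixes I :: "'a set" and p :: "'a \<Rightarrow> real"
  assumes finite_index: "finite I"
    and p_ge_0: "e \<in> I \<Longrightarrow> 0 \<le> p e" and p_le_1: "e \<in> I \<Longrightarrow> p e \<le> 1"
begin

abbreviation expect :: "(('a \<Rightarrow> bool) \<Rightarrow> 'b::{banach, second_countable_topology}) \<Rightarrow> 'b" where
  "expect f \<equiv> measure_pmf.expectation (bernoulli_product I p) f"

definition Y :: "'a \<Rightarrow> ('a \<Rightarrow> bool) \<Rightarrow> real" where
  "Y e X = of_bool (X e) - p e"

definition w :: "'a \<Rightarrow> real" where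
  "w e = p e * (1 - p e)"

text \<open>The discrete derivative in direction \<open>e\<close>; its value does not depend on
  \<open>X e\<close>.\<close>

definition influence :: "'a \<Rightarrow> (('a \<Rightarrow> bool) \<Rightarrow> real) \<Rightarrow> ('a \<Rightarrow> bool) \<Rightarrow> real" where
  "influence e F X = F (X(e := True)) - F (X(e := False))"

lemma integrable_any [simp, intro]:
  fixes f :: "('a \<Rightarrow> bool) \<Rightarrow> 'b::{banach, second_countable_topology}"
  shows "integrable (measure_pmf (bernoulli_product I p)) f"
  by (intro integrable_measure_pmf_finite finite_set_bernoulli_product finite_index)

lemma expect_add: "expect (\<lambda>X. f X + g X) = expect f + expect g"
  and expect_diff: "expect (\<lambda>X. f X - g X) = expect f - expect g"
  and expect_sum: "expect (\<lambda>X. \<Sum>i\<in>J. h i X) = (\<Sum>i\<in>J. expect (h i))"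
  by simp_all

lemma expect_mono:
  fixes f g :: "('a \<Rightarrow> bool) \<Rightarrow> real"
  assumes "\<And>X. f X \<le> g X"
  shows "expect f \<le> expect g"
  by (intro integral_mono) (auto simp: assms)

lemma expect_square_le:
  fixes f :: "('a \<Rightarrow> bool) \<Rightarrow> real"
  shows "(expect f)\<^sup>2 \<le> expect (\<lambda>X. (f X)\<^sup>2)"
proof -
  have "0 \<le> expect (\<lambda>X. (f X - expect f)\<^sup>2)"
    by (intro Bochner_Integration.integral_nonneg) auto
  also have "\<dots> = expect (\<lambda>X. (f X)\<^sup>2) - (expect f)\<^sup>2"
    by (simp add: power2_diff) (simp add: power2_eq_square)
  finally show ?thesis by simp
qed

lemma expect_abs_le_sqrt:
  fixes f :: "('a \<Rightarrow> bool) \<Rightarrow> real"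
  shows "expect (\<lambda>X. \<bar>f X\<bar>) \<le> sqrt (expect (\<lambda>X. (f X)\<^sup>2))"
  using expect_square_le[of "\<lambda>X. \<bar>f X\<bar>"] by (intro real_le_rsqrt) simp

lemma w_ge_0: "e \<in> I \<Longrightarrow> 0 \<le> w e"
  using p_ge_0 p_le_1 by (simp add: w_def)

lemma w_le: "w e \<le> 1/4"
proof -
  have "0 \<le> (p e - 1/2)^2" by simp
  then show ?thesis by (simp add: w_def power2_eq_square algebra_simps)
qed

lemma w_le_1: "w e \<le> 1"
  using w_le[of e] by simp

lemma Y_upd [simp]: "Y e (X(e := b)) = of_bool b - p e"
  "f \<noteq> e \<Longrightarrow> Y f (X(e := b)) = Y f X"
  by (simp_all add: Y_def)

lemma abs_Y_le: "e \<in> I \<Longrightarrow> \<bar>Y e X\<bar> \<le> 1"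
  using p_ge_0[of e] p_le_1[of e] by (cases "X e") (auto simp: Y_def)

lemma expect_resample:
  fixes f :: "('a \<Rightarrow> bool) \<Rightarrow> 'b::{banach, second_countable_topology}"
  assumes "e \<in> I"
  shows "expect f = expect (\<lambda>X. p e *\<^sub>R f (X(e := True)) + (1 - p e) *\<^sub>R f (X(e := False)))"
proof -
  have I: "I = insert e (I - {e})" "finite (I - {e})" "e \<notin> I - {e}"
    using assms finite_index by auto
  note ins = expectation_bernoulli_product_insert[where x = e and p = p, OF I(2,3) p_ge_0[OF assms] p_le_1[OF assms], folded I(1)]
  have [simp]: "p e *\<^sub>R x + (1 - p e) *\<^sub>R x = x" for x :: 'b
    by (simp add: scaleR_diff_left)
  have int: "integrable (measure_pmf (bernoulli_product (I - {e}) p)) g"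
    for g :: "('a \<Rightarrow> bool) \<Rightarrow> 'b"
    by (intro integrable_measure_pmf_finite finite_set_bernoulli_product I)
  show ?thesis
    by (subst (1 2) ins) (simp add: int)
qed

text \<open>Independence of \<open>g\<close> from the variable at \<open>e\<close> is expressed as
  invariance under overwriting that variable, a condition checked by rewriting instead of through
  sigma-algebras.\<close>

lemma expect_times_independent:
  fixes g :: "('a \<Rightarrow> bool) \<Rightarrow> 'b::{banach, second_countable_topology}"
  assumes "e \<in> I" and "\<And>X b. g (X(e := b)) = g X"
  shows "expect (\<lambda>X. h (X e) *\<^sub>R g X) = (p e * h True + (1 - p e) * h False) *\<^sub>R expect g"
  by (subst expect_resample[OF assms(1)]) (simp add: assms(2) flip: scaleR_left.add)

lemma expect_Y_times:
  fixes g :: "('a \<Rightarrow> bool) \<Rightarrow> 'b::{banach, second_countable_topology}"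
  assumes "e \<in> I" and "\<And>X b. g (X(e := b)) = g X"
  shows "expect (\<lambda>X. Y e X *\<^sub>R g X) = 0"
  unfolding Y_def
  using expect_times_independent[OF assms, of "\<lambda>b. of_bool b - p e"] by (simp add: algebra_simps)

lemma expect_Y2_times:
  fixes g :: "('a \<Rightarrow> bool) \<Rightarrow> 'b::{banach, second_countable_topology}"
  assumes "e \<in> I" and "\<And>X b. g (X(e := b)) = g X"
  shows "expect (\<lambda>X. (Y e X)\<^sup>2 *\<^sub>R g X) = w e *\<^sub>R expect g"
proof -
  have "p e * (1 - p e)\<^sup>2 + (1 - p e) * (- p e)\<^sup>2 = w e"
    by (simp add: w_def power2_eq_square algebra_simps)
  then show ?thesis
    unfolding Y_def
    using expect_times_independent[OF assms, of "\<lambda>b. (of_bool b - p e)\<^sup>2"] by simp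
qed

end

text \<open>Induction over the index set. Averaging out the variable at \<open>x\<close> splits the
  variance of \<open>F\<close> exactly into the variance of the average \<open>m\<close> and
  \<open>w x\<close> times the mean square influence of \<open>x\<close>; by convexity of the
  square, averaging does not increase the mean square influence of the other variables. The index
  set changes in the induction, hence the formulation outside the locale.\<close>

theorem efron_stein_bernoulli:
  fixes F :: "('a \<Rightarrow> bool) \<Rightarrow> real"
  assumes "bernoulli_family I p"
  shows "measure_pmf.expectation (bernoulli_product I p) (\<lambda>X. (F X)\<^sup>2)
      - (measure_pmf.expectation (bernoulli_product I p) F)\<^sup>2
    \<le> (\<Sum>e\<in>I. bernoulli_family.w p e *
         measure_pmf.expectation (bernoulli_product I p) (\<lambda>X. (bernoulli_family.influence e F X)\<^sup>2))"
proof -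
  have "finite I"
    using assms by (simp add: bernoulli_family_def)
  then show ?thesis
    using assms
  proof (induction I arbitrary: F rule: finite_induct)
    case empty
    then show ?case by (simp add: bernoulli_product_def)
  next
    case (insert x I)
    interpret B': bernoulli_family "insert x I" p by fact
    interpret B: bernoulli_family I p
      using insert.prems by (auto simp: bernoulli_family_def)
    have p: "0 \<le> p x" "p x \<le> 1"
      using B'.p_ge_0 B'.p_le_1 by auto
    note ins = expectation_bernoulli_product_insert[where p = p and x = x, OF insert.hyps p]
    define F1 where "F1 = (\<lambda>X. F (X(x := True)))"
    define F0 where "F0 = (\<lambda>X. F (X(x := False)))"
    define m where "m = (\<lambda>X. p x * F1 X + (1 - p x) * F0 X)"
    have E1: "B'.expect F = B.expect m"
      by (subst ins) (simp add: m_def F1_def F0_def)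
    have E2: "B'.expect (\<lambda>X. (F X)\<^sup>2) = B.expect (\<lambda>X. (m X)\<^sup>2) + B.w x * B.expect (\<lambda>X. (F1 X - F0 X)\<^sup>2)"
    proof -
      have "B'.expect (\<lambda>X. (F X)\<^sup>2) = B.expect (\<lambda>X. p x * (F1 X)\<^sup>2 + (1 - p x) * (F0 X)\<^sup>2)"
        by (subst ins) (simp add: F1_def F0_def)
      also have "\<dots> = B.expect (\<lambda>X. (m X)\<^sup>2 + B.w x * (F1 X - F0 X)\<^sup>2)"
        unfolding m_def B.w_def bernoulli_variance_identity ..
      finally show ?thesis by simp
    qed
    have Dx: "B'.expect (\<lambda>X. (B.influence x F X)\<^sup>2) = B.expect (\<lambda>X. (F1 X - F0 X)\<^sup>2)"
      by (subst ins) (simp add: B.influence_def F1_def F0_def algebra_simps)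
    have De: "B.w e * B.expect (\<lambda>X. (B.influence e m X)\<^sup>2) \<le> B.w e * B'.expect (\<lambda>X. (B.influence e F X)\<^sup>2)"
      if "e \<in> I" for e
    proof (rule mult_left_mono)
      have ne: "e \<noteq> x" using that insert.hyps by auto
      have "B'.expect (\<lambda>X. (B.influence e F X)\<^sup>2) =
          B.expect (\<lambda>X. p x * (B.influence e F1 X)\<^sup>2 + (1 - p x) * (B.influence e F0 X)\<^sup>2)"
        by (subst ins) (simp add: B.influence_def F1_def F0_def fun_upd_twist[OF ne])
      moreover have "(B.influence e m X)\<^sup>2 \<le> p x * (B.influence e F1 X)\<^sup>2 + (1 - p x) * (B.influence e F0 X)\<^sup>2" for X
      proof -
        have "B.influence e m X = p x * B.influence e F1 X + (1 - p x) * B.influence e F0 X"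
          by (simp add: B.influence_def m_def algebra_simps)
        then show ?thesis
          unfolding bernoulli_variance_identity using p by simp
      qed
      ultimately show "B.expect (\<lambda>X. (B.influence e m X)\<^sup>2) \<le> B'.expect (\<lambda>X. (B.influence e F X)\<^sup>2)"
        by (simp only:) (intro B.expect_mono)
    qed (use B.w_ge_0 that in auto)
    have "B'.expect (\<lambda>X. (F X)\<^sup>2) - (B'.expect F)\<^sup>2 =
       (B.expect (\<lambda>X. (m X)\<^sup>2) - (B.expect m)\<^sup>2) + B.w x * B'.expect (\<lambda>X. (B.influence x F X)\<^sup>2)"
      unfolding E1 E2 Dx by simp
    also have "\<dots> \<le> (\<Sum>e\<in>I. B.w e * B.expect (\<lambda>X. (B.influence e m X)\<^sup>2))
        + B.w x * B'.expect (\<lambda>X. (B.influence x F X)\<^sup>2)"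
      using insert.IH[OF B.bernoulli_family_axioms, of m] by simp
    also have "\<dots> \<le> (\<Sum>e\<in>I. B.w e * B'.expect (\<lambda>X. (B.influence e F X)\<^sup>2))
        + B.w x * B'.expect (\<lambda>X. (B.influence x F X)\<^sup>2)"
      using De by (intro add_right_mono sum_mono) auto
    also have "\<dots> = (\<Sum>e\<in>insert x I. B.w e * B'.expect (\<lambda>X. (B.influence e F X)\<^sup>2))"
      using insert.hyps by simp
    finally show ?case .
  qed
qed

context bernoulli_family
begin

section \<open>Linear forms in the centred indicators: variance and moment bounds\<close>

definition lin :: "'a set \<Rightarrow> ('a \<Rightarrow> real) \<Rightarrow> ('a \<Rightarrow> bool) \<Rightarrow> real" where
  "lin J c X = (\<Sum>e\<in>J. c e * Y e X)"

lemma lin_upd_notin: "e \<notin> J \<Longrightarrow> lin J c (X(e := b)) = lin J c X"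
  unfolding lin_def by (intro sum.cong refl) (auto simp: Y_def)

text \<open>A variable on which \<open>F\<close> does not depend has influence zero, so the sum
  shrinks to one layer. The weights \<open>w\<close> are estimated by 1.\<close>

lemma efron_stein:
  fixes F :: "('a \<Rightarrow> bool) \<Rightarrow> real"
  assumes J: "J \<subseteq> I"
    and inv: "\<And>e b X. e \<in> I - J \<Longrightarrow> F (X(e := b)) = F X"
  shows "expect (\<lambda>X. (F X - expect F)\<^sup>2) \<le> (\<Sum>e\<in>J. expect (\<lambda>X. (influence e F X)\<^sup>2))"
proof -
  have "expect (\<lambda>X. (F X - expect F)\<^sup>2) = expect (\<lambda>X. (F X)\<^sup>2) - (expect F)\<^sup>2"
    by (simp add: power2_diff) (simp add: power2_eq_square)
  also have "\<dots> \<le> (\<Sum>e\<in>I. w e * expect (\<lambda>X. (influence e F X)\<^sup>2))"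
    by (rule efron_stein_bernoulli) (rule bernoulli_family_axioms)
  also have "\<dots> = (\<Sum>e\<in>J. w e * expect (\<lambda>X. (influence e F X)\<^sup>2))"
    using J finite_index by (intro sum.mono_neutral_right) (auto simp: influence_def inv)
  also have "\<dots> \<le> (\<Sum>e\<in>J. expect (\<lambda>X. (influence e F X)\<^sup>2))"
    using J w_ge_0 w_le_1 by (intro sum_mono mult_left_le_one_le Bochner_Integration.integral_nonneg) auto
  finally show ?thesis .
qed

lemma expect_Y_power_times_lin:
  assumes "e \<in> I" "e \<notin> J"
  shows "expect (\<lambda>X. Y e X ^ k * lin J c X ^ l) = expect (\<lambda>X. Y e X ^ k) * expect (\<lambda>X. lin J c X ^ l)"
  using expect_times_independent[OF assms(1), of "\<lambda>X. lin J c X ^ l" "\<lambda>b. (of_bool b - p e)^k"]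
    expect_times_independent[OF assms(1), of "\<lambda>X. 1::real" "\<lambda>b. (of_bool b - p e)^k"]
  by (simp add: Y_def lin_upd_notin assms)

lemma expect_Y [simp]: "e \<in> I \<Longrightarrow> expect (Y e) = 0"
  using expect_Y_times[of e "\<lambda>_. 1::real"] by simp

lemma expect_Y2 [simp]: "e \<in> I \<Longrightarrow> expect (\<lambda>X. (Y e X)\<^sup>2) = w e"
  using expect_Y2_times[of e "\<lambda>_. 1::real"] by simp

lemma abs_expect_Y_power_le: "e \<in> I \<Longrightarrow> \<bar>expect (\<lambda>X. Y e X ^ k)\<bar> \<le> 1"
proof -
  assume "e \<in> I"
  have "\<bar>expect (\<lambda>X. Y e X ^ k)\<bar> \<le> expect (\<lambda>X. \<bar>Y e X ^ k\<bar>)"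
    by (rule integral_abs_bound)
  also have "\<dots> \<le> expect (\<lambda>X. 1)"
    using abs_Y_le[OF \<open>e \<in> I\<close>] by (intro expect_mono) (simp add: power_abs power_le_one)
  finally show ?thesis by simp
qed

lemma lin_insert:
  assumes "finite J" "e \<notin> J"
  shows "lin (insert e J) c X = lin J c X + c e * Y e X"
  using assms by (simp add: lin_def)

lemma expect_lin: "J \<subseteq> I \<Longrightarrow> expect (lin J c) = 0"
  unfolding lin_def[abs_def] by (subst expect_sum) (auto intro!: sum.neutral)

lemma expect_Y_Y:
  assumes "e \<in> I" "f \<in> I"
  shows "expect (\<lambda>X. Y e X * Y f X) = (if e = f then w e else 0)"
  using expect_Y_times[OF assms(1), of "Y f"] expect_Y2[OF assms(1)] by (auto simp: power2_eq_square)

lemma expect_lin_lin: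
  assumes "J \<subseteq> I"
  shows "expect (\<lambda>X. lin J c X * lin J d X) = (\<Sum>e\<in>J. c e * d e * w e)"
proof -
  have J: "finite J" using assms finite_index finite_subset by blast
  have "expect (\<lambda>X. lin J c X * lin J d X) = (\<Sum>e\<in>J. \<Sum>f\<in>J. c e * d f * expect (\<lambda>X. Y e X * Y f X))"
    unfolding lin_def sum_product by (simp add: mult.assoc mult.left_commute)
  also have "\<dots> = (\<Sum>e\<in>J. \<Sum>f\<in>J. if e = f then c e * d e * w e else 0)"
    using assms by (intro sum.cong refl) (auto simp: expect_Y_Y subset_iff)
  finally show ?thesis using J by simp
qed

lemma expect_lin_square_le:
  assumes "J \<subseteq> I"
  shows "expect (\<lambda>X. (lin J c X)\<^sup>2) \<le> (\<Sum>e\<in>J. (c e)\<^sup>2)"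
  unfolding power2_eq_square expect_lin_lin[OF assms]
  using assms w_le_1 by (intro sum_mono) (simp add: mult_left_le)

text \<open>In the expansion of the cube of \<open>lin J c + c e * Y e\<close> both mixed terms have
  mean zero, so only third moments of single variables survive. With coefficients of order
  \<open>1 / D\<close> on about \<open>D\<close> hyperedges this gives \<open>D^-2\<close>.\<close>

lemma expect_lin_cube_le:
  assumes "J \<subseteq> I"
  shows "\<bar>expect (\<lambda>X. (lin J c X)^3)\<bar> \<le> (\<Sum>e\<in>J. \<bar>c e\<bar>^3)"
proof -
  have "finite J" using assms finite_index finite_subset by blast
  then show ?thesis using assms
  proof (induction J)
    case empty
    then show ?case by (simp add: lin_def)
  next
    case (insert e J)
    then have e: "e \<in> I" "e \<notin> J" and J: "J \<subseteq> I" by auto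
    have "(lin (insert e J) c X)^3 = lin J c X^3 + 3 * c e * (Y e X ^ 1 * lin J c X ^ 2)
        + 3 * (c e)^2 * (Y e X ^ 2 * lin J c X ^ 1) + (c e)^3 * Y e X ^ 3" for X
      unfolding lin_insert[OF insert(1,2)] by (simp add: power2_eq_square power3_eq_cube algebra_simps)
    then have "expect (\<lambda>X. (lin (insert e J) c X)^3) = expect (\<lambda>X. (lin J c X)^3) + (c e)^3 * expect (\<lambda>X. Y e X^3)"
      by (simp only: expect_add integral_mult_right_zero expect_Y_power_times_lin[OF e])
        (simp add: e expect_lin[OF J])
    then have "\<bar>expect (\<lambda>X. (lin (insert e J) c X)^3)\<bar> \<le> \<bar>expect (\<lambda>X. (lin J c X)^3)\<bar> + \<bar>c e\<bar>^3 * \<bar>expect (\<lambda>X. Y e X^3)\<bar>"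
      by (simp add: abs_mult power_abs) (metis abs_mult abs_triangle_ineq power_abs)
    also have "\<dots> \<le> (\<Sum>e\<in>J. \<bar>c e\<bar>^3) + \<bar>c e\<bar>^3 * 1"
      using insert.IH[OF J] abs_expect_Y_power_le[OF e(1)] by (intro add_mono mult_left_mono) auto
    finally show ?case using insert(1,2) by simp
  qed
qed

text \<open>The mixed terms with odd powers vanish. With \<open>V\<close> the sum of squares so far,
  inserting \<open>e\<close> adds at most \<open>6 * (c e)^2 * V + (c e)^4\<close>, while
  \<open>3 * V^2\<close> grows by \<open>6 * (c e)^2 * V + 3 * (c e)^4\<close>.\<close>

lemma expect_lin_fourth_le:
  assumes "J \<subseteq> I"
  shows "expect (\<lambda>X. (lin J c X)^4) \<le> 3 * (\<Sum>e\<in>J. (c e)\<^sup>2)\<^sup>2"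
proof -
  have "finite J" using assms finite_index finite_subset by blast
  then show ?thesis using assms
  proof (induction J)
    case empty
    then show ?case by (simp add: lin_def)
  next
    case (insert e J)
    then have e: "e \<in> I" "e \<notin> J" and J: "J \<subseteq> I" by auto
    let ?V = "\<Sum>e\<in>J. (c e)\<^sup>2"
    have "(lin (insert e J) c X)^4 = lin J c X^4 + 4 * c e * (Y e X ^ 1 * lin J c X ^ 3)
        + 6 * (c e)^2 * (Y e X ^ 2 * lin J c X ^ 2) + 4 * (c e)^3 * (Y e X ^ 3 * lin J c X ^ 1)
        + (c e)^4 * Y e X ^ 4" for X
      unfolding lin_insert[OF insert(1,2)]
      by (simp add: power2_eq_square power3_eq_cube power4_eq_xxxx algebra_simps)
    then have "expect (\<lambda>X. (lin (insert e J) c X)^4) = expect (\<lambda>X. (lin J c X)^4)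
        + 6 * (c e)\<^sup>2 * (w e * expect (\<lambda>X. (lin J c X)\<^sup>2)) + (c e)^4 * expect (\<lambda>X. Y e X^4)"
      by (simp only: expect_add integral_mult_right_zero expect_Y_power_times_lin[OF e])
        (simp add: e expect_lin[OF J])
    also have "\<dots> \<le> 3 * ?V\<^sup>2 + 6 * (c e)\<^sup>2 * (1 * ?V) + (c e)^4 * 1"
      using insert.IH[OF J] abs_expect_Y_power_le[OF e(1), of 4] expect_lin_square_le[OF J, of c]
        w_le_1[of e] w_ge_0[OF e(1)]
      by (intro add_mono mult_left_mono mult_mono) (auto intro!: Bochner_Integration.integral_nonneg)
    also have "\<dots> \<le> 3 * (?V + (c e)\<^sup>2)\<^sup>2"
      using zero_le_square[of "c e * c e"] by (simp add: power2_sum power2_eq_square power4_eq_xxxx algebra_simps)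
    finally show ?case using insert(1,2) by (simp add: add.commute)
  qed
qed

lemma lin_upd:
  assumes "finite J" "e \<in> J"
  shows "lin J c (X(e := b)) = lin J c X + (of_bool b - of_bool (X e)) * c e"
proof -
  have "lin J c (X(e := b)) - lin J c X = (\<Sum>f\<in>J. if f = e then (of_bool b - of_bool (X e)) * c e else 0)"
    unfolding lin_def sum_subtractf[symmetric]
    by (intro sum.cong refl) (auto simp: Y_def algebra_simps)
  then show ?thesis using assms by simp
qed

text \<open>One of the two points compared by the influence is \<open>X\<close> itself, so bounding
  the effect of overwriting one coordinate suffices.\<close>

lemma abs_influence_le:
  assumes "\<And>b. \<bar>F (X(e := b)) - F X\<bar> \<le> B"
  shows "\<bar>influence e F X\<bar> \<le> B"
proof (cases "X e")
  case True
  then have "X(e := True) = X" by (simp add: fun_upd_idem)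
  then show ?thesis using assms[of False] by (simp add: influence_def)
next
  case False
  then have "X(e := False) = X" by (simp add: fun_upd_idem)
  then show ?thesis using assms[of True] by (simp add: influence_def)
qed

lemma expect_abs_dev_le:
  assumes "expect (\<lambda>X. (F X - m)\<^sup>2) \<le> V"
  shows "expect (\<lambda>X. \<bar>F X - m\<bar>) \<le> sqrt V"
  using expect_abs_le_sqrt[of "\<lambda>X. F X - m"] assms by (meson order.trans real_sqrt_le_iff)

end

section \<open>A central limit theorem for quadratic forms\<close>

lemma norm_iexp_diff_le: "cmod (iexp x - iexp y) \<le> \<bar>x - y\<bar>"
proof -
  have "iexp x - iexp y = iexp y * (iexp (x - y) - 1)"
    by (simp add: algebra_simps flip: exp_add)
  then have "cmod (iexp x - iexp y) = cmod (iexp (x - y) - 1)"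
    by (simp add: norm_mult)
  then show ?thesis
    using iexp_approx1[of "x - y" 0] by simp
qed

context bernoulli_family
begin

lemma norm_expect_iexp_diff_le:
  "cmod (expect (\<lambda>X. iexp (t * U X)) - expect (\<lambda>X. iexp (t * V X))) \<le> \<bar>t\<bar> * expect (\<lambda>X. \<bar>U X - V X\<bar>)"
proof -
  have "cmod (expect (\<lambda>X. iexp (t * U X) - iexp (t * V X))) \<le> expect (\<lambda>X. cmod (iexp (t * U X) - iexp (t * V X)))"
    by (rule integral_norm_bound)
  also have "\<dots> \<le> expect (\<lambda>X. \<bar>t\<bar> * \<bar>U X - V X\<bar>)"
  proof (rule expect_mono)
    show "cmod (iexp (t * U X) - iexp (t * V X)) \<le> \<bar>t\<bar> * \<bar>U X - V X\<bar>" for X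
      using norm_iexp_diff_le[of "t * U X" "t * V X"] by (simp only: right_diff_distrib[symmetric] abs_mult)
  qed
  finally show ?thesis by simp
qed

text \<open>The expectation is a finite weighted sum, so it is differentiated term by term.\<close>

lemma expect_has_vector_derivative:
  fixes f :: "real \<Rightarrow> ('a \<Rightarrow> bool) \<Rightarrow> 'b::{banach, second_countable_topology}"
  assumes "\<And>X. ((\<lambda>t. f t X) has_vector_derivative f' X) F"
  shows "((\<lambda>t. expect (f t)) has_vector_derivative expect f') F"
proof -
  have "expect g = (\<Sum>X\<in>set_pmf (bernoulli_product I p). pmf (bernoulli_product I p) X *\<^sub>R g X)"
    for g :: "('a \<Rightarrow> bool) \<Rightarrow> 'b"
    by (intro integral_measure_pmf finite_set_bernoulli_product finite_index)
  then show ?thesis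
    by (simp only:) (intro has_vector_derivative_sum assms
        bounded_linear.has_vector_derivative[OF bounded_linear_scaleR_right])
qed

text \<open>With a vanishing diagonal the form is affine in \<open>Y e\<close>. By symmetry the row
  and the column of \<open>e\<close> contribute equally, which cancels the factor 1/2.\<close>

lemma quadratic_form_split:
  assumes "finite J" "e \<in> J" and "\<And>e f. h e f = h f e" "\<And>e. h e e = 0"
  shows "(\<Sum>f\<in>J. Y f X * lin J (h f) X) / 2 =
    Y e X * lin J (h e) X + (\<Sum>f\<in>J - {e}. Y f X * lin (J - {e}) (h f) X) / 2"
proof -
  have J: "J = insert e (J - {e})" and fin: "finite (J - {e})" and ni: "e \<notin> J - {e}" using assms by auto
  have lin: "lin J (h f) X = lin (J - {e}) (h f) X + h f e * Y e X" for f
    using lin_insert[OF fin ni, of "h f" X] J by simp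
  have "(\<Sum>f\<in>J. Y f X * lin J (h f) X) = Y e X * lin J (h e) X + (\<Sum>f\<in>J - {e}. Y f X * lin J (h f) X)"
    by (rule sum.remove) (use assms in auto)
  also have "(\<Sum>f\<in>J - {e}. Y f X * lin J (h f) X) =
      (\<Sum>f\<in>J - {e}. Y f X * lin (J - {e}) (h f) X) + Y e X * (\<Sum>f\<in>J - {e}. h e f * Y f X)"
    unfolding lin by (simp add: ring_distribs sum.distrib sum_distrib_left assms(3)[of _ e] mult_ac)
  also have "(\<Sum>f\<in>J - {e}. h e f * Y f X) = lin J (h e) X"
    unfolding lin[of e] by (simp add: assms lin_def)
  finally show ?thesis by (simp add: field_simps)
qed

text \<open>
  Stein's method on the level of characteristic functions: \<open>\<phi>' + t \<phi>\<close> is small, where \<open>\<phi>\<close> is the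
  characteristic function of the form. Each summand \<open>Y e * lin J (h e)\<close> is integrated by parts in the
  single variable \<open>Y e\<close>, on which \<open>lin J (h e)\<close> does not depend since \<open>h\<close> vanishes on the diagonal.
\<close>

lemma quadratic_form_stein:
  fixes h :: "'a \<Rightarrow> 'a \<Rightarrow> real" and J t
  defines "U \<equiv> \<lambda>X. (\<Sum>e\<in>J. Y e X * lin J (h e) X) / 2"
  assumes J: "J \<subseteq> I" and h: "\<And>e f. h e f = h f e" "\<And>e. h e e = 0"
  shows "cmod (expect (\<lambda>X. \<i> * U X * iexp (t * U X)) + t * expect (\<lambda>X. iexp (t * U X)))
    \<le> \<bar>t\<bar> / 2 * expect (\<lambda>X. \<bar>(\<Sum>e\<in>J. w e * (lin J (h e) X)\<^sup>2) - 2\<bar>)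
      + t\<^sup>2 * (\<Sum>e\<in>J. expect (\<lambda>X. \<bar>lin J (h e) X\<bar>^3))"
proof -
  have fin: "finite J" using J finite_index finite_subset by blast
  define \<phi> where "\<phi> = (\<lambda>X. iexp (t * U X))"
  have n\<phi>: "cmod (\<phi> X) = 1" for X
    by (simp add: \<phi>_def)
  have edge: "cmod (expect (\<lambda>X. (Y e X * lin J (h e) X) *\<^sub>R \<phi> X) - (\<i> * t) * expect (\<lambda>X. (w e * (lin J (h e) X)\<^sup>2) *\<^sub>R \<phi> X))
      \<le> 2 * t\<^sup>2 * expect (\<lambda>X. \<bar>lin J (h e) X\<bar>^3)" if e: "e \<in> J" for e
  proof -
    have eI: "e \<in> I" using e J by auto
    define l where "l = lin J (h e)"
    have l_inv: "l (X(e := b)) = l X" for X b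
      unfolding l_def lin_def by (intro sum.cong refl) (auto simp: Y_def h)
    define U0 where "U0 = (\<lambda>X. (\<Sum>f\<in>J - {e}. Y f X * lin (J - {e}) (h f) X) / 2)"
    have U0_inv: "U0 (X(e := b)) = U0 X" for X b
      unfolding U0_def by (intro arg_cong2[where f = "(/)"] sum.cong refl) (auto simp: lin_upd_notin)
    have U: "U X = Y e X * l X + U0 X" for X
      unfolding U_def U0_def l_def by (rule quadratic_form_split[OF fin e h])
    define \<psi> where "\<psi> = (\<lambda>X. iexp (t * U0 X))"
    have n\<psi>: "cmod (\<psi> X) = 1" for X
      by (simp add: \<psi>_def)
    have \<psi>_inv: "\<psi> (X(e := b)) = \<psi> X" for X b
      by (simp add: \<psi>_def U0_inv)
    have \<phi>\<psi>: "\<phi> X = iexp (t * (Y e X * l X)) * \<psi> X" for X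
      by (simp add: \<phi>_def \<psi>_def U ring_distribs exp_add)
    have z1: "expect (\<lambda>X. Y e X *\<^sub>R (l X *\<^sub>R \<psi> X)) = 0"
      by (rule expect_Y_times[OF eI]) (simp add: l_inv \<psi>_inv)
    have z2: "expect (\<lambda>X. (Y e X)\<^sup>2 *\<^sub>R (\<i> * t * ((l X)\<^sup>2 *\<^sub>R \<psi> X))) = w e *\<^sub>R expect (\<lambda>X. \<i> * t * ((l X)\<^sup>2 *\<^sub>R \<psi> X))"
      by (rule expect_Y2_times[OF eI]) (simp add: l_inv \<psi>_inv)
    \<comment> \<open>\<open>r1\<close> is the error of expanding \<open>iexp\<close> to first order
      in \<open>Y e * l\<close>, and \<open>r2\<close> that of replacing \<open>\<psi>\<close> by
      \<open>\<phi>\<close> in the variance term. They are at most 1/2 and 1 times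
      \<open>t^2 * |l|^3\<close>; the factor 2 in the claim rounds up their sum.\<close>
    define r1 where "r1 = (\<lambda>X. (Y e X * l X) *\<^sub>R ((iexp (t * (Y e X * l X)) - (1 + \<i> * t * (Y e X * l X))) * \<psi> X))"
    define r2 where "r2 = (\<lambda>X. (\<i> * t * w e * (l X)\<^sup>2) * ((1 - iexp (t * (Y e X * l X))) * \<psi> X))"
    have "expect (\<lambda>X. (Y e X * l X) *\<^sub>R \<phi> X) - (\<i> * t) * expect (\<lambda>X. (w e * (l X)\<^sup>2) *\<^sub>R \<phi> X) =
       expect (\<lambda>X. Y e X *\<^sub>R (l X *\<^sub>R \<psi> X) + ((Y e X)\<^sup>2 *\<^sub>R (\<i> * t * ((l X)\<^sup>2 *\<^sub>R \<psi> X)) - w e *\<^sub>R (\<i> * t * ((l X)\<^sup>2 *\<^sub>R \<psi> X))) + (r1 X + r2 X))"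
      unfolding integral_mult_right_zero[symmetric] expect_diff[symmetric]
      by (intro arg_cong[where f = "\<lambda>f. expect f"] ext)
        (simp add: \<phi>\<psi> r1_def r2_def scaleR_conv_of_real power2_eq_square algebra_simps)
    also have "\<dots> = expect (\<lambda>X. r1 X + r2 X)"
      by (simp only: expect_add expect_diff z1 z2 integral_scaleR_right) simp
    also have "cmod \<dots> \<le> expect (\<lambda>X. cmod (r1 X + r2 X))"
      by (rule integral_norm_bound)
    also have "\<dots> \<le> expect (\<lambda>X. 2 * t\<^sup>2 * \<bar>l X\<bar>^3)"
    proof (rule expect_mono)
      fix X
      have y: "\<bar>Y e X\<bar> \<le> 1" by (rule abs_Y_le[OF eI])
      have yl: "\<bar>t * (Y e X * l X)\<bar> \<le> \<bar>t * l X\<bar>"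
        using y by (simp add: abs_mult mult_left_mono mult_left_le_one_le)
      have "cmod (iexp (t * (Y e X * l X)) - (1 + \<i> * t * (Y e X * l X))) \<le> \<bar>t * (Y e X * l X)\<bar>^2 / 2"
        using iexp_approx1[of "t * (Y e X * l X)" 1] by (simp add: mult.assoc power2_eq_square)
      also have "\<dots> \<le> \<bar>t * l X\<bar>^2 / 2"
        using yl by (intro divide_right_mono power_mono) auto
      finally have "cmod (r1 X) \<le> (1 * \<bar>l X\<bar>) * (\<bar>t * l X\<bar>^2 / 2)"
        unfolding r1_def norm_scaleR norm_mult n\<psi> abs_mult mult_1_right
        using y by (intro mult_mono) auto
      moreover have "cmod (1 - iexp (t * (Y e X * l X))) \<le> \<bar>t * l X\<bar>"
        using iexp_approx1[of "t * (Y e X * l X)" 0] yl by (simp add: norm_minus_commute)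
      then have "cmod (r2 X) \<le> (\<bar>t\<bar> * 1 * (l X)\<^sup>2) * \<bar>t * l X\<bar>"
        unfolding r2_def norm_mult n\<psi> mult_1_right
        using w_le_1[of e] w_ge_0[OF eI] by (intro mult_mono) (auto simp: norm_power mult_left_le)
      moreover have l3: "\<bar>l X\<bar>^3 = \<bar>l X\<bar> * (l X)\<^sup>2"
        by (simp add: power3_eq_cube power2_eq_square mult_ac)
      have "(1 * \<bar>l X\<bar>) * (\<bar>t * l X\<bar>^2 / 2) = t\<^sup>2 * \<bar>l X\<bar>^3 / 2"
        by (simp add: l3 power_mult_distrib)
      moreover have "(\<bar>t\<bar> * 1 * (l X)\<^sup>2) * \<bar>t * l X\<bar> = (\<bar>t\<bar> * \<bar>t\<bar>) * (\<bar>l X\<bar> * (l X)\<^sup>2)"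
        by (simp only: abs_mult mult_ac mult_1_right)
      then have "(\<bar>t\<bar> * 1 * (l X)\<^sup>2) * \<bar>t * l X\<bar> = t\<^sup>2 * \<bar>l X\<bar>^3"
        by (simp add: l3 power2_eq_square)
      ultimately have "cmod (r1 X) + cmod (r2 X) \<le> 3 / 2 * (t\<^sup>2 * \<bar>l X\<bar>^3)"
        by simp
      also have "\<dots> \<le> 2 * (t\<^sup>2 * \<bar>l X\<bar>^3)"
        by (intro mult_right_mono) auto
      finally show "cmod (r1 X + r2 X) \<le> 2 * t\<^sup>2 * \<bar>l X\<bar>^3"
        using norm_triangle_ineq[of "r1 X" "r2 X"] by (simp add: mult.assoc)
    qed
    finally show ?thesis by (simp add: l_def)
  qed
  \<comment> \<open>The mean of \<open>V\<close> is the sum of \<open>w e * w f * (h e f)^2\<close>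
    over ordered pairs, which is twice the variance of \<open>U\<close>. The target value 2
    therefore stands for unit variance.\<close>
  define V where "V = (\<lambda>X. \<Sum>e\<in>J. w e * (lin J (h e) X)\<^sup>2)"
  define S where "S = (\<Sum>e\<in>J. expect (\<lambda>X. (Y e X * lin J (h e) X) *\<^sub>R \<phi> X)
        - (\<i> * t) * expect (\<lambda>X. (w e * (lin J (h e) X)\<^sup>2) *\<^sub>R \<phi> X))"
  define R where "R = expect (\<lambda>X. (V X - 2) *\<^sub>R \<phi> X)"
  have main: "expect (\<lambda>X. \<i> * U X * \<phi> X) + t * expect \<phi> = \<i> / 2 * S - complex_of_real t / 2 * R"
  proof -
    have f1: "(\<Sum>e\<in>J. expect (\<lambda>X. (Y e X * lin J (h e) X) *\<^sub>R \<phi> X)) = expect (\<lambda>X. 2 * U X * \<phi> X)"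
      unfolding expect_sum[symmetric] U_def
      by (simp add: scaleR_conv_of_real sum_distrib_right)
    have f2: "(\<Sum>e\<in>J. expect (\<lambda>X. (w e * (lin J (h e) X)\<^sup>2) *\<^sub>R \<phi> X)) = expect (\<lambda>X. V X *\<^sub>R \<phi> X)"
      unfolding expect_sum[symmetric] V_def
      by (simp add: scaleR_conv_of_real sum_distrib_right)
    have f3: "R = expect (\<lambda>X. V X *\<^sub>R \<phi> X) - 2 * expect \<phi>"
      unfolding R_def
      by (simp only: scaleR_diff_left expect_diff integral_scaleR_right) (simp add: scaleR_conv_of_real)
    have f4: "expect (\<lambda>X. 2 * U X * \<phi> X) = 2 * expect (\<lambda>X. U X * \<phi> X)"
      by (simp add: mult.assoc)
    have f5: "expect (\<lambda>X. \<i> * U X * \<phi> X) = \<i> * expect (\<lambda>X. U X * \<phi> X)"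
      by (simp add: mult.assoc)
    have alg: "\<i> * x + t * z = \<i> / 2 * (2 * x - (\<i> * t) * y) - complex_of_real t / 2 * (y - 2 * z)"
      for x y z :: complex
    proof -
      have "\<i> * (\<i> * t * y) = - (t * y)"
        by (simp only: mult.assoc[symmetric]) simp
      then show ?thesis
        by (simp only: right_diff_distrib) simp
    qed
    have S: "S = 2 * expect (\<lambda>X. U X * \<phi> X) - (\<i> * t) * expect (\<lambda>X. V X *\<^sub>R \<phi> X)"
      unfolding S_def sum_subtractf f1 f4 f2[symmetric] sum_distrib_left ..
    show ?thesis
      unfolding f3 f5 S by (rule alg)
  qed
  have S_le: "cmod S \<le> 2 * t\<^sup>2 * (\<Sum>e\<in>J. expect (\<lambda>X. \<bar>lin J (h e) X\<bar>^3))"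
    unfolding S_def sum_distrib_left by (rule order.trans[OF norm_sum sum_mono[OF edge]])
  have "cmod R \<le> expect (\<lambda>X. cmod ((V X - 2) *\<^sub>R \<phi> X))"
    unfolding R_def by (rule integral_norm_bound)
  also have "\<dots> = expect (\<lambda>X. \<bar>V X - 2\<bar>)"
    by (simp add: n\<phi>)
  finally have R_le: "\<bar>t\<bar> / 2 * cmod R \<le> \<bar>t\<bar> / 2 * expect (\<lambda>X. \<bar>V X - 2\<bar>)"
    by (rule mult_left_mono) simp
  have "cmod (\<i> / 2 * S - complex_of_real t / 2 * R) \<le> cmod (\<i> / 2 * S) + cmod (complex_of_real t / 2 * R)"
    by (rule norm_triangle_ineq4)
  also have "\<dots> = 1 / 2 * cmod S + \<bar>t\<bar> / 2 * cmod R"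
    by (simp add: norm_mult norm_divide)
  finally show ?thesis
    unfolding main[unfolded \<phi>_def] using S_le R_le[unfolded V_def] by linarith
qed

text \<open>Integrating factor: \<open>G s = \<phi> s * exp (s^2 / 2)\<close> has as derivative the
  Stein residual times \<open>exp (s^2 / 2)\<close>. The mean value inequality between 0 and
  \<open>t\<close> costs \<open>exp (t^2 / 2)\<close>, which cancels on returning to
  \<open>\<phi>\<close>, so the bound stays polynomial in \<open>t\<close>.\<close>

theorem quadratic_form_char_bound:
  fixes h :: "'a \<Rightarrow> 'a \<Rightarrow> real" and J
  defines "U \<equiv> \<lambda>X. (\<Sum>e\<in>J. Y e X * lin J (h e) X) / 2"
  assumes J: "J \<subseteq> I" and h: "\<And>e f. h e f = h f e" "\<And>e. h e e = 0"
    and a: "expect (\<lambda>X. \<bar>(\<Sum>e\<in>J. w e * (lin J (h e) X)\<^sup>2) - 2\<bar>) \<le> a"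
    and b: "(\<Sum>e\<in>J. expect (\<lambda>X. \<bar>lin J (h e) X\<bar>^3)) \<le> b"
  shows "cmod (expect (\<lambda>X. iexp (t * U X)) - of_real (exp (- t\<^sup>2 / 2))) \<le> t\<^sup>2 * a + \<bar>t\<bar>^3 * b"
proof -
  define \<phi> where "\<phi> = (\<lambda>t. expect (\<lambda>X. iexp (t * U X)))"
  define \<phi>' where "\<phi>' = (\<lambda>t. expect (\<lambda>X. \<i> * U X * iexp (t * U X)))"
  have d\<phi>: "(\<phi> has_vector_derivative \<phi>' t) (at t within S)" for t S
    unfolding \<phi>_def \<phi>'_def
  proof (rule expect_has_vector_derivative)
    fix X
    have d: "((\<lambda>t. t * U X) has_vector_derivative U X) (at t within S)"
      by (auto intro!: derivative_eq_intros simp flip: has_real_derivative_iff_has_vector_derivative)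
    show "((\<lambda>t. iexp (t * U X)) has_vector_derivative \<i> * U X * iexp (t * U X)) (at t within S)"
      using vector_diff_chain_within[OF d has_vector_derivative_iexp]
      by (simp add: o_def scaleR_conv_of_real mult_ac)
  qed
  have a0: "0 \<le> a" using a by (rule order.trans[rotated]) (auto intro!: Bochner_Integration.integral_nonneg)
  have b0: "0 \<le> b" using b by (rule order.trans[rotated]) (auto intro!: sum_nonneg Bochner_Integration.integral_nonneg)
  have stein: "cmod (\<phi>' s + s * \<phi> s) \<le> \<bar>s\<bar> * a + s\<^sup>2 * b" for s
  proof -
    have "cmod (\<phi>' s + s * \<phi> s) \<le> \<bar>s\<bar> / 2 * a + s\<^sup>2 * b"
      unfolding \<phi>_def \<phi>'_def U_def
      by (rule order.trans[OF quadratic_form_stein[OF J h]])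
        (intro add_mono mult_left_mono a b; simp)+
    also have "\<dots> \<le> \<bar>s\<bar> * a + s\<^sup>2 * b" using a0 by (simp add: mult_right_mono)
    finally show ?thesis .
  qed
  define G where "G = (\<lambda>s. \<phi> s * of_real (exp (s\<^sup>2 / 2)))"
  let ?S = "{-\<bar>t\<bar>..\<bar>t\<bar>}"
  define C where "C = (\<bar>t\<bar> * a + t\<^sup>2 * b) * exp (t\<^sup>2 / 2)"
  have dG: "(G has_vector_derivative (\<phi>' s + s * \<phi> s) * of_real (exp (s\<^sup>2 / 2))) (at s within ?S)" for s
  proof -
    have "((\<lambda>s. exp (s\<^sup>2 / 2)) has_real_derivative s * exp (s\<^sup>2 / 2)) (at s within ?S)"
      by (auto intro!: derivative_eq_intros)
    then have "((\<lambda>s. complex_of_real (exp (s\<^sup>2 / 2))) has_vector_derivative of_real (s * exp (s\<^sup>2 / 2))) (at s within ?S)"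
      by (intro has_vector_derivative_of_real) (simp add: has_real_derivative_iff_has_vector_derivative)
    from has_vector_derivative_mult[OF d\<phi>[of s ?S] this] show ?thesis
      unfolding G_def by (simp add: algebra_simps)
  qed
  have "norm (G t - G 0) \<le> C * norm (t - 0)"
  proof (rule differentiable_bound[where S = ?S])
    show "(G has_derivative (\<lambda>x. x *\<^sub>R ((\<phi>' s + s * \<phi> s) * of_real (exp (s\<^sup>2 / 2))))) (at s within ?S)" for s
      using dG[of s] by (simp add: has_vector_derivative_def)
    fix s assume s: "s \<in> ?S"
    then have st: "\<bar>s\<bar> \<le> \<bar>t\<bar>" "s\<^sup>2 \<le> t\<^sup>2" by (auto simp: abs_le_square_iff[symmetric])
    have "norm ((\<phi>' s + s * \<phi> s) * of_real (exp (s\<^sup>2 / 2))) \<le> (\<bar>s\<bar> * a + s\<^sup>2 * b) * exp (s\<^sup>2 / 2)"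
      using stein[of s] by (simp add: norm_mult)
    also have "\<dots> \<le> C"
      unfolding C_def using st a0 b0 by (intro mult_mono add_mono) auto
    finally show "onorm (\<lambda>x. x *\<^sub>R ((\<phi>' s + s * \<phi> s) * of_real (exp (s\<^sup>2 / 2)))) \<le> C"
      by (intro onorm_le) (simp add: mult.commute[of C] mult_left_mono)
  qed auto
  moreover have "G 0 = 1" by (simp add: G_def \<phi>_def)
  moreover have "\<phi> t - of_real (exp (- t\<^sup>2 / 2)) = (G t - 1) * of_real (exp (- t\<^sup>2 / 2))"
    by (simp add: G_def ring_distribs mult.assoc flip: exp_add of_real_mult)
  ultimately have "cmod (\<phi> t - of_real (exp (- t\<^sup>2 / 2))) \<le> C * \<bar>t\<bar> * exp (- t\<^sup>2 / 2)"
    by (simp add: norm_mult)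
  also have "\<dots> = t\<^sup>2 * a + \<bar>t\<bar>^3 * b"
  proof -
    have "exp (t\<^sup>2 / 2) * exp (- t\<^sup>2 / 2) = 1"
      by (simp flip: exp_add)
    then have "C * \<bar>t\<bar> * exp (- t\<^sup>2 / 2) = (\<bar>t\<bar> * a + t\<^sup>2 * b) * \<bar>t\<bar>"
      unfolding C_def by (simp add: mult_ac)
    also have "\<dots> = t\<^sup>2 * a + \<bar>t\<bar>^3 * b"
      by (simp add: power3_eq_cube power2_eq_square ring_distribs abs_mult_self_eq)
    finally show ?thesis .
  qed
  finally show ?thesis by (simp add: \<phi>_def)
qed

end

section \<open>The logistic function\<close>

definition logistic :: "real \<Rightarrow> real" where
  "logistic x = exp x / (1 + exp x)"

definition softplus :: "real \<Rightarrow> real" where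
  "softplus x = ln (1 + exp x)"

definition logistic_var :: "real \<Rightarrow> real" where
  "logistic_var x = logistic x * (1 - logistic x)"

lemma logistic_pos: "0 < logistic x" and logistic_less_1: "logistic x < 1"
  by (auto simp: logistic_def add_pos_pos divide_less_eq)

lemma logistic_var_pos: "0 < logistic_var x"
  using logistic_pos[of x] logistic_less_1[of x] by (simp add: logistic_var_def)

lemma logistic_var_le: "logistic_var x \<le> 1 / 4"
proof -
  have "0 \<le> (logistic x - 1 / 2)\<^sup>2" by simp
  then show ?thesis by (simp add: logistic_var_def power2_eq_square algebra_simps)
qed

text \<open>\<open>logistic_var x\<close> equals \<open>1 / (2 + exp x + exp (- x))\<close>, and the
  denominator is at most \<open>4 * exp K\<close>.\<close>

lemma logistic_var_ge:
  assumes "\<bar>x\<bar> \<le> K"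
  shows "exp (- K) / 4 \<le> logistic_var x"
proof -
  have pos: "0 < 1 + exp x" by (simp add: add_pos_pos)
  have eq: "logistic_var x = 1 / (2 + exp x + exp (- x))"
  proof -
    have "exp x * (2 + exp x + exp (- x)) = (1 + exp x)\<^sup>2"
      by (simp add: power2_eq_square algebra_simps flip: exp_add)
    moreover have "logistic_var x = exp x / (1 + exp x)\<^sup>2"
      using pos by (simp add: logistic_var_def logistic_def field_simps power2_eq_square)
    ultimately show ?thesis
      by (metis exp_not_eq_zero mult_divide_mult_cancel_left nonzero_mult_div_cancel_left mult.right_neutral)
  qed
  have "exp x \<le> exp K" "exp (- x) \<le> exp K" "1 \<le> exp K"
    using assms by auto
  then have "2 + exp x + exp (- x) \<le> 4 * exp K" by linarith
  then have "1 / (4 * exp K) \<le> logistic_var x"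
    unfolding eq by (intro divide_left_mono) (auto intro!: mult_pos_pos add_pos_pos)
  then show ?thesis by (simp add: exp_minus field_simps)
qed

lemma DERIV_softplus: "(softplus has_real_derivative logistic x) (at x)"
  unfolding softplus_def[abs_def] logistic_def
  by (auto intro!: derivative_eq_intros simp: add_pos_pos)

lemma DERIV_logistic: "(logistic has_real_derivative logistic_var x) (at x)"
proof -
  have "1 + exp x \<noteq> 0" using exp_gt_zero[of x] by linarith
  then show ?thesis
    unfolding logistic_def[abs_def] logistic_var_def logistic_def
    by (auto intro!: derivative_eq_intros simp: field_simps)
qed

lemma DERIV_logistic_var:
  "(logistic_var has_real_derivative logistic_var x * (1 - 2 * logistic x)) (at x)"
  unfolding logistic_var_def[abs_def]
  by (rule derivative_eq_intros DERIV_logistic refl)+ (simp add: logistic_var_def algebra_simps)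

lemma DERIV_logistic_var2:
  "((\<lambda>x. logistic_var x * (1 - 2 * logistic x)) has_real_derivative
     logistic_var x * (1 - 2 * logistic x)\<^sup>2 - 2 * (logistic_var x)\<^sup>2) (at x)"
  by (rule derivative_eq_intros DERIV_logistic DERIV_logistic_var refl)+
    (simp add: power2_eq_square algebra_simps)

text \<open>The expression is the third derivative of \<open>softplus\<close>; the next lemma treats
  the fourth. The constant 1 is crude, since only orders of magnitude matter below.\<close>

lemma abs_logistic_third_le: "\<bar>logistic_var x * (1 - 2 * logistic x)\<bar> \<le> 1"
proof -
  have "\<bar>logistic_var x\<bar> * \<bar>1 - 2 * logistic x\<bar> \<le> 1 * 1"
    using logistic_pos[of x] logistic_less_1[of x] logistic_var_pos[of x] logistic_var_le[of x]
    by (intro mult_mono) auto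
  then show ?thesis by (simp add: abs_mult)
qed

lemma abs_logistic_fourth_le: "\<bar>logistic_var x * (1 - 2 * logistic x)\<^sup>2 - 2 * (logistic_var x)\<^sup>2\<bar> \<le> 1"
proof -
  have v: "0 \<le> logistic_var x" "logistic_var x \<le> 1 / 4"
    using logistic_var_pos[of x] logistic_var_le[of x] by auto
  have "\<bar>1 - 2 * logistic x\<bar> \<le> 1"
    using logistic_pos[of x] logistic_less_1[of x] by auto
  then have "(1 - 2 * logistic x)\<^sup>2 \<le> 1"
    using abs_square_le_1 by blast
  then have "logistic_var x * (1 - 2 * logistic x)\<^sup>2 \<le> 1 / 4 * 1"
    using v by (intro mult_mono) auto
  moreover have "(logistic_var x)\<^sup>2 \<le> (1 / 4)\<^sup>2"
    using v by (intro power_mono) auto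
  moreover have "0 \<le> logistic_var x * (1 - 2 * logistic x)\<^sup>2"
    using v by simp
  moreover have "0 \<le> (logistic_var x)\<^sup>2" "(1 / 4)\<^sup>2 = (1 / 16 :: real)"
    by (simp_all add: power2_eq_square)
  ultimately show ?thesis
    by linarith
qed

lemma DERIV_shift_comp:
  assumes "\<And>x. (f has_real_derivative f' x) (at x)"
  shows "((\<lambda>t. f (x + t)) has_real_derivative f' (x + t)) (at t)"
  using DERIV_shift[of f "f' (x + t)" t x] assms[of "x + t"] by (simp add: add.commute)

lemma logistic_taylor: "\<bar>logistic (x + h) - logistic x - logistic_var x * h\<bar> \<le> h\<^sup>2 / 2"
proof -
  define diff where "diff = (\<lambda>m::nat. if m = 0 then (\<lambda>t. logistic (x + t)) else
    if m = 1 then (\<lambda>t. logistic_var (x + t)) else (\<lambda>t. logistic_var (x + t) * (1 - 2 * logistic (x + t))))"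
  have "\<exists>t. \<bar>t\<bar> \<le> \<bar>h\<bar> \<and> logistic (x + h) = (\<Sum>m<2. diff m 0 / fact m * h ^ m) + diff 2 t / fact 2 * h ^ 2"
    by (rule Maclaurin_bi_le)
      (auto simp: diff_def less_2_cases_iff intro: DERIV_shift_comp DERIV_logistic DERIV_logistic_var)
  then obtain t where t: "logistic (x + h) = (\<Sum>m<2. diff m 0 / fact m * h ^ m) + diff 2 t / fact 2 * h ^ 2"
    by blast
  have "logistic (x + h) - logistic x - logistic_var x * h =
      (logistic_var (x + t) * (1 - 2 * logistic (x + t))) * (h\<^sup>2 / 2)"
    unfolding t by (simp add: diff_def numeral_2_eq_2)
  then show ?thesis
    using mult_right_mono[OF abs_logistic_third_le[of "x + t"], of "h\<^sup>2 / 2"]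
    by (simp only: abs_mult) simp
qed

lemma softplus_taylor2:
  obtains t where "\<bar>t\<bar> \<le> \<bar>h\<bar>"
    and "softplus (x + h) - softplus x - logistic x * h = logistic_var (x + t) * h\<^sup>2 / 2"
proof -
  define diff where "diff = (\<lambda>m::nat. if m = 0 then (\<lambda>t. softplus (x + t)) else
    if m = 1 then (\<lambda>t. logistic (x + t)) else (\<lambda>t. logistic_var (x + t)))"
  have "\<exists>t. \<bar>t\<bar> \<le> \<bar>h\<bar> \<and> softplus (x + h) = (\<Sum>m<2. diff m 0 / fact m * h ^ m) + diff 2 t / fact 2 * h ^ 2"
    by (rule Maclaurin_bi_le)
      (auto simp: diff_def less_2_cases_iff intro: DERIV_shift_comp DERIV_logistic DERIV_softplus)
  then obtain t where t: "\<bar>t\<bar> \<le> \<bar>h\<bar>"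
    "softplus (x + h) = (\<Sum>m<2. diff m 0 / fact m * h ^ m) + diff 2 t / fact 2 * h ^ 2"
    by blast
  show ?thesis
    by (rule that[OF t(1)]) (unfold t(2), simp add: diff_def numeral_2_eq_2)
qed

lemma softplus_taylor2_le: "\<bar>softplus (x + h) - softplus x - logistic x * h\<bar> \<le> h\<^sup>2 / 8"
proof -
  obtain t where t: "softplus (x + h) - softplus x - logistic x * h = logistic_var (x + t) * h\<^sup>2 / 2"
    by (rule softplus_taylor2)
  have "logistic_var (x + t) * h\<^sup>2 \<le> 1 / 4 * h\<^sup>2"
    using logistic_var_le by (intro mult_right_mono) auto
  then show ?thesis
    unfolding t using logistic_var_pos[of "x + t"] by (simp add: abs_mult)
qed

text \<open>The hypothesis keeps the segment from \<open>x\<close> to \<open>x + h\<close> inside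
  \<open>[-K, K]\<close>, where the second derivative is at least
  \<open>exp (- K) / 4\<close>.\<close>

lemma softplus_strongly_convex:
  assumes "\<bar>x\<bar> + \<bar>h\<bar> \<le> K"
  shows "softplus x + logistic x * h + exp (- K) / 8 * h\<^sup>2 \<le> softplus (x + h)"
proof -
  obtain t where t: "\<bar>t\<bar> \<le> \<bar>h\<bar>"
    "softplus (x + h) - softplus x - logistic x * h = logistic_var (x + t) * h\<^sup>2 / 2"
    by (rule softplus_taylor2)
  have "\<bar>x + t\<bar> \<le> K" using assms t(1) by linarith
  then have "exp (- K) / 4 * h\<^sup>2 \<le> logistic_var (x + t) * h\<^sup>2"
    by (intro mult_right_mono logistic_var_ge) auto
  then show ?thesis using t(2) by simp
qed

lemma softplus_convex: "convex_on UNIV softplus"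
  by (rule convex_on_realI[of _ _ logistic])
    (auto intro!: DERIV_softplus has_real_derivative_imp_continuous_on
      DERIV_nonneg_imp_nondecreasing[of _ _ logistic] simp: logistic_var_pos less_imp_le
      intro: exI[of _ "logistic_var _"] DERIV_logistic)

lemma softplus_taylor4:
  "\<bar>softplus (x + h) - softplus x - logistic x * h - logistic_var x / 2 * h\<^sup>2
     - logistic_var x * (1 - 2 * logistic x) / 6 * h^3\<bar> \<le> h^4 / 24"
proof -
  define diff where "diff = (\<lambda>m::nat. if m = 0 then (\<lambda>t. softplus (x + t)) else
    if m = 1 then (\<lambda>t. logistic (x + t)) else if m = 2 then (\<lambda>t. logistic_var (x + t))
    else if m = 3 then (\<lambda>t. logistic_var (x + t) * (1 - 2 * logistic (x + t)))
    else (\<lambda>t. logistic_var (x + t) * (1 - 2 * logistic (x + t))\<^sup>2 - 2 * (logistic_var (x + t))\<^sup>2))"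
  have m4: "m < 4 \<longleftrightarrow> m = 0 \<or> m = 1 \<or> m = 2 \<or> m = 3" for m :: nat
    by auto
  have "\<exists>t. \<bar>t\<bar> \<le> \<bar>h\<bar> \<and> softplus (x + h) = (\<Sum>m<4. diff m 0 / fact m * h ^ m) + diff 4 t / fact 4 * h ^ 4"
    by (rule Maclaurin_bi_le)
      (auto simp: diff_def m4 intro: DERIV_shift_comp DERIV_logistic DERIV_softplus DERIV_logistic_var
        DERIV_shift_comp[where f = "\<lambda>x. logistic_var x * (1 - 2 * logistic x)", OF DERIV_logistic_var2])
  then obtain t where t: "softplus (x + h) = (\<Sum>m<4. diff m 0 / fact m * h ^ m) + diff 4 t / fact 4 * h ^ 4"
    by blast
  have sum4: "(\<Sum>m<4. g m) = g 0 + g 1 + g 2 + g 3" for g :: "nat \<Rightarrow> real"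
    by (simp add: eval_nat_numeral)
  have facts: "fact 3 = (6::real)" "fact 4 = (24::real)" by (simp_all add: fact_numeral)
  have "softplus (x + h) - softplus x - logistic x * h - logistic_var x / 2 * h\<^sup>2
     - logistic_var x * (1 - 2 * logistic x) / 6 * h^3 =
      (logistic_var (x + t) * (1 - 2 * logistic (x + t))\<^sup>2 - 2 * (logistic_var (x + t))\<^sup>2) * (h^4 / 24)"
    unfolding t sum4 by (simp add: diff_def facts)
  then show ?thesis
    using mult_right_mono[OF abs_logistic_fourth_le[of "x + t"], of "h^4 / 24"]
    by (simp only: abs_mult) simp
qed

section \<open>Hyperedges of a fixed size\<close>

definition edges :: "nat \<Rightarrow> nat \<Rightarrow> nat set set" where
  "edges n s = {e. e \<subseteq> {1..n} \<and> card e = s}"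

lemma finite_edges [simp, intro]: "finite (edges n s)"
  by (rule finite_subset[of _ "Pow {1..n}"]) (auto simp: edges_def)

lemma edgesD:
  assumes "e \<in> edges n s"
  shows "finite e" "e \<subseteq> {1..n}" "card e = s"
  using assms by (auto simp: edges_def intro: finite_subset)

lemma card_edges_containing:
  assumes T: "T \<subseteq> {1..n}" "card T \<le> s"
  shows "card {e \<in> edges n s. T \<subseteq> e} = (n - card T) choose (s - card T)"
proof -
  have fT: "finite T" using T(1) finite_subset by blast
  have "bij_betw (\<lambda>e. e - T) {e \<in> edges n s. T \<subseteq> e} {f. f \<subseteq> {1..n} - T \<and> card f = s - card T}"
  proof (rule bij_betw_byWitness[where f' = "\<lambda>f. f \<union> T"])
    show "(\<lambda>e. e - T) ` {e \<in> edges n s. T \<subseteq> e} \<subseteq> {f. f \<subseteq> {1..n} - T \<and> card f = s - card T}"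
      by (auto simp: edges_def card_Diff_subset fT)
    show "(\<lambda>f. f \<union> T) ` {f. f \<subseteq> {1..n} - T \<and> card f = s - card T} \<subseteq> {e \<in> edges n s. T \<subseteq> e}"
    proof clarify
      fix f assume f: "f \<subseteq> {1..n} - T" "card f = s - card T"
      then have "card (f \<union> T) = card f + card T"
        by (intro card_Un_disjoint fT) (auto intro: finite_subset)
      then show "f \<union> T \<in> edges n s \<and> T \<subseteq> f \<union> T"
        using f T by (auto simp: edges_def)
    qed
  qed auto
  then have "card {e \<in> edges n s. T \<subseteq> e} = card {f. f \<subseteq> {1..n} - T \<and> card f = s - card T}"
    by (rule bij_betw_same_card)
  also have "\<dots> = (n - card T) choose (s - card T)"
    using T fT by (subst n_subsets) (auto simp: card_Diff_subset)
  finally show ?thesis .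
qed

lemma sum_edges_swap:
  fixes g :: "nat \<Rightarrow> nat set \<Rightarrow> real"
  shows "(\<Sum>e\<in>edges n s. \<Sum>v\<in>e. g v e) = (\<Sum>v\<in>{1..n}. \<Sum>e\<in>{e \<in> edges n s. v \<in> e}. g v e)"
proof -
  have "(\<Sum>v\<in>e. g v e) = (\<Sum>v\<in>{v \<in> {1..n}. v \<in> e}. g v e)" if "e \<in> edges n s" for e
    using edgesD[OF that] by (intro sum.cong) auto
  then have "(\<Sum>e\<in>edges n s. \<Sum>v\<in>e. g v e) = (\<Sum>e\<in>edges n s. \<Sum>v\<in>{v \<in> {1..n}. v \<in> e}. g v e)"
    by (rule sum.cong[OF refl])
  also have "\<dots> = (\<Sum>v\<in>{1..n}. \<Sum>e\<in>{e \<in> edges n s. v \<in> e}. g v e)"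
    by (rule sum.swap_restrict) auto
  finally show ?thesis .
qed

text \<open>The condition \<open>2 * s \<le> n\<close> holds for all large \<open>n\<close> and
  yields \<open>2 * D2 \<le> D\<close>, so that \<open>D - D2\<close>, the constant of strong
  convexity, is of order \<open>D\<close>.\<close>

locale layer_size =
  fixes n s :: nat
  assumes s_ge_2: "2 \<le> s" and n_ge: "2 * s \<le> n"
begin

abbreviation E :: "nat set set" where "E \<equiv> edges n s"

text \<open>Degree of a vertex and codegree of a pair in the complete \<open>s\<close>-uniform
  hypergraph. The ratio \<open>D2 / D = (s - 1) / (n - 1)\<close> is what makes the Fisher
  information nearly diagonal.\<close>

definition D :: real where "D = real ((n - 1) choose (s - 1))"
definition D2 :: real where "D2 = real ((n - 2) choose (s - 2))"

lemma card_edges_vertex: "v \<in> {1..n} \<Longrightarrow> real (card {e \<in> E. v \<in> e}) = D"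
  using card_edges_containing[of "{v}" n s] s_ge_2 by (simp add: D_def)

lemma card_edges_pair: "u \<in> {1..n} \<Longrightarrow> v \<in> {1..n} \<Longrightarrow> u \<noteq> v \<Longrightarrow> real (card {e \<in> E. u \<in> e \<and> v \<in> e}) = D2"
  using card_edges_containing[of "{u, v}" n s] s_ge_2 by (simp add: D2_def numeral_2_eq_2)

lemma real_s: "2 \<le> real s" and real_n: "2 * real s \<le> real n"
  using s_ge_2 n_ge by linarith+

lemma D2_ge_1: "1 \<le> D2"
  using s_ge_2 n_ge by (simp add: D2_def Suc_le_eq zero_less_binomial_iff)

lemma D_D2: "(real s - 1) * D = (real n - 1) * D2"
proof -
  have "Suc (s - 2) * (Suc (n - 2) choose Suc (s - 2)) = Suc (n - 2) * ((n - 2) choose (s - 2))"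
    by (rule Suc_times_binomial)
  moreover have "Suc (s - 2) = s - 1" "Suc (n - 2) = n - 1" using s_ge_2 n_ge by auto
  ultimately have "real (s - 1) * D = real (n - 1) * D2"
    unfolding D_def D2_def by (metis of_nat_mult)
  then show ?thesis using s_ge_2 n_ge by (simp add: of_nat_diff)
qed

lemma n_D2_le: "real n * D2 \<le> real s * D"
proof -
  have "(real n - 1) * (real n * D2) = real n * (real s - 1) * D"
    using D_D2 by (simp add: mult_ac)
  also have "\<dots> \<le> (real n - 1) * real s * D"
  proof (rule mult_right_mono)
    show "real n * (real s - 1) \<le> (real n - 1) * real s"
      using real_n real_s by (simp add: algebra_simps)
  qed (simp add: D_def)
  finally have "(real n - 1) * (real n * D2) \<le> (real n - 1) * (real s * D)" by (simp add: mult_ac)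
  then show ?thesis using real_n real_s by simp
qed

text \<open>The degree grows at least linearly in \<open>n\<close>. For \<open>s = 2\<close> this is
  its true order, so \<open>n / D\<close> cannot be treated as small in any estimate.\<close>

lemma n_le: "real n \<le> real s * D"
  using n_D2_le mult_left_mono[OF D2_ge_1, of "real n"] by simp

lemma D2_le: "D2 \<le> real s * D / real n"
  using n_D2_le real_n real_s by (simp add: field_simps)

lemma D_ge_1: "1 \<le> D"
  using s_ge_2 n_ge by (simp add: D_def Suc_le_eq zero_less_binomial_iff)

lemma D_pos: "0 < D" using D_ge_1 by simp

lemma two_D2_le: "2 * D2 \<le> D"
proof -
  have "2 * real s * D2 \<le> real n * D2"
    using real_n D2_ge_1 by (intro mult_right_mono) auto
  then have "real s * (2 * D2) \<le> real s * D" using n_D2_le by (simp add: mult_ac)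
  then show ?thesis using real_s by simp
qed

lemma card_E: "real s * real (card E) = real n * D"
proof -
  have "real s * real (card E) = (\<Sum>e\<in>E. \<Sum>v\<in>e. 1)"
    using edgesD by (simp add: mult.commute)
  also have "\<dots> = (\<Sum>v\<in>{1..n}. real (card {e \<in> E. v \<in> e}))"
    unfolding sum_edges_swap by simp
  also have "\<dots> = real n * D"
    by (subst sum.cong[OF refl card_edges_vertex]) auto
  finally show ?thesis .
qed

lemma card_E_le: "real (card E) \<le> real n * D" and card_E_le': "real (card E) \<le> D\<^sup>2"
proof -
  have "real s * real (card E) \<le> real s * D\<^sup>2"
    unfolding card_E using mult_right_mono[OF n_le, of D] D_pos by (simp add: power2_eq_square mult_ac)
  then show "real (card E) \<le> D\<^sup>2" using real_s by simp
  have "1 * real (card E) \<le> real s * real (card E)"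
    using real_s by (intro mult_right_mono) auto
  then show "real (card E) \<le> real n * D" unfolding card_E by simp
qed

lemma card_edges_meeting:
  assumes "e \<in> E"
  shows "real (card {f \<in> E. e \<inter> f \<noteq> {}}) \<le> real s * D"
proof -
  have "{f \<in> E. e \<inter> f \<noteq> {}} = (\<Union>v\<in>e. {f \<in> E. v \<in> f})" by auto
  then have "card {f \<in> E. e \<inter> f \<noteq> {}} \<le> (\<Sum>v\<in>e. card {f \<in> E. v \<in> f})"
    using edgesD[OF assms] by (simp add: card_UN_le)
  then have "real (card {f \<in> E. e \<inter> f \<noteq> {}}) \<le> (\<Sum>v\<in>e. real (card {f \<in> E. v \<in> f}))"
    by (simp flip: of_nat_sum)
  also have "\<dots> = (\<Sum>v\<in>e. D)"
    using edgesD[OF assms] by (intro sum.cong refl card_edges_vertex) auto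
  finally show ?thesis using edgesD[OF assms] by simp
qed

text \<open>Double counting gives the exact value \<open>(D - D2) * (\<Sum>v. (\<delta> v)^2) + D2 *
  (\<Sum>v. \<delta> v)^2\<close>, whose second term is dropped.\<close>

lemma sum_edge_squares_ge:
  "(D - D2) * (\<Sum>v\<in>{1..n}. (\<delta> v)\<^sup>2) \<le> (\<Sum>e\<in>E. (\<Sum>v\<in>e. \<delta> v)\<^sup>2)"
proof -
  have "(\<Sum>e\<in>E. (\<Sum>v\<in>e. \<delta> v)\<^sup>2) = (\<Sum>e\<in>E. \<Sum>u\<in>e. \<Sum>v\<in>{1..n}. if v \<in> e then \<delta> u * \<delta> v else 0)"
  proof (rule sum.cong[OF refl])
    fix e assume "e \<in> E"
    then have "(\<Sum>v\<in>{1..n}. if v \<in> e then \<delta> u * \<delta> v else 0) = (\<Sum>v\<in>e. \<delta> u * \<delta> v)" for u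
      using edgesD[of e] by (intro sum.mono_neutral_cong_right) auto
    then show "(\<Sum>v\<in>e. \<delta> v)\<^sup>2 = (\<Sum>u\<in>e. \<Sum>v\<in>{1..n}. if v \<in> e then \<delta> u * \<delta> v else 0)"
      by (simp add: power2_eq_square sum_product)
  qed
  also have "\<dots> = (\<Sum>u\<in>{1..n}. \<Sum>v\<in>{1..n}. \<Sum>e\<in>{e \<in> E. u \<in> e}. if v \<in> e then \<delta> u * \<delta> v else 0)"
    unfolding sum_edges_swap by (intro sum.cong refl sum.swap)
  also have "\<dots> = (\<Sum>u\<in>{1..n}. \<Sum>v\<in>{1..n}. (if u = v then D - D2 else 0) * (\<delta> u * \<delta> v) + D2 * (\<delta> u * \<delta> v))"
  proof (intro sum.cong refl)
    fix u v assume uv: "u \<in> {1..n}" "v \<in> {1..n}"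
    have "(\<Sum>e\<in>{e \<in> E. u \<in> e}. if v \<in> e then \<delta> u * \<delta> v else 0) = (\<Sum>e\<in>{e \<in> E. u \<in> e \<and> v \<in> e}. \<delta> u * \<delta> v)"
      by (intro sum.mono_neutral_cong_right) auto
    also have "\<dots> = real (card {e \<in> E. u \<in> e \<and> v \<in> e}) * (\<delta> u * \<delta> v)" by simp
    also have "real (card {e \<in> E. u \<in> e \<and> v \<in> e}) = (if u = v then D - D2 else 0) + D2"
      using card_edges_vertex[OF uv(1)] card_edges_pair[OF uv] by auto
    finally show "(\<Sum>e\<in>{e \<in> E. u \<in> e}. if v \<in> e then \<delta> u * \<delta> v else 0) =
        (if u = v then D - D2 else 0) * (\<delta> u * \<delta> v) + D2 * (\<delta> u * \<delta> v)"
      by (simp only: ring_distribs)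
  qed
  also have "\<dots> = (D - D2) * (\<Sum>v\<in>{1..n}. (\<delta> v)\<^sup>2) + D2 * (\<Sum>v\<in>{1..n}. \<delta> v)\<^sup>2"
  proof -
    have "(\<Sum>u\<in>{1..n}. \<Sum>v\<in>{1..n}. (if u = v then D - D2 else 0) * (\<delta> u * \<delta> v)) =
        (D - D2) * (\<Sum>v\<in>{1..n}. (\<delta> v)\<^sup>2)"
      by (simp add: if_distrib[where f = "\<lambda>x. x * _"] power2_eq_square sum_distrib_left sum.delta cong: if_cong)
    moreover have "(\<Sum>u\<in>{1..n}. \<Sum>v\<in>{1..n}. D2 * (\<delta> u * \<delta> v)) = D2 * (\<Sum>v\<in>{1..n}. \<delta> v)\<^sup>2"
    proof -
      have "(\<Sum>v\<in>{1..n}. \<delta> v)\<^sup>2 = (\<Sum>u\<in>{1..n}. \<Sum>v\<in>{1..n}. \<delta> u * \<delta> v)"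
        unfolding power2_eq_square by (rule sum_product)
      then show ?thesis
        by (simp only: sum_distrib_left[symmetric])
    qed
    ultimately show ?thesis
      by (simp only: sum.distrib)
  qed
  finally show ?thesis using D2_ge_1 by simp
qed

end

section \<open>The approximate Newton step\<close>

lemma square_add_le: "(x + y)\<^sup>2 \<le> 2 * x\<^sup>2 + 2 * (y::real)\<^sup>2"
  using zero_le_power2[of "x - y"] by (simp add: power2_eq_square algebra_simps)

text \<open>Arithmetic-geometric mean inequality for \<open>x^2 / m\<close> and
  \<open>m * x^4\<close>; it is sharp when \<open>m\<close> is about \<open>1 / |x|\<close>.\<close>

lemma abs_cube_le:
  fixes x m :: real
  assumes "0 < m"
  shows "\<bar>x\<bar>^3 \<le> (x\<^sup>2 / m + m * x^4) / 2"
proof -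
  have "0 \<le> (1 - m * \<bar>x\<bar>)\<^sup>2 * (x\<^sup>2 / m)"
    using assms by simp
  also have "\<dots> = x\<^sup>2 / m + m * x^4 - 2 * \<bar>x\<bar>^3"
  proof -
    have "\<bar>x\<bar>^3 = \<bar>x\<bar> * x\<^sup>2" "x^4 = x\<^sup>2 * x\<^sup>2"
      by (simp_all add: power3_eq_cube power2_eq_square power4_eq_xxxx mult_ac)
    moreover have "(1 - m * \<bar>x\<bar>)\<^sup>2 = 1 - 2 * m * \<bar>x\<bar> + m\<^sup>2 * x\<^sup>2"
      by (simp add: power2_diff power_mult_distrib)
    ultimately show ?thesis
      using assms by (simp add: field_simps power2_eq_square)
  qed
  finally show ?thesis by simp
qed

text \<open>\<open>I\<close> carries the hyperedges of all layers, and only those in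
  \<open>E\<close> have probabilities tied to \<gamma>. The constants of this locale are functions
  of \<open>s\<close> and \<open>c\<close>, hence uniform in \<open>n\<close> and \<gamma>.\<close>

locale beta_layer = bernoulli_family I p + layer_size n s
  for I :: "nat set set" and p n s +
  fixes \<gamma> :: "nat \<Rightarrow> real" and c :: real
  assumes edges_subset: "E \<subseteq> I"
    and p_eq: "e \<in> E \<Longrightarrow> p e = logistic (\<Sum>v\<in>e. \<gamma> v)"
    and c_pos: "0 < c" and w_ge: "e \<in> E \<Longrightarrow> c \<le> w e"
begin

text \<open>
  \<open>A\<close> is the Fisher information matrix of the layer at \<open>\<gamma>\<close>, \<open>a\<close> its diagonal, and the score \<open>Z\<close> is the
  vector of centred degrees. \<open>\<epsilon>\<close> is the Newton step with \<open>A\<close> replaced by its diagonal; it changes the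
  linear predictor of the hyperedge \<open>e\<close> by \<open>\<xi> e\<close>.
\<close>

definition A :: "nat \<Rightarrow> nat \<Rightarrow> real" where
  "A u v = (\<Sum>e\<in>{e \<in> E. u \<in> e \<and> v \<in> e}. w e)"

definition a :: "nat \<Rightarrow> real" where
  "a v = (\<Sum>e\<in>{e \<in> E. v \<in> e}. w e)"

definition Z :: "nat \<Rightarrow> (nat set \<Rightarrow> bool) \<Rightarrow> real" where
  "Z v = lin E (\<lambda>e. of_bool (v \<in> e))"

definition \<epsilon> :: "nat \<Rightarrow> (nat set \<Rightarrow> bool) \<Rightarrow> real" where
  "\<epsilon> v X = Z v X / a v"

definition \<xi> :: "nat set \<Rightarrow> (nat set \<Rightarrow> bool) \<Rightarrow> real" where
  "\<xi> e X = (\<Sum>v\<in>e. \<epsilon> v X)"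

text \<open>The kernel of \<open>\<xi> e\<close> as a linear form in the centred indicators.\<close>

definition k :: "nat set \<Rightarrow> nat set \<Rightarrow> real" where
  "k e f = (\<Sum>v\<in>e \<inter> f. 1 / a v)"

text \<open>Scale-free constants: \<open>k e f \<le> kap / D\<close>, and the squares
  \<open>(k e f)^2\<close> sum over \<open>f\<close> to at most \<open>tau / D\<close>, because at
  most \<open>s * D\<close> hyperedges meet \<open>e\<close>.\<close>

definition kap :: real where "kap = real s / c"
definition tau :: real where "tau = real s * kap\<^sup>2"

lemma kap_pos: "0 < kap"
  using c_pos real_s by (simp add: kap_def)

lemma tau_pos: "0 < tau" using kap_pos real_s by (simp add: tau_def)

section \<open>Size of the Fisher information entries and of the kernel\<close>

lemma a_ge: "v \<in> {1..n} \<Longrightarrow> c * D \<le> a v"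
  using sum_bounded_below[of "{e \<in> E. v \<in> e}" c w] w_ge card_edges_vertex[of v]
  by (simp add: a_def mult.commute)

lemma cD_pos: "0 < c * D" using c_pos D_pos by simp

lemma a_pos: "v \<in> {1..n} \<Longrightarrow> 0 < a v"
  using a_ge cD_pos by fastforce

lemma inverse_a_le: "v \<in> {1..n} \<Longrightarrow> 1 / a v \<le> 1 / (c * D)"
  using a_ge a_pos cD_pos by (intro divide_left_mono) auto

lemma A_diag: "A v v = a v"
  by (simp add: A_def a_def)

lemma A_ge_0: "0 \<le> A u v"
  unfolding A_def using w_ge_0 edges_subset by (intro sum_nonneg) auto

lemma A_le: "u \<in> {1..n} \<Longrightarrow> v \<in> {1..n} \<Longrightarrow> u \<noteq> v \<Longrightarrow> A u v \<le> real s * D / real n"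
  using sum_bounded_above[of "{e \<in> E. u \<in> e \<and> v \<in> e}" w 1] w_le_1 card_edges_pair[of u v] D2_le
  by (simp add: A_def)

lemma k_ge_0: "e \<in> E \<Longrightarrow> 0 \<le> k e f"
  unfolding k_def using edgesD(2)[of e] a_pos by (intro sum_nonneg) (simp add: less_imp_le subset_iff)

lemma k_commute: "k e f = k f e"
  by (simp add: k_def Int_commute)

lemma k_disjoint: "e \<inter> f = {} \<Longrightarrow> k e f = 0"
  by (simp add: k_def)

lemma k_le: assumes "e \<in> E" shows "k e f \<le> kap / D"
proof -
  have "k e f \<le> real (card (e \<inter> f)) * (1 / (c * D))"
    unfolding k_def using edgesD[OF assms] by (intro sum_bounded_above inverse_a_le) auto
  also have "\<dots> \<le> real s * (1 / (c * D))"
    using edgesD[OF assms] cD_pos card_mono[of e "e \<inter> f"] by (intro mult_right_mono) auto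
  finally show ?thesis by (simp add: kap_def)
qed

lemma sum_meeting_le:
  assumes e: "e \<in> E" and "\<And>f. f \<in> E \<Longrightarrow> e \<inter> f \<noteq> {} \<Longrightarrow> g f \<le> b" and "\<And>f. f \<in> E \<Longrightarrow> e \<inter> f = {} \<Longrightarrow> g f = 0"
    and "0 \<le> b"
  shows "(\<Sum>f\<in>E. g f) \<le> real s * D * b"
proof -
  have "(\<Sum>f\<in>E. g f) = (\<Sum>f\<in>{f \<in> E. e \<inter> f \<noteq> {}}. g f)"
    using assms by (intro sum.mono_neutral_right) auto
  also have "\<dots> \<le> real (card {f \<in> E. e \<inter> f \<noteq> {}}) * b"
    using assms by (intro sum_bounded_above) auto
  also have "\<dots> \<le> real s * D * b"
    using card_edges_meeting[OF e] assms by (intro mult_right_mono) auto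
  finally show ?thesis .
qed

lemma sum_k_square_le: assumes "e \<in> E" shows "(\<Sum>f\<in>E. (k e f)\<^sup>2) \<le> tau / D"
proof -
  have "(\<Sum>f\<in>E. (k e f)\<^sup>2) \<le> real s * D * (kap / D)\<^sup>2"
    using k_ge_0 k_le assms by (intro sum_meeting_le) (auto simp: k_disjoint intro!: power_mono)
  also have "\<dots> = tau / D"
    using D_pos by (simp add: tau_def power2_eq_square field_simps)
  finally show ?thesis .
qed

lemma sum_k_cube_le: assumes "e \<in> E" shows "(\<Sum>f\<in>E. \<bar>k e f\<bar>^3) \<le> real s * kap^3 / D\<^sup>2"
proof -
  have "(\<Sum>f\<in>E. \<bar>k e f\<bar>^3) \<le> real s * D * (kap / D)^3"
    using k_ge_0 k_le assms kap_pos D_pos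
    by (intro sum_meeting_le) (auto simp: k_disjoint intro!: power_mono)
  also have "\<dots> = real s * kap^3 / D\<^sup>2"
    using D_pos by (simp add: power2_eq_square power3_eq_cube field_simps)
  finally show ?thesis .
qed

text \<open>The coordinates of \<open>\<epsilon>\<close> are dependent. Interchanging sums rewrites
  their combinations over the independent hyperedge indicators, where the moment bounds
  apply.\<close>

lemma lin_combine:
  assumes "finite S"
  shows "(\<Sum>v\<in>S. \<alpha> v * \<epsilon> v X) = lin E (\<lambda>f. \<Sum>v\<in>S \<inter> f. \<alpha> v / a v) X"
proof -
  have "(\<Sum>v\<in>S. \<alpha> v * \<epsilon> v X) = (\<Sum>v\<in>S. \<Sum>f\<in>E. (if v \<in> f then \<alpha> v / a v else 0) * Y f X)"
    unfolding \<epsilon>_def Z_def lin_def sum_divide_distrib sum_distrib_left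
    by (intro sum.cong refl) simp
  also have "\<dots> = (\<Sum>f\<in>E. \<Sum>v\<in>S. (if v \<in> f then \<alpha> v / a v else 0) * Y f X)"
    by (rule sum.swap)
  also have "\<dots> = (\<Sum>f\<in>E. (\<Sum>v\<in>S \<inter> f. \<alpha> v / a v) * Y f X)"
    unfolding sum_distrib_right[symmetric] using assms
    by (intro sum.cong[OF refl] arg_cong2[where f = "(*)"] refl) (simp add: sum.inter_restrict)
  finally show ?thesis by (simp add: lin_def)
qed

lemma \<xi>_eq_lin: "e \<in> E \<Longrightarrow> \<xi> e = lin E (k e)"
  using lin_combine[of e "\<lambda>_. 1"] edgesD(1)
  by (simp add: \<xi>_def[abs_def] k_def[abs_def] fun_eq_iff)

lemma expect_\<xi>2_le: assumes "e \<in> E" shows "expect (\<lambda>X. (\<xi> e X)\<^sup>2) \<le> tau / D"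
  unfolding \<xi>_eq_lin[OF assms]
  using expect_lin_square_le[OF edges_subset] sum_k_square_le[OF assms] by (rule order.trans)

lemma expect_\<xi>4_le: assumes "e \<in> E" shows "expect (\<lambda>X. (\<xi> e X)^4) \<le> 3 * tau\<^sup>2 / D\<^sup>2"
proof -
  have "(\<Sum>f\<in>E. (k e f)\<^sup>2)\<^sup>2 \<le> (tau / D)\<^sup>2"
    using sum_k_square_le[OF assms] by (intro power_mono sum_nonneg) auto
  then show ?thesis
    unfolding \<xi>_eq_lin[OF assms]
    using expect_lin_fourth_le[OF edges_subset, of "k e"] by (simp add: power_divide)
qed

lemma abs_expect_\<xi>3_le: assumes "e \<in> E" shows "\<bar>expect (\<lambda>X. (\<xi> e X)^3)\<bar> \<le> real s * kap^3 / D\<^sup>2"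
  unfolding \<xi>_eq_lin[OF assms]
  using expect_lin_cube_le[OF edges_subset] sum_k_cube_le[OF assms] by (rule order.trans)

lemma sum_of_bool_edges:
  assumes "v \<in> {1..n}"
  shows "(\<Sum>e\<in>E. of_bool (v \<in> e)) = D"
  using card_edges_vertex[OF assms] by (simp add: sum.If_cases of_bool_def Int_def)

lemma expect_\<epsilon>4_le: assumes "v \<in> {1..n}" shows "expect (\<lambda>X. (\<epsilon> v X)^4) \<le> 3 / (c\<^sup>2 * D)\<^sup>2"
proof -
  have "\<epsilon> v X = lin E (\<lambda>e. of_bool (v \<in> e) / a v) X" for X
    unfolding \<epsilon>_def Z_def lin_def sum_divide_distrib by simp
  moreover have "(\<Sum>e\<in>E. (of_bool (v \<in> e) / a v)\<^sup>2) \<le> 1 / (c\<^sup>2 * D)"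
  proof -
    have "(\<Sum>e\<in>E. (of_bool (v \<in> e) / a v)\<^sup>2) = (\<Sum>e\<in>E. of_bool (v \<in> e)) * (1 / a v)\<^sup>2"
      unfolding sum_distrib_right by (intro sum.cong refl) (simp add: power_divide)
    also have "\<dots> \<le> D * (1 / (c * D))\<^sup>2"
      unfolding sum_of_bool_edges[OF assms] using inverse_a_le[OF assms] a_pos[OF assms] D_pos
      by (intro mult_left_mono power_mono) auto
    also have "\<dots> = 1 / (c\<^sup>2 * D)"
      using D_pos by (simp add: power2_eq_square field_simps)
    finally show ?thesis .
  qed
  then have "(\<Sum>e\<in>E. (of_bool (v \<in> e) / a v)\<^sup>2)\<^sup>2 \<le> (1 / (c\<^sup>2 * D))\<^sup>2"
    by (intro power_mono sum_nonneg) auto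
  ultimately show ?thesis
    using expect_lin_fourth_le[OF edges_subset, of "\<lambda>e. of_bool (v \<in> e) / a v"]
    by (simp add: power_divide)
qed

text \<open>\<open>(\<Sum>u. A u v * \<epsilon> u) = Z v + off v\<close>: the first-order part of
  the score that a step with the diagonal alone leaves uncancelled.\<close>

definition off :: "nat \<Rightarrow> (nat set \<Rightarrow> bool) \<Rightarrow> real" where
  "off v X = (\<Sum>u\<in>{1..n} - {v}. A u v * \<epsilon> u X)"

text \<open>A hyperedge has only \<open>s\<close> vertices, so its coefficient in
  \<open>off v\<close> is of order \<open>1 / n\<close>, and \<open>n * D / s\<close> independent
  terms give variance of order \<open>D / n\<close>. Bounding the summands of \<open>off v\<close>
  one by one would only give \<open>D\<close>.\<close>

lemma expect_off2_le:
  assumes v: "v \<in> {1..n}"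
  shows "expect (\<lambda>X. (off v X)\<^sup>2) \<le> real s * kap\<^sup>2 * D / real n"
proof -
  define h where "h = (\<lambda>f. \<Sum>u\<in>({1..n} - {v}) \<inter> f. A u v / a u)"
  have off: "off v = lin E h"
    unfolding off_def[abs_def] h_def by (intro ext lin_combine) simp
  have n: "0 < real n" using real_n real_s by linarith
  have h_le: "\<bar>h e\<bar> \<le> real s * kap / real n" if e: "e \<in> E" for e
  proof -
    have u: "A u v / a u \<le> kap / real n" "0 \<le> A u v / a u" if "u \<in> {1..n} - {v}" for u
    proof -
      have "A u v * (1 / a u) \<le> (real s * D / real n) * (1 / (c * D))"
        using that v A_le[of u v] inverse_a_le[of u] a_pos[of u] A_ge_0 cD_pos D_pos
        by (intro mult_mono) auto
      also have "\<dots> = kap / real n" using D_pos by (simp add: kap_def)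
      finally show "A u v / a u \<le> kap / real n" by simp
      show "0 \<le> A u v / a u" using A_ge_0 a_pos[of u] that by simp
    qed
    have "0 \<le> h e" unfolding h_def using u by (intro sum_nonneg) auto
    moreover have "h e \<le> real (card (({1..n} - {v}) \<inter> e)) * (kap / real n)"
      unfolding h_def using u by (intro sum_bounded_above) auto
    moreover have "\<dots> \<le> real s * (kap / real n)"
      using edgesD[OF e] card_mono[of e "({1..n} - {v}) \<inter> e"] kap_pos by (intro mult_right_mono) auto
    ultimately show ?thesis by simp
  qed
  have "expect (\<lambda>X. (off v X)\<^sup>2) \<le> (\<Sum>e\<in>E. (h e)\<^sup>2)"
    unfolding off by (rule expect_lin_square_le[OF edges_subset])
  also have "\<dots> \<le> real (card E) * (real s * kap / real n)\<^sup>2"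
  proof (rule sum_bounded_above)
    fix e assume "e \<in> E"
    from power_mono[OF h_le[OF this], of 2] show "(h e)\<^sup>2 \<le> (real s * kap / real n)\<^sup>2" by simp
  qed
  also have "\<dots> = (real s * real (card E)) * real s * kap\<^sup>2 / (real n)\<^sup>2"
    by (simp add: power_divide power_mult_distrib power2_eq_square)
  also have "\<dots> = real s * kap\<^sup>2 * D / real n"
    unfolding card_E using n by (simp add: power2_eq_square)
  finally show ?thesis .
qed

section \<open>Size of the score after the step\<close>

definition gam :: "nat set \<Rightarrow> real" where
  "gam e = (\<Sum>v\<in>e. \<gamma> v)"

lemma p_logistic: "e \<in> E \<Longrightarrow> p e = logistic (gam e)"
  by (simp add: p_eq gam_def)

lemma w_logistic: "e \<in> E \<Longrightarrow> w e = logistic_var (gam e)"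
  by (simp add: w_def logistic_var_def p_logistic)

text \<open>The score after the step \<open>\<epsilon>\<close>.\<close>

definition r :: "nat \<Rightarrow> (nat set \<Rightarrow> bool) \<Rightarrow> real" where
  "r v X = Z v X - (\<Sum>f\<in>{f \<in> E. v \<in> f}. logistic (gam f + \<xi> f X) - logistic (gam f))"

lemma sum_w_\<xi>:
  assumes v: "v \<in> {1..n}"
  shows "(\<Sum>f\<in>{f \<in> E. v \<in> f}. w f * \<xi> f X) = Z v X + off v X"
proof -
  have "(\<Sum>f\<in>{f \<in> E. v \<in> f}. w f * \<xi> f X) = (\<Sum>f\<in>E. \<Sum>u\<in>f. if v \<in> f then w f * \<epsilon> u X else 0)"
    by (rule sum.mono_neutral_cong_left) (auto simp: \<xi>_def sum_distrib_left)
  also have "\<dots> = (\<Sum>u\<in>{1..n}. \<Sum>f\<in>{f \<in> E. u \<in> f}. if v \<in> f then w f * \<epsilon> u X else 0)"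
    by (rule sum_edges_swap)
  also have "\<dots> = (\<Sum>u\<in>{1..n}. A u v * \<epsilon> u X)"
    unfolding A_def sum_distrib_right
    by (intro sum.cong refl sum.mono_neutral_cong_right) auto
  also have "\<dots> = A v v * \<epsilon> v X + off v X"
    unfolding off_def using v by (intro sum.remove) auto
  also have "A v v * \<epsilon> v X = Z v X"
    using a_pos[OF v] by (simp add: A_diag \<epsilon>_def)
  finally show ?thesis .
qed

text \<open>Taylor expansion of the logistic function: the linear part is
  \<open>Z v + off v\<close>, whose first term cancels the score at \<gamma>, and the remainder is
  quadratic in \<open>\<xi>\<close>.\<close>

lemma abs_r_le:
  assumes v: "v \<in> {1..n}"
  shows "\<bar>r v X\<bar> \<le> \<bar>off v X\<bar> + (\<Sum>f\<in>{f \<in> E. v \<in> f}. (\<xi> f X)\<^sup>2) / 2"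
proof -
  let ?S = "{f \<in> E. v \<in> f}"
  have "r v X + off v X = - (\<Sum>f\<in>?S. logistic (gam f + \<xi> f X) - logistic (gam f) - w f * \<xi> f X)"
    unfolding r_def using sum_w_\<xi>[OF v, of X] by (simp add: sum_subtractf)
  also have "\<bar>\<dots>\<bar> \<le> (\<Sum>f\<in>?S. \<bar>logistic (gam f + \<xi> f X) - logistic (gam f) - w f * \<xi> f X\<bar>)"
    unfolding abs_minus_cancel by (rule sum_abs)
  also have "\<dots> \<le> (\<Sum>f\<in>?S. (\<xi> f X)\<^sup>2 / 2)"
    using logistic_taylor by (intro sum_mono) (simp only: w_logistic mem_Collect_eq)
  finally show ?thesis by (simp add: sum_divide_distrib)
qed

text \<open>Small compared with the variance \<open>a v\<close> of \<open>Z v\<close>, which is of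
  order \<open>D\<close>: \<open>off v\<close> contributes \<open>D / n\<close>, and the
  \<open>D\<close> squares \<open>(\<xi> f)^2\<close> of order \<open>1 / D\<close> contribute a
  constant by Cauchy-Schwarz.\<close>

lemma expect_r2_le:
  assumes v: "v \<in> {1..n}"
  shows "expect (\<lambda>X. (r v X)\<^sup>2) \<le> 2 * real s * kap\<^sup>2 * D / real n + 3 / 2 * tau\<^sup>2"
proof -
  let ?S = "{f \<in> E. v \<in> f}"
  have "(r v X)\<^sup>2 \<le> 2 * (off v X)\<^sup>2 + D / 2 * (\<Sum>f\<in>?S. (\<xi> f X)^4)" for X
  proof -
    have "(r v X)\<^sup>2 \<le> (\<bar>off v X\<bar> + (\<Sum>f\<in>?S. (\<xi> f X)\<^sup>2) / 2)\<^sup>2"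
      using power_mono[OF abs_r_le[OF v, of X], of 2] by simp
    also have "\<dots> \<le> 2 * (off v X)\<^sup>2 + 2 * ((\<Sum>f\<in>?S. (\<xi> f X)\<^sup>2) / 2)\<^sup>2"
      using square_add_le[of "\<bar>off v X\<bar>"] by simp
    also have "((\<Sum>f\<in>?S. (\<xi> f X)\<^sup>2) / 2)\<^sup>2 \<le> (D * (\<Sum>f\<in>?S. (\<xi> f X)^4)) / 4"
      using sum_squared_le_sum_of_squares[of "\<lambda>f. (\<xi> f X)\<^sup>2" ?S] card_edges_vertex[OF v]
      by (simp add: power_divide mult.commute flip: power_mult)
    finally show ?thesis by simp
  qed
  then have "expect (\<lambda>X. (r v X)\<^sup>2) \<le> expect (\<lambda>X. 2 * (off v X)\<^sup>2 + D / 2 * (\<Sum>f\<in>?S. (\<xi> f X)^4))"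
    by (rule expect_mono)
  also have "\<dots> = 2 * expect (\<lambda>X. (off v X)\<^sup>2) + D / 2 * (\<Sum>f\<in>?S. expect (\<lambda>X. (\<xi> f X)^4))"
    by simp
  also have "\<dots> \<le> 2 * (real s * kap\<^sup>2 * D / real n) + D / 2 * (D * (3 * tau\<^sup>2 / D\<^sup>2))"
  proof (intro add_mono mult_left_mono expect_off2_le[OF v])
    have "(\<Sum>f\<in>?S. expect (\<lambda>X. (\<xi> f X)^4)) \<le> real (card ?S) * (3 * tau\<^sup>2 / D\<^sup>2)"
      by (intro sum_bounded_above expect_\<xi>4_le) auto
    then show "(\<Sum>f\<in>?S. expect (\<lambda>X. (\<xi> f X)^4)) \<le> D * (3 * tau\<^sup>2 / D\<^sup>2)"
      unfolding card_edges_vertex[OF v] .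
  qed (use D_pos in auto)
  also have "\<dots> = 2 * real s * kap\<^sup>2 * D / real n + 3 / 2 * tau\<^sup>2"
    using D_pos by (simp add: power2_eq_square)
  finally show ?thesis .
qed

definition C_r :: real where "C_r = 2 * real s * kap\<^sup>2 + 3 / 2 * real s * tau\<^sup>2"

lemma expect_sum_r2_le: "expect (\<lambda>X. \<Sum>v\<in>{1..n}. (r v X)\<^sup>2) \<le> C_r * D"
proof -
  have n: "0 < real n" using real_n real_s by linarith
  have "expect (\<lambda>X. \<Sum>v\<in>{1..n}. (r v X)\<^sup>2) = (\<Sum>v\<in>{1..n}. expect (\<lambda>X. (r v X)\<^sup>2))"
    by simp
  also have "\<dots> \<le> real (card {1..n}) * (2 * real s * kap\<^sup>2 * D / real n + 3 / 2 * tau\<^sup>2)"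
    by (intro sum_bounded_above expect_r2_le)
  also have "\<dots> = 2 * real s * kap\<^sup>2 * D + real n * (3 / 2 * tau\<^sup>2)"
    using n by (simp add: field_simps)
  also have "\<dots> \<le> 2 * real s * kap\<^sup>2 * D + (real s * D) * (3 / 2 * tau\<^sup>2)"
    using n_le by (intro add_left_mono mult_right_mono) auto
  also have "\<dots> = C_r * D" by (simp add: C_r_def algebra_simps)
  finally show ?thesis .
qed

section \<open>Variance of the remainder of the likelihood gain\<close>

lemma flip_abs_le: "\<bar>of_bool b - of_bool b'\<bar> \<le> (1::real)"
  by (cases b; cases b') auto

lemma Z_upd:
  assumes "e \<in> E"
  shows "Z v (X(e := b)) = Z v X + (of_bool b - of_bool (X e)) * of_bool (v \<in> e)"
  unfolding Z_def by (rule lin_upd) (use assms in auto)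

lemma \<xi>_upd:
  assumes "e \<in> E" "f \<in> E"
  shows "\<xi> f (X(e := b)) = \<xi> f X + (of_bool b - of_bool (X e)) * k f e"
  unfolding \<xi>_eq_lin[OF assms(2)] by (rule lin_upd) (use assms in auto)

lemma Z_upd_other: "e \<notin> E \<Longrightarrow> Z v (X(e := b)) = Z v X"
  unfolding Z_def by (rule lin_upd_notin)

lemma \<epsilon>_upd_other: "e \<notin> E \<Longrightarrow> \<epsilon> v (X(e := b)) = \<epsilon> v X"
  by (simp add: \<epsilon>_def Z_upd_other)

lemma \<xi>_upd_other: "e \<notin> E \<Longrightarrow> \<xi> f (X(e := b)) = \<xi> f X"
  by (simp add: \<xi>_def \<epsilon>_upd_other)

text \<open>The Bregman divergence of \<open>softplus\<close> between \<open>gam f\<close> and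
  \<open>gam f + x\<close>.\<close>

definition g :: "nat set \<Rightarrow> real \<Rightarrow> real" where
  "g f x = softplus (gam f + x) - softplus (gam f) - logistic (gam f) * x"

text \<open>
  \<open>F\<close> is what the log-likelihood gain of the step \<open>\<epsilon>\<close> has beyond its leading term
  \<open>(\<Sum>v. Z v * \<epsilon> v) / 2\<close>. Flipping one hyperedge changes \<open>F\<close> by about the gradient \<open>r\<close> of
  the log-likelihood after the step, so the Efron--Stein inequality reduces its variance to the
  second moments of \<open>r\<close>.
\<close>

definition F :: "(nat set \<Rightarrow> bool) \<Rightarrow> real" where
  "F X = (\<Sum>v\<in>{1..n}. Z v X * \<epsilon> v X) / 2 - (\<Sum>f\<in>E. g f (\<xi> f X))"

text \<open>The Fisher quadratic form \<open>\<Sum>u v. A u v * \<epsilon> u * \<epsilon> v\<close>.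
  Half of it is the second-order Taylor term of the sum in \<open>F\<close>; it also governs the
  variance term in Stein's method.\<close>

definition q :: "(nat set \<Rightarrow> bool) \<Rightarrow> real" where
  "q X = (\<Sum>f\<in>E. w f * (\<xi> f X)\<^sup>2)"

lemma sum_k_edges:
  assumes "e \<in> E"
  shows "(\<Sum>f\<in>E. k f e * d f) = (\<Sum>v\<in>e. (\<Sum>f\<in>{f \<in> E. v \<in> f}. d f) / a v)"
proof -
  have "(\<Sum>f\<in>E. k f e * d f) = (\<Sum>f\<in>E. \<Sum>v\<in>{v \<in> e. v \<in> f}. d f / a v)"
    unfolding k_def sum_distrib_right by (intro sum.cong) auto
  also have "\<dots> = (\<Sum>v\<in>e. \<Sum>f\<in>{f \<in> E. v \<in> f}. d f / a v)"
    by (rule sum.swap_restrict) (use edgesD[OF assms] in auto)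
  finally show ?thesis by (simp add: sum_divide_distrib)
qed

lemma F_flip:
  assumes e: "e \<in> E"
  shows "\<bar>F (X(e := b)) - F X\<bar> \<le> (\<Sum>v\<in>e. \<bar>r v X\<bar>) / (c * D) + (kap / 2 + tau / 8) / D"
proof -
  define \<theta> :: real where "\<theta> = of_bool b - of_bool (X e)"
  have \<theta>: "\<bar>\<theta>\<bar> \<le> 1" "\<theta>\<^sup>2 \<le> 1"
    using flip_abs_le[of b "X e"] by (auto simp: \<theta>_def abs_square_le_1[symmetric])
  have ev: "v \<in> {1..n}" if "v \<in> e" for v using that edgesD[OF e] by auto
  define d where "d = (\<lambda>f. logistic (gam f + \<xi> f X) - logistic (gam f))"
  \<comment> \<open>Second-order remainder of \<open>g f\<close> at \<open>\<xi> f X\<close>, where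
    the slope of \<open>g f\<close> is \<open>d f\<close>.\<close>
  define R where "R = (\<lambda>f. g f (\<xi> f X + \<theta> * k f e) - g f (\<xi> f X) - \<theta> * k f e * d f)"
  have R: "\<bar>R f\<bar> \<le> (k e f)\<^sup>2 / 8" if "f \<in> E" for f
  proof -
    have "\<bar>R f\<bar> \<le> (\<theta> * k f e)\<^sup>2 / 8"
      using softplus_taylor2_le[of "gam f + \<xi> f X" "\<theta> * k f e"]
      by (simp add: R_def g_def d_def algebra_simps)
    also have "\<dots> \<le> (k e f)\<^sup>2 / 8"
      using \<theta> by (simp add: power_mult_distrib mult_left_le_one_le k_commute[of f e])
    finally show ?thesis .
  qed
  have "(\<Sum>v\<in>{1..n}. Z v (X(e := b)) * \<epsilon> v (X(e := b))) - (\<Sum>v\<in>{1..n}. Z v X * \<epsilon> v X) =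
      (\<Sum>v\<in>{1..n}. if v \<in> e then (2 * \<theta> * Z v X + \<theta>\<^sup>2) / a v else 0)"
    unfolding sum_subtractf[symmetric] \<epsilon>_def Z_upd[OF e] \<theta>_def[symmetric]
    by (intro sum.cong refl) (auto simp: power2_eq_square algebra_simps simp flip: add_divide_distrib diff_divide_distrib)
  also have "\<dots> = (\<Sum>v\<in>e. (2 * \<theta> * Z v X + \<theta>\<^sup>2) / a v)"
    by (rule sum.mono_neutral_cong_right) (use edgesD[OF e] in auto)
  also have "\<dots> = 2 * (\<theta> * (\<Sum>v\<in>e. Z v X / a v)) + \<theta>\<^sup>2 * (\<Sum>v\<in>e. 1 / a v)"
    unfolding sum_distrib_left sum.distrib[symmetric]
    by (intro sum.cong refl) (simp add: add_divide_distrib)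
  finally have q: "(\<Sum>v\<in>{1..n}. Z v (X(e := b)) * \<epsilon> v (X(e := b))) / 2 - (\<Sum>v\<in>{1..n}. Z v X * \<epsilon> v X) / 2 =
      \<theta> * (\<Sum>v\<in>e. Z v X / a v) + \<theta>\<^sup>2 / 2 * (\<Sum>v\<in>e. 1 / a v)"
    by simp
  have "(\<Sum>f\<in>E. g f (\<xi> f (X(e := b)))) - (\<Sum>f\<in>E. g f (\<xi> f X)) = (\<Sum>f\<in>E. \<theta> * (k f e * d f) + R f)"
    unfolding sum_subtractf[symmetric]
    by (intro sum.cong refl) (simp add: \<xi>_upd[OF e] R_def \<theta>_def)
  also have "\<dots> = \<theta> * (\<Sum>v\<in>e. (\<Sum>f\<in>{f \<in> E. v \<in> f}. d f) / a v) + (\<Sum>f\<in>E. R f)"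
    by (simp add: sum.distrib sum_k_edges[OF e] flip: sum_distrib_left)
  \<comment> \<open>The linear parts of the two halves, with coefficients \<open>Z v / a v\<close>
    and \<open>(\<Sum>f. d f) / a v\<close>, combine to \<open>r v / a v\<close>. Separate bounds
    would miss this cancellation.\<close>
  finally have eq: "F (X(e := b)) - F X = \<theta> * (\<Sum>v\<in>e. r v X / a v) + (\<theta>\<^sup>2 / 2 * (\<Sum>v\<in>e. 1 / a v) - (\<Sum>f\<in>E. R f))"
    using q unfolding F_def r_def d_def[symmetric]
    by (simp add: diff_divide_distrib sum_subtractf right_diff_distrib)
  have "\<bar>F (X(e := b)) - F X\<bar> \<le> \<bar>\<theta> * (\<Sum>v\<in>e. r v X / a v)\<bar> + (\<theta>\<^sup>2 / 2 * (\<Sum>v\<in>e. 1 / a v) + \<bar>\<Sum>f\<in>E. R f\<bar>)"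
  proof -
    have "0 \<le> \<theta>\<^sup>2 / 2 * (\<Sum>v\<in>e. 1 / a v)"
      using a_pos[OF ev] by (intro mult_nonneg_nonneg sum_nonneg) (auto simp: less_imp_le)
    then show ?thesis unfolding eq by linarith
  qed
  also have "\<dots> \<le> (\<Sum>v\<in>e. \<bar>r v X\<bar>) / (c * D) + (1 / 2 * (kap / D) + tau / D / 8)"
  proof (intro add_mono mult_mono)
    have "\<bar>\<theta> * (\<Sum>v\<in>e. r v X / a v)\<bar> \<le> 1 * (\<Sum>v\<in>e. \<bar>r v X / a v\<bar>)"
      unfolding abs_mult using \<theta> by (intro mult_mono sum_abs) auto
    also have "\<dots> \<le> (\<Sum>v\<in>e. \<bar>r v X\<bar> * (1 / (c * D)))"
    proof -
      have "\<bar>r v X / a v\<bar> \<le> \<bar>r v X\<bar> * (1 / (c * D))" if "v \<in> e" for v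
        using mult_left_mono[OF inverse_a_le[OF ev[OF that]], of "\<bar>r v X\<bar>"] a_pos[OF ev[OF that]]
        by (simp add: abs_divide)
      then show ?thesis by (simp add: sum_mono)
    qed
    finally show "\<bar>\<theta> * (\<Sum>v\<in>e. r v X / a v)\<bar> \<le> (\<Sum>v\<in>e. \<bar>r v X\<bar>) / (c * D)"
      by (simp flip: sum_divide_distrib)
    show "\<theta>\<^sup>2 / 2 \<le> 1 / 2" using \<theta> by simp
    show "(\<Sum>v\<in>e. 1 / a v) \<le> kap / D" using k_le[OF e, of e] by (simp add: k_def)
    show "0 \<le> (\<Sum>v\<in>e. 1 / a v)" using a_pos[OF ev] by (intro sum_nonneg) (auto simp: less_imp_le)
    have "\<bar>\<Sum>f\<in>E. R f\<bar> \<le> (\<Sum>f\<in>E. (k e f)\<^sup>2 / 8)"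
      by (rule order.trans[OF sum_abs sum_mono[OF R]])
    also have "\<dots> \<le> tau / D / 8"
      unfolding sum_divide_distrib[symmetric] using sum_k_square_le[OF e] by simp
    finally show "\<bar>\<Sum>f\<in>E. R f\<bar> \<le> tau / D / 8" .
  qed auto
  finally show ?thesis by (simp add: add_divide_distrib)
qed

definition V_F :: real where
  "V_F = 2 * real s * C_r / c\<^sup>2 + 2 * (kap / 2 + tau / 8)\<^sup>2"

text \<open>Up to constants the squared influence is \<open>(\<Sum>v\<in>e. (r v)^2) / D^2\<close>
  plus \<open>1 / D^2\<close>. Summing over hyperedges counts each vertex \<open>D\<close> times, so
  the bound \<open>C_r * D\<close> leaves a constant; the second part is paid by
  \<open>card E \<le> D^2\<close>.\<close>

lemma variance_F_le: "expect (\<lambda>X. (F X - expect F)\<^sup>2) \<le> V_F"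
proof -
  let ?K = "kap / 2 + tau / 8"
  have "expect (\<lambda>X. (F X - expect F)\<^sup>2) \<le> (\<Sum>e\<in>E. expect (\<lambda>X. (influence e F X)\<^sup>2))"
    by (rule efron_stein[OF edges_subset])
      (auto simp: F_def Z_upd_other \<epsilon>_upd_other \<xi>_upd_other intro!: sum.cong)
  also have "\<dots> = expect (\<lambda>X. \<Sum>e\<in>E. (influence e F X)\<^sup>2)" by simp
  also have "\<dots> \<le> expect (\<lambda>X. \<Sum>e\<in>E. 2 * real s / (c * D)\<^sup>2 * (\<Sum>v\<in>e. (r v X)\<^sup>2) + 2 * ?K\<^sup>2 / D\<^sup>2)"
  proof (intro expect_mono sum_mono)
    fix X e assume e: "e \<in> E"
    have "\<bar>influence e F X\<bar> \<le> (\<Sum>v\<in>e. \<bar>r v X\<bar>) / (c * D) + ?K / D"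
      by (rule abs_influence_le) (rule F_flip[OF e])
    from power_mono[OF this, of 2]
    have "(influence e F X)\<^sup>2 \<le> ((\<Sum>v\<in>e. \<bar>r v X\<bar>) / (c * D) + ?K / D)\<^sup>2" by simp
    also have "\<dots> \<le> 2 * ((\<Sum>v\<in>e. \<bar>r v X\<bar>) / (c * D))\<^sup>2 + 2 * (?K / D)\<^sup>2"
      by (rule square_add_le)
    also have "((\<Sum>v\<in>e. \<bar>r v X\<bar>) / (c * D))\<^sup>2 \<le> (real s * (\<Sum>v\<in>e. (r v X)\<^sup>2)) / (c * D)\<^sup>2"
      using sum_squared_le_sum_of_squares[of "\<lambda>v. \<bar>r v X\<bar>" e] edgesD[OF e]
      unfolding power_divide by (intro divide_right_mono) (simp_all add: mult.commute)
    finally show "(influence e F X)\<^sup>2 \<le> 2 * real s / (c * D)\<^sup>2 * (\<Sum>v\<in>e. (r v X)\<^sup>2) + 2 * ?K\<^sup>2 / D\<^sup>2"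
      by (simp add: power_divide)
  qed
  also have "\<dots> = 2 * real s / (c * D)\<^sup>2 * (D * expect (\<lambda>X. \<Sum>v\<in>{1..n}. (r v X)\<^sup>2)) + real (card E) * (2 * ?K\<^sup>2 / D\<^sup>2)"
  proof -
    have "(\<Sum>e\<in>E. \<Sum>v\<in>e. (r v X)\<^sup>2) = D * (\<Sum>v\<in>{1..n}. (r v X)\<^sup>2)" for X
      unfolding sum_edges_swap sum_distrib_left
      by (intro sum.cong refl) (use card_edges_vertex in simp)
    then have "(\<Sum>e\<in>E. 2 * real s / (c * D)\<^sup>2 * (\<Sum>v\<in>e. (r v X)\<^sup>2) + 2 * ?K\<^sup>2 / D\<^sup>2) =
        2 * real s / (c * D)\<^sup>2 * (D * (\<Sum>v\<in>{1..n}. (r v X)\<^sup>2)) + real (card E) * (2 * ?K\<^sup>2 / D\<^sup>2)" for X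
      by (simp only: sum.distrib sum_distrib_left[symmetric]) simp
    then show ?thesis by simp
  qed
  also have "\<dots> \<le> 2 * real s / (c * D)\<^sup>2 * (D * (C_r * D)) + D\<^sup>2 * (2 * ?K\<^sup>2 / D\<^sup>2)"
    using expect_sum_r2_le card_E_le' D_pos by (intro add_mono mult_left_mono mult_right_mono) auto
  also have "\<dots> = V_F"
    using D_pos c_pos by (simp add: V_F_def power_mult_distrib power2_eq_square)
  finally show ?thesis .
qed

section \<open>Means of \<open>q\<close> and \<open>F\<close>\<close>

lemma expect_Z_Z: "expect (\<lambda>X. Z u X * Z v X) = A u v"
  unfolding Z_def expect_lin_lin[OF edges_subset] A_def
  by (rule sum.mono_neutral_cong_right) auto

lemma expect_Z_\<epsilon>: "v \<in> {1..n} \<Longrightarrow> expect (\<lambda>X. Z v X * \<epsilon> v X) = 1"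
  using expect_Z_Z[of v v] a_pos[of v] by (simp add: \<epsilon>_def A_diag)

lemma expect_\<epsilon>_\<epsilon>: "expect (\<lambda>X. \<epsilon> u X * \<epsilon> v X) = A u v / (a u * a v)"
  using expect_Z_Z[of u v] by (simp add: \<epsilon>_def)

lemma q_eq: "q X = (\<Sum>v\<in>{1..n}. Z v X * \<epsilon> v X) + (\<Sum>v\<in>{1..n}. off v X * \<epsilon> v X)"
proof -
  have "q X = (\<Sum>f\<in>E. \<Sum>v\<in>f. w f * \<xi> f X * \<epsilon> v X)"
    unfolding q_def power2_eq_square
    by (intro sum.cong refl) (simp add: sum_distrib_left[symmetric] \<xi>_def[symmetric])
  also have "\<dots> = (\<Sum>v\<in>{1..n}. (Z v X + off v X) * \<epsilon> v X)"
    unfolding sum_edges_swap sum_distrib_right[symmetric] by (intro sum.cong refl) (simp only: sum_w_\<xi>)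
  finally show ?thesis by (simp add: ring_distribs sum.distrib)
qed

text \<open>The mean of \<open>q\<close> is \<open>\<Sum>u v. (A u v)^2 / (a u * a v)\<close>. The
  diagonal gives exactly \<open>n\<close>, and the fewer than \<open>n^2\<close> other terms are at
  most \<open>(kap / n)^2\<close> each.\<close>

lemma abs_expect_q_le: "\<bar>expect q - real n\<bar> \<le> kap\<^sup>2"
proof -
  have n: "0 < real n" using real_n real_s by linarith
  have "expect q = (\<Sum>v\<in>{1..n}. expect (\<lambda>X. Z v X * \<epsilon> v X)) + (\<Sum>v\<in>{1..n}. expect (\<lambda>X. off v X * \<epsilon> v X))"
    unfolding q_eq[abs_def] by simp
  also have "(\<Sum>v\<in>{1..n}. expect (\<lambda>X. Z v X * \<epsilon> v X)) = real n"
    by (simp add: expect_Z_\<epsilon>)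
  finally have "\<bar>expect q - real n\<bar> \<le> (\<Sum>v\<in>{1..n}. \<bar>expect (\<lambda>X. off v X * \<epsilon> v X)\<bar>)"
    by simp
  also have "\<dots> \<le> real (card {1..n}) * (kap\<^sup>2 / real n)"
  proof (rule sum_bounded_above)
    fix v assume v: "v \<in> {1..n}"
    have eq: "expect (\<lambda>X. off v X * \<epsilon> v X) = (\<Sum>u\<in>{1..n} - {v}. A u v * (A u v / (a u * a v)))"
      unfolding off_def sum_distrib_right by (simp add: mult.assoc expect_\<epsilon>_\<epsilon>)
    have "\<bar>expect (\<lambda>X. off v X * \<epsilon> v X)\<bar> \<le> (\<Sum>u\<in>{1..n} - {v}. \<bar>A u v * (A u v / (a u * a v))\<bar>)"
      unfolding eq by (rule sum_abs)
    also have "\<dots> \<le> real (card ({1..n} - {v})) * (kap\<^sup>2 / (real n)\<^sup>2)"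
    proof (rule sum_bounded_above)
      fix u assume u: "u \<in> {1..n} - {v}"
      have "A u v * A u v * (1 / a u) * (1 / a v) \<le>
          (real s * D / real n) * (real s * D / real n) * (1 / (c * D)) * (1 / (c * D))"
        using u v A_le[of u v] A_ge_0[of u v] inverse_a_le[of u] inverse_a_le[of v] a_pos[of u] a_pos[of v] cD_pos D_pos
        by (intro mult_mono mult_nonneg_nonneg) (auto intro: less_imp_le)
      also have "\<dots> = kap\<^sup>2 / (real n)\<^sup>2"
        using D_pos c_pos by (simp add: kap_def power2_eq_square)
      finally show "\<bar>A u v * (A u v / (a u * a v))\<bar> \<le> kap\<^sup>2 / (real n)\<^sup>2"
        using u v A_ge_0[of u v] a_pos[of u] a_pos[of v] by (simp add: abs_mult)
    qed
    also have "\<dots> \<le> real n * (kap\<^sup>2 / (real n)\<^sup>2)"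
      using card_Diff1_le[of "{1..n}" v] by (intro mult_right_mono) auto
    also have "\<dots> = kap\<^sup>2 / real n" using n by (simp add: power2_eq_square)
    finally show "\<bar>expect (\<lambda>X. off v X * \<epsilon> v X)\<bar> \<le> kap\<^sup>2 / real n" .
  qed
  also have "\<dots> = kap\<^sup>2" using n by simp
  finally show ?thesis .
qed

definition M_F :: real where
  "M_F = kap\<^sup>2 / 2 + real s * kap^3 / 6 + tau\<^sup>2 / 8"

text \<open>The second-order terms give \<open>(n - expect q) / 2\<close>. The cubic terms enter
  through the signed third moment, which like the fourth moment is of order \<open>D^-2\<close>, so
  that both sum to constants over \<open>card E \<le> D^2\<close> hyperedges.\<close>

lemma abs_expect_F_le: "\<bar>expect F\<bar> \<le> M_F"
proof -
  define \<kappa>3 where "\<kappa>3 = (\<lambda>f. logistic_var (gam f) * (1 - 2 * logistic (gam f)))"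
  have edge: "\<bar>expect (\<lambda>X. g f (\<xi> f X)) - w f / 2 * expect (\<lambda>X. (\<xi> f X)\<^sup>2)\<bar> \<le> (real s * kap^3 / 6 + tau\<^sup>2 / 8) / D\<^sup>2"
    if f: "f \<in> E" for f
  proof -
    have "\<bar>expect (\<lambda>X. g f (\<xi> f X) - w f / 2 * (\<xi> f X)\<^sup>2 - \<kappa>3 f / 6 * (\<xi> f X)^3)\<bar> \<le>
        expect (\<lambda>X. \<bar>g f (\<xi> f X) - w f / 2 * (\<xi> f X)\<^sup>2 - \<kappa>3 f / 6 * (\<xi> f X)^3\<bar>)"
      by (rule integral_abs_bound)
    also have "\<dots> \<le> expect (\<lambda>X. (\<xi> f X)^4 / 24)"
      unfolding g_def w_logistic[OF f] \<kappa>3_def by (intro expect_mono softplus_taylor4)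
    also have "\<dots> \<le> 3 * tau\<^sup>2 / D\<^sup>2 / 24"
      using expect_\<xi>4_le[OF f] by simp
    finally have 4: "\<bar>expect (\<lambda>X. g f (\<xi> f X)) - w f / 2 * expect (\<lambda>X. (\<xi> f X)\<^sup>2) - \<kappa>3 f / 6 * expect (\<lambda>X. (\<xi> f X)^3)\<bar>
        \<le> 3 * tau\<^sup>2 / D\<^sup>2 / 24"
      by simp
    have "\<bar>\<kappa>3 f\<bar> * \<bar>expect (\<lambda>X. (\<xi> f X)^3)\<bar> \<le> 1 * (real s * kap^3 / D\<^sup>2)"
      unfolding \<kappa>3_def using abs_logistic_third_le abs_expect_\<xi>3_le[OF f] by (intro mult_mono) auto
    then have "\<bar>\<kappa>3 f / 6 * expect (\<lambda>X. (\<xi> f X)^3)\<bar> \<le> real s * kap^3 / D\<^sup>2 / 6"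
      by (simp add: abs_mult)
    with 4 have "\<bar>expect (\<lambda>X. g f (\<xi> f X)) - w f / 2 * expect (\<lambda>X. (\<xi> f X)\<^sup>2)\<bar> \<le> 3 * tau\<^sup>2 / D\<^sup>2 / 24 + real s * kap^3 / D\<^sup>2 / 6"
      by linarith
    then show ?thesis by (simp add: add_divide_distrib)
  qed
  define S where "S = (\<Sum>f\<in>E. expect (\<lambda>X. g f (\<xi> f X)) - w f / 2 * expect (\<lambda>X. (\<xi> f X)\<^sup>2))"
  have "expect F = real n / 2 - (\<Sum>f\<in>E. expect (\<lambda>X. g f (\<xi> f X)))"
    unfolding F_def[abs_def] by (simp add: expect_Z_\<epsilon>)
  moreover have "expect q = (\<Sum>f\<in>E. w f * expect (\<lambda>X. (\<xi> f X)\<^sup>2))"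
    unfolding q_def[abs_def] by simp
  ultimately have "expect F = (real n - expect q) / 2 - S"
    by (simp add: S_def sum_subtractf sum_divide_distrib diff_divide_distrib)
  moreover have "\<bar>S\<bar> \<le> real s * kap^3 / 6 + tau\<^sup>2 / 8"
  proof -
    have "\<bar>S\<bar> \<le>
        (\<Sum>f\<in>E. (real s * kap^3 / 6 + tau\<^sup>2 / 8) / D\<^sup>2)"
      unfolding S_def by (rule order.trans[OF sum_abs sum_mono[OF edge]])
    also have "\<dots> \<le> D\<^sup>2 * ((real s * kap^3 / 6 + tau\<^sup>2 / 8) / D\<^sup>2)"
      unfolding sum_constant using card_E_le' kap_pos by (intro mult_right_mono) auto
    also have "\<dots> = real s * kap^3 / 6 + tau\<^sup>2 / 8" using D_pos by simp
    finally show ?thesis .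
  qed
  moreover have "\<bar>(real n - expect q) / 2\<bar> \<le> kap\<^sup>2 / 2"
    using abs_expect_q_le by (simp add: abs_minus_commute)
  ultimately show ?thesis
    using abs_triangle_ineq4[of "(real n - expect q) / 2" S] by (simp add: M_F_def)
qed

lemma expect_abs_F_le: "expect (\<lambda>X. \<bar>F X\<bar>) \<le> M_F + sqrt V_F"
proof -
  have "expect (\<lambda>X. \<bar>F X\<bar>) \<le> expect (\<lambda>X. M_F + \<bar>F X - expect F\<bar>)"
    using abs_expect_F_le by (intro expect_mono) linarith
  also have "\<dots> = M_F + expect (\<lambda>X. \<bar>F X - expect F\<bar>)" by simp
  finally show ?thesis using expect_abs_dev_le[OF variance_F_le] by simp
qed

section \<open>Concentration of \<open>q\<close>\<close>

definition K_q :: real where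
  "K_q = (real s)\<^sup>2 * kap\<^sup>2 * (8 * tau + 2 * kap\<^sup>2)"

text \<open>Flipping \<open>e\<close> moves \<open>\<xi> f\<close> only for the at most
  \<open>s * D\<close> hyperedges \<open>f\<close> meeting \<open>e\<close>, each by at most
  \<open>kap / D\<close>. As \<open>\<xi> f\<close> has size \<open>D^(-1/2)\<close>, so has the
  influence, and \<open>card E \<le> n * D\<close> gives a variance of order
  \<open>n\<close>.\<close>

lemma variance_q_le: "expect (\<lambda>X. (q X - expect q)\<^sup>2) \<le> K_q * real n"
proof -
  define N where "N = (\<lambda>e. {f \<in> E. e \<inter> f \<noteq> {}})"
  have N: "N e \<subseteq> E" "finite (N e)" for e by (auto simp: N_def)
  have "expect (\<lambda>X. (q X - expect q)\<^sup>2) \<le> (\<Sum>e\<in>E. expect (\<lambda>X. (influence e q X)\<^sup>2))"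
    by (rule efron_stein[OF edges_subset]) (auto simp: q_def \<xi>_upd_other intro!: sum.cong)
  also have "\<dots> \<le> real (card E) * (K_q / D)"
  proof (rule sum_bounded_above)
    fix e assume e: "e \<in> E"
    define B where "B = (\<lambda>X. real s * D * (\<Sum>f\<in>N e. (kap / D)\<^sup>2 * (8 * (\<xi> f X)\<^sup>2 + 2 * (kap / D)\<^sup>2)))"
    have "(influence e q X)\<^sup>2 \<le> B X" for X
    proof -
      have "\<bar>influence e q X\<bar> \<le> (\<Sum>f\<in>N e. kap / D * (2 * \<bar>\<xi> f X\<bar> + kap / D))"
      proof (rule abs_influence_le)
        fix b'
        define \<theta> :: real where "\<theta> = of_bool b' - of_bool (X e)"
        have \<theta>: "\<bar>\<theta>\<bar> \<le> 1" using flip_abs_le by (simp add: \<theta>_def)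
        have eq: "q (X(e := b')) - q X = (\<Sum>f\<in>E. w f * ((\<xi> f X + \<theta> * k f e)\<^sup>2 - (\<xi> f X)\<^sup>2))"
          unfolding q_def sum_subtractf[symmetric]
          by (intro sum.cong refl) (simp add: \<xi>_upd[OF e] \<theta>_def right_diff_distrib)
        have "\<bar>q (X(e := b')) - q X\<bar> \<le> (\<Sum>f\<in>E. \<bar>w f * ((\<xi> f X + \<theta> * k f e)\<^sup>2 - (\<xi> f X)\<^sup>2)\<bar>)"
          unfolding eq by (rule sum_abs)
        also have "\<dots> = (\<Sum>f\<in>N e. \<bar>w f * ((\<xi> f X + \<theta> * k f e)\<^sup>2 - (\<xi> f X)\<^sup>2)\<bar>)"
          by (rule sum.mono_neutral_right) (auto simp: N_def k_disjoint Int_commute)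
        also have "\<dots> \<le> (\<Sum>f\<in>N e. kap / D * (2 * \<bar>\<xi> f X\<bar> + kap / D))"
        proof (rule sum_mono)
          fix f assume "f \<in> N e"
          then have f: "f \<in> E" using N by auto
          have k: "\<bar>\<theta> * k f e\<bar> \<le> kap / D"
            using mult_mono[OF \<theta> k_le[OF f, of e]] k_ge_0[OF f, of e] by (simp add: abs_mult)
          have "(\<xi> f X + \<theta> * k f e)\<^sup>2 - (\<xi> f X)\<^sup>2 = \<theta> * k f e * (2 * \<xi> f X + \<theta> * k f e)"
            by (simp add: power2_eq_square algebra_simps)
          then have "\<bar>w f * ((\<xi> f X + \<theta> * k f e)\<^sup>2 - (\<xi> f X)\<^sup>2)\<bar> = \<bar>w f\<bar> * (\<bar>\<theta> * k f e\<bar> * \<bar>2 * \<xi> f X + \<theta> * k f e\<bar>)"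
            by (simp only: abs_mult)
          also have "\<dots> \<le> 1 * (kap / D * (2 * \<bar>\<xi> f X\<bar> + kap / D))"
          proof (intro mult_mono k)
            show "\<bar>w f\<bar> \<le> 1" using w_le_1[of f] w_ge_0[of f] f edges_subset by (auto simp: abs_le_iff)
            show "\<bar>2 * \<xi> f X + \<theta> * k f e\<bar> \<le> 2 * \<bar>\<xi> f X\<bar> + kap / D" using k by linarith
          qed (use kap_pos D_pos in auto)
          finally show "\<bar>w f * ((\<xi> f X + \<theta> * k f e)\<^sup>2 - (\<xi> f X)\<^sup>2)\<bar> \<le> kap / D * (2 * \<bar>\<xi> f X\<bar> + kap / D)"
            by simp
        qed
        finally show "\<bar>q (X(e := b')) - q X\<bar> \<le> (\<Sum>f\<in>N e. kap / D * (2 * \<bar>\<xi> f X\<bar> + kap / D))" .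
      qed
      from power_mono[OF this, of 2]
      have "(influence e q X)\<^sup>2 \<le> (\<Sum>f\<in>N e. kap / D * (2 * \<bar>\<xi> f X\<bar> + kap / D))\<^sup>2" by simp
      also have "\<dots> \<le> (\<Sum>f\<in>N e. (kap / D * (2 * \<bar>\<xi> f X\<bar> + kap / D))\<^sup>2) * real (card (N e))"
        by (rule sum_squared_le_sum_of_squares)
      also have "\<dots> \<le> (\<Sum>f\<in>N e. (kap / D)\<^sup>2 * (8 * (\<xi> f X)\<^sup>2 + 2 * (kap / D)\<^sup>2)) * (real s * D)"
      proof (intro mult_mono sum_mono sum_nonneg)
        show "real (card (N e)) \<le> real s * D"
          unfolding N_def by (rule card_edges_meeting[OF e])
        show "(kap / D * (2 * \<bar>\<xi> f X\<bar> + kap / D))\<^sup>2 \<le> (kap / D)\<^sup>2 * (8 * (\<xi> f X)\<^sup>2 + 2 * (kap / D)\<^sup>2)" for f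
          unfolding power_mult_distrib[of "kap / D"]
          using square_add_le[of "2 * \<bar>\<xi> f X\<bar>" "kap / D"]
          by (intro mult_left_mono) (auto simp: power_mult_distrib)
      qed auto
      finally show ?thesis by (simp only: B_def mult_ac)
    qed
    then have "expect (\<lambda>X. (influence e q X)\<^sup>2) \<le> expect B"
      by (rule expect_mono)
    also have "\<dots> = real s * D * (\<Sum>f\<in>N e. (kap / D)\<^sup>2 * (8 * expect (\<lambda>X. (\<xi> f X)\<^sup>2) + 2 * (kap / D)\<^sup>2))"
      unfolding B_def by simp
    also have "\<dots> \<le> real s * D * (real s * D * ((kap / D)\<^sup>2 * (8 * (tau / D) + 2 * (kap / D)\<^sup>2)))"
    proof (intro mult_left_mono)
      have "(\<Sum>f\<in>N e. (kap / D)\<^sup>2 * (8 * expect (\<lambda>X. (\<xi> f X)\<^sup>2) + 2 * (kap / D)\<^sup>2)) \<le>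
          real (card (N e)) * ((kap / D)\<^sup>2 * (8 * (tau / D) + 2 * (kap / D)\<^sup>2))"
        using expect_\<xi>2_le N by (intro sum_bounded_above mult_left_mono add_right_mono) auto
      also have "\<dots> \<le> real s * D * ((kap / D)\<^sup>2 * (8 * (tau / D) + 2 * (kap / D)\<^sup>2))"
        unfolding N_def using card_edges_meeting[OF e] tau_pos D_pos by (intro mult_right_mono) auto
      finally show "(\<Sum>f\<in>N e. (kap / D)\<^sup>2 * (8 * expect (\<lambda>X. (\<xi> f X)\<^sup>2) + 2 * (kap / D)\<^sup>2)) \<le>
          real s * D * ((kap / D)\<^sup>2 * (8 * (tau / D) + 2 * (kap / D)\<^sup>2))" .
    qed (use D_pos in auto)
    also have "\<dots> = (real s)\<^sup>2 * kap\<^sup>2 * (8 * (tau / D) + 2 * kap\<^sup>2 / D\<^sup>2)"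
      using D_pos by (simp add: power_divide) (simp add: power2_eq_square)
    also have "\<dots> \<le> (real s)\<^sup>2 * kap\<^sup>2 * (8 * (tau / D) + 2 * kap\<^sup>2 / D)"
    proof (intro mult_left_mono add_left_mono divide_left_mono)
      show "D \<le> D\<^sup>2" using D_ge_1 by (simp add: power2_eq_square mult_left_le)
    qed (use D_pos in auto)
    also have "\<dots> = K_q / D"
      using D_pos by (simp add: K_q_def field_simps)
    finally show "expect (\<lambda>X. (influence e q X)\<^sup>2) \<le> K_q / D" .
  qed
  also have "\<dots> \<le> (real n * D) * (K_q / D)"
    using card_E_le D_pos kap_pos tau_pos by (intro mult_right_mono) (auto simp: K_q_def)
  also have "\<dots> = K_q * real n" using D_pos by simp
  finally show ?thesis .
qed

lemma expect_abs_q_le: "expect (\<lambda>X. \<bar>q X - real n\<bar>) \<le> kap\<^sup>2 + sqrt (K_q * real n)"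
proof -
  have "expect (\<lambda>X. \<bar>q X - real n\<bar>) \<le> expect (\<lambda>X. kap\<^sup>2 + \<bar>q X - expect q\<bar>)"
    using abs_expect_q_le by (intro expect_mono) linarith
  also have "\<dots> = kap\<^sup>2 + expect (\<lambda>X. \<bar>q X - expect q\<bar>)" by simp
  finally show ?thesis using expect_abs_dev_le[OF variance_q_le] by simp
qed

subsection \<open>Asymptotic normality of the leading term\<close>

definition Q :: "(nat set \<Rightarrow> bool) \<Rightarrow> real" where
  "Q X = ((\<Sum>v\<in>{1..n}. Z v X * \<epsilon> v X) - real n) / sqrt (2 * real n)"

text \<open>Off-diagonal part of the kernel of \<open>Q\<close>. Without the diagonal,
  \<open>lin E (h e)\<close> is independent of \<open>Y e\<close>; the factor 2 offsets the halving
  in \<open>U\<close>.\<close>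

definition h :: "nat set \<Rightarrow> nat set \<Rightarrow> real" where
  "h e f = (if e = f then 0 else 2 / sqrt (2 * real n) * k e f)"

definition U :: "(nat set \<Rightarrow> bool) \<Rightarrow> real" where
  "U X = (\<Sum>e\<in>E. Y e X * lin E (h e) X) / 2"

lemma n_pos: "0 < real n" using real_n real_s by linarith

lemma sum_Z_\<epsilon>: "(\<Sum>v\<in>{1..n}. Z v X * \<epsilon> v X) = (\<Sum>e\<in>E. Y e X * \<xi> e X)"
proof -
  have "(\<Sum>e\<in>E. Y e X * \<xi> e X) = (\<Sum>v\<in>{1..n}. \<Sum>e\<in>{e \<in> E. v \<in> e}. Y e X * \<epsilon> v X)"
    unfolding \<xi>_def sum_distrib_left by (rule sum_edges_swap)
  also have "\<dots> = (\<Sum>v\<in>{1..n}. Z v X * \<epsilon> v X)"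
  proof (intro sum.cong refl)
    fix v
    have "Z v X = (\<Sum>e\<in>{e \<in> E. v \<in> e}. Y e X)"
      unfolding Z_def lin_def by (rule sum.mono_neutral_cong_right) auto
    then show "(\<Sum>e\<in>{e \<in> E. v \<in> e}. Y e X * \<epsilon> v X) = Z v X * \<epsilon> v X"
      by (simp add: sum_distrib_right)
  qed
  finally show ?thesis by simp
qed

lemma lin_h:
  assumes "e \<in> E"
  shows "lin E (h e) X = 2 / sqrt (2 * real n) * (\<xi> e X - k e e * Y e X)"
proof -
  have "lin E (h e) X = (\<Sum>f\<in>E - {e}. 2 / sqrt (2 * real n) * (k e f * Y f X))"
    unfolding lin_def h_def by (rule sum.mono_neutral_cong_right) auto
  also have "\<dots> = 2 / sqrt (2 * real n) * (\<Sum>f\<in>E - {e}. k e f * Y f X)"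
    by (rule sum_distrib_left[symmetric])
  also have "(\<Sum>f\<in>E - {e}. k e f * Y f X) = \<xi> e X - k e e * Y e X"
    unfolding \<xi>_eq_lin[OF assms] lin_def using assms by (simp add: sum.remove[of E e])
  finally show ?thesis .
qed

lemma Q_minus_U: "Q X - U X = ((\<Sum>e\<in>E. k e e * (Y e X)\<^sup>2) - real n) / sqrt (2 * real n)"
proof -
  have half: "y * (2 / sqrt (2 * real n) * z) / 2 = y * z / sqrt (2 * real n)" for y z :: real
    by simp
  have "U X = (\<Sum>e\<in>E. Y e X * (\<xi> e X - k e e * Y e X)) / sqrt (2 * real n)"
    unfolding U_def sum_divide_distrib by (intro sum.cong refl) (simp only: lin_h half)
  also have "(\<Sum>e\<in>E. Y e X * (\<xi> e X - k e e * Y e X)) = (\<Sum>e\<in>E. Y e X * \<xi> e X) - (\<Sum>e\<in>E. k e e * (Y e X)\<^sup>2)"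
    unfolding sum_subtractf[symmetric] by (intro sum.cong refl) (simp add: power2_eq_square algebra_simps)
  finally show ?thesis
    unfolding Q_def sum_Z_\<epsilon> diff_divide_distrib by simp
qed

text \<open>The diagonal part \<open>\<Sum>e. k e e * (Y e)^2\<close> has mean exactly
  \<open>n\<close>, since the weights \<open>w e / a v\<close> of the hyperedges through
  \<open>v\<close> sum to 1; it thus absorbs the centring of \<open>Q\<close>. Its fluctuation is
  bounded while the normalisation is \<open>\<surd>(2n)\<close>.\<close>

lemma expect_Q_U_le: "expect (\<lambda>X. \<bar>Q X - U X\<bar>) \<le> kap / sqrt (real n)"
proof -
  define S where "S = (\<lambda>X. \<Sum>e\<in>E. k e e * (Y e X)\<^sup>2)"
  have "expect S = (\<Sum>e\<in>E. k e e * w e)"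
    unfolding S_def expect_sum using edges_subset by (intro sum.cong refl) (auto simp: subset_iff)
  also have "\<dots> = (\<Sum>e\<in>E. \<Sum>v\<in>e. w e / a v)"
    by (simp add: k_def sum_distrib_right)
  also have "\<dots> = (\<Sum>v\<in>{1..n}. a v / a v)"
    unfolding sum_edges_swap sum_divide_distrib[symmetric] a_def[symmetric] ..
  also have "\<dots> = (\<Sum>v\<in>{1..n}. 1)"
    by (intro sum.cong refl divide_self) (use a_pos in fastforce)
  finally have ES: "expect S = real n" by simp
  have "expect (\<lambda>X. (S X - expect S)\<^sup>2) \<le> (\<Sum>e\<in>E. expect (\<lambda>X. (influence e S X)\<^sup>2))"
    by (rule efron_stein[OF edges_subset]) (auto simp: S_def Y_def intro!: sum.cong)
  also have "\<dots> \<le> real (card E) * (kap / D)\<^sup>2"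
  proof (rule sum_bounded_above)
    fix e assume e: "e \<in> E"
    then have eI: "e \<in> I" using edges_subset by auto
    have "(influence e S X)\<^sup>2 \<le> (kap / D)\<^sup>2" for X
    proof -
      have "\<bar>influence e S X\<bar> \<le> kap / D"
      proof (rule abs_influence_le)
        fix b
        have "S (X(e := b)) - S X = (\<Sum>f\<in>E. if f = e then k e e * ((Y e (X(e := b)))\<^sup>2 - (Y e X)\<^sup>2) else 0)"
          unfolding S_def sum_subtractf[symmetric] by (intro sum.cong refl) (auto simp: Y_def algebra_simps)
        then have S: "S (X(e := b)) - S X = k e e * ((Y e (X(e := b)))\<^sup>2 - (Y e X)\<^sup>2)"
          using e by simp
        have "(Y e X')\<^sup>2 \<le> 1" for X'
          using abs_Y_le[OF eI] abs_square_le_1 by blast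
        then have "\<bar>(Y e (X(e := b)))\<^sup>2 - (Y e X)\<^sup>2\<bar> \<le> 1"
          by (smt (verit) zero_le_power2)
        then have "k e e * \<bar>(Y e (X(e := b)))\<^sup>2 - (Y e X)\<^sup>2\<bar> \<le> kap / D * 1"
          using k_le[OF e, of e] k_ge_0[OF e, of e] by (intro mult_mono) auto
        then show "\<bar>S (X(e := b)) - S X\<bar> \<le> kap / D"
          unfolding S abs_mult using k_ge_0[OF e, of e] by simp
      qed
      from power_mono[OF this, of 2] show ?thesis by simp
    qed
    then have "expect (\<lambda>X. (influence e S X)\<^sup>2) \<le> expect (\<lambda>X. (kap / D)\<^sup>2)"
      by (rule expect_mono)
    then show "expect (\<lambda>X. (influence e S X)\<^sup>2) \<le> (kap / D)\<^sup>2" by simp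
  qed
  also have "\<dots> \<le> D\<^sup>2 * (kap / D)\<^sup>2"
    using card_E_le' by (intro mult_right_mono) auto
  also have "\<dots> = kap\<^sup>2" using D_pos by (simp add: power_divide)
  finally have "expect (\<lambda>X. \<bar>S X - real n\<bar>) \<le> sqrt (kap\<^sup>2)"
    unfolding ES by (rule expect_abs_dev_le)
  then have S_le: "expect (\<lambda>X. \<bar>S X - real n\<bar>) \<le> kap"
    using kap_pos by simp
  have "expect (\<lambda>X. \<bar>Q X - U X\<bar>) = expect (\<lambda>X. \<bar>S X - real n\<bar> / sqrt (2 * real n))"
    unfolding Q_minus_U S_def by (simp add: abs_divide)
  also have "\<dots> = expect (\<lambda>X. \<bar>S X - real n\<bar>) / sqrt (2 * real n)" by simp
  also have "\<dots> \<le> kap / sqrt (real n)"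
    using S_le n_pos kap_pos by (intro frac_le) auto
  finally show ?thesis .
qed

definition K_a :: real where
  "K_a = 2 * (2 * kap\<^sup>2 + sqrt K_q + 2 * kap * sqrt (tau * real s))"

text \<open>Up to the diagonal the sum is \<open>2 / n * q\<close>, so the claim rests on the
  concentration of \<open>q\<close> around \<open>n\<close>. Removing the diagonal costs
  \<open>B\<close>, whose mean is of order \<open>\<surd>n\<close>.\<close>

lemma conditional_variance_le:
  "expect (\<lambda>X. \<bar>(\<Sum>e\<in>E. w e * (lin E (h e) X)\<^sup>2) - 2\<bar>) \<le> K_a / sqrt (real n)"
proof -
  define B where "B = (\<lambda>X. \<Sum>e\<in>E. 2 * (kap / D) * \<bar>\<xi> e X\<bar> + (kap / D)\<^sup>2)"
  have pointwise: "\<bar>(\<Sum>e\<in>E. w e * (lin E (h e) X)\<^sup>2) - 2\<bar> \<le> 2 / real n * (\<bar>q X - real n\<bar> + B X)" for X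
  proof -
    have sq: "(2 / sqrt (2 * real n) * z)\<^sup>2 = 2 / real n * z\<^sup>2" for z
      using n_pos by (simp add: power_mult_distrib power_divide)
    have "(\<Sum>e\<in>E. w e * (lin E (h e) X)\<^sup>2) = 2 / real n * (\<Sum>e\<in>E. w e * (\<xi> e X - k e e * Y e X)\<^sup>2)"
      unfolding sum_distrib_left by (intro sum.cong refl) (simp only: lin_h sq mult.left_commute)
    also have "\<dots> - 2 = 2 / real n * ((\<Sum>e\<in>E. w e * (\<xi> e X - k e e * Y e X)\<^sup>2) - real n)"
      using n_pos by (simp add: field_simps)
    finally have eq: "(\<Sum>e\<in>E. w e * (lin E (h e) X)\<^sup>2) - 2 =
        2 / real n * ((\<Sum>e\<in>E. w e * (\<xi> e X - k e e * Y e X)\<^sup>2) - real n)" .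
    have "\<bar>(\<Sum>e\<in>E. w e * (\<xi> e X - k e e * Y e X)\<^sup>2) - q X\<bar> \<le> B X"
    proof -
      have "\<bar>(\<Sum>e\<in>E. w e * (\<xi> e X - k e e * Y e X)\<^sup>2) - q X\<bar> \<le>
          (\<Sum>e\<in>E. \<bar>w e * (\<xi> e X - k e e * Y e X)\<^sup>2 - w e * (\<xi> e X)\<^sup>2\<bar>)"
        unfolding q_def sum_subtractf[symmetric] by (rule sum_abs)
      also have "\<dots> \<le> B X"
        unfolding B_def
      proof (rule sum_mono)
        fix e assume e: "e \<in> E"
        then have eI: "e \<in> I" using edges_subset by auto
        have y: "\<bar>k e e * Y e X\<bar> \<le> kap / D"
          using mult_mono[OF k_le[OF e, of e] abs_Y_le[OF eI, of X]] k_ge_0[OF e, of e] kap_pos D_pos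
          by (simp add: abs_mult)
        have "w e * (\<xi> e X - k e e * Y e X)\<^sup>2 - w e * (\<xi> e X)\<^sup>2 = w e * ((k e e * Y e X) * (k e e * Y e X - 2 * \<xi> e X))"
          by (simp add: power2_eq_square algebra_simps)
        then have "\<bar>w e * (\<xi> e X - k e e * Y e X)\<^sup>2 - w e * (\<xi> e X)\<^sup>2\<bar> = \<bar>w e\<bar> * (\<bar>k e e * Y e X\<bar> * \<bar>k e e * Y e X - 2 * \<xi> e X\<bar>)"
          by (simp only: abs_mult)
        also have "\<dots> \<le> 1 * (kap / D * (kap / D + 2 * \<bar>\<xi> e X\<bar>))"
        proof (intro mult_mono y)
          show "\<bar>w e\<bar> \<le> 1" using w_le_1[of e] w_ge_0[OF eI] by simp
          show "\<bar>k e e * Y e X - 2 * \<xi> e X\<bar> \<le> kap / D + 2 * \<bar>\<xi> e X\<bar>" using y by linarith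
        qed (use kap_pos D_pos in auto)
        finally show "\<bar>w e * (\<xi> e X - k e e * Y e X)\<^sup>2 - w e * (\<xi> e X)\<^sup>2\<bar> \<le> 2 * (kap / D) * \<bar>\<xi> e X\<bar> + (kap / D)\<^sup>2"
          by (simp add: power2_eq_square algebra_simps)
      qed
      finally show ?thesis .
    qed
    then have "\<bar>(\<Sum>e\<in>E. w e * (\<xi> e X - k e e * Y e X)\<^sup>2) - real n\<bar> \<le> \<bar>q X - real n\<bar> + B X"
      by linarith
    then show ?thesis
      unfolding eq abs_mult using n_pos by (simp add: divide_right_mono)
  qed
  have EB: "expect B \<le> kap\<^sup>2 + 2 * kap * sqrt (tau * real s) * sqrt (real n)"
  proof -
    have "expect (\<lambda>X. \<bar>\<xi> e X\<bar>) \<le> sqrt (tau * real s) / sqrt (real n)" if e: "e \<in> E" for e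
    proof -
      have "expect (\<lambda>X. \<bar>\<xi> e X\<bar>) \<le> sqrt (tau / D)"
        using expect_abs_dev_le[of "\<xi> e" 0] expect_\<xi>2_le[OF e] by simp
      also have "\<dots> \<le> sqrt (tau * real s / real n)"
        using n_le n_pos D_pos tau_pos by (simp add: field_simps)
      finally show ?thesis by (simp add: real_sqrt_divide)
    qed
    then have "(\<Sum>e\<in>E. 2 * (kap / D) * expect (\<lambda>X. \<bar>\<xi> e X\<bar>) + (kap / D)\<^sup>2) \<le>
        (\<Sum>e\<in>E. 2 * (kap / D) * (sqrt (tau * real s) / sqrt (real n)) + (kap / D)\<^sup>2)"
      using kap_pos D_pos by (intro sum_mono add_right_mono mult_left_mono) auto
    moreover have "expect B = (\<Sum>e\<in>E. 2 * (kap / D) * expect (\<lambda>X. \<bar>\<xi> e X\<bar>) + (kap / D)\<^sup>2)"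
      unfolding B_def by simp
    ultimately have "expect B \<le> (\<Sum>e\<in>E. 2 * (kap / D) * (sqrt (tau * real s) / sqrt (real n)) + (kap / D)\<^sup>2)"
      by simp
    also have "\<dots> = real (card E) * (2 * (kap / D) * (sqrt (tau * real s) / sqrt (real n))) + real (card E) * (kap / D)\<^sup>2"
      by (simp add: ring_distribs)
    also have "\<dots> \<le> (real n * D) * (2 * (kap / D) * (sqrt (tau * real s) / sqrt (real n))) + D\<^sup>2 * (kap / D)\<^sup>2"
      using card_E_le card_E_le' kap_pos D_pos tau_pos real_s
      by (intro add_mono mult_right_mono) auto
    also have "D\<^sup>2 * (kap / D)\<^sup>2 = kap\<^sup>2"
      using D_pos by (simp add: power_divide)
    also have "(real n * D) * (2 * (kap / D) * (sqrt (tau * real s) / sqrt (real n))) =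
        2 * kap * sqrt (tau * real s) * (real n / sqrt (real n))"
      using D_pos by simp
    also have "real n / sqrt (real n) = sqrt (real n)"
      by (rule real_div_sqrt) simp
    finally show ?thesis by simp
  qed
  have "expect (\<lambda>X. \<bar>(\<Sum>e\<in>E. w e * (lin E (h e) X)\<^sup>2) - 2\<bar>) \<le> expect (\<lambda>X. 2 / real n * (\<bar>q X - real n\<bar> + B X))"
    by (rule expect_mono[OF pointwise])
  also have "\<dots> = 2 / real n * (expect (\<lambda>X. \<bar>q X - real n\<bar>) + expect B)"
    by simp
  also have "\<dots> \<le> 2 / real n * ((kap\<^sup>2 + sqrt (K_q * real n)) + (kap\<^sup>2 + 2 * kap * sqrt (tau * real s) * sqrt (real n)))"
    using expect_abs_q_le EB n_pos by (intro mult_left_mono add_mono) auto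
  also have "\<dots> \<le> 2 / real n * (sqrt (real n) * (2 * kap\<^sup>2 + sqrt K_q + 2 * kap * sqrt (tau * real s)))"
  proof (rule mult_left_mono)
    have "1 * (2 * kap\<^sup>2) \<le> sqrt (real n) * (2 * kap\<^sup>2)"
      using real_n real_s by (intro mult_right_mono) auto
    then show "kap\<^sup>2 + sqrt (K_q * real n) + (kap\<^sup>2 + 2 * kap * sqrt (tau * real s) * sqrt (real n)) \<le>
        sqrt (real n) * (2 * kap\<^sup>2 + sqrt K_q + 2 * kap * sqrt (tau * real s))"
      by (simp add: real_sqrt_mult algebra_simps)
  qed (use n_pos in auto)
  also have "\<dots> = K_a * (sqrt (real n) / real n)"
    by (simp add: K_a_def)
  also have "sqrt (real n) / real n = 1 / sqrt (real n)"
    using n_pos by (simp add: field_simps)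
  finally show ?thesis by simp
qed

definition K_b :: real where "K_b = tau + 6 * tau\<^sup>2"

lemma third_moment_le: "(\<Sum>e\<in>E. expect (\<lambda>X. \<bar>lin E (h e) X\<bar>^3)) \<le> K_b / sqrt (real n)"
proof -
  \<comment> \<open>The inverse of the typical size of \<open>lin E (h e)\<close>, whose second
    moment is at most \<open>2 * tau / m^2\<close>; this choice balances the two terms of
    \<open>abs_cube_le\<close>.\<close>
  define m where "m = sqrt (real n * D)"
  have m: "0 < m" "m\<^sup>2 = real n * D" using n_pos D_pos by (auto simp: m_def)
  have "(\<Sum>e\<in>E. expect (\<lambda>X. \<bar>lin E (h e) X\<bar>^3)) \<le> real (card E) * (K_b / m^3)"
  proof (rule sum_bounded_above)
    fix e assume e: "e \<in> E"
    have h2: "(\<Sum>f\<in>E. (h e f)\<^sup>2) \<le> 2 * tau / m\<^sup>2"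
    proof -
      have "(\<Sum>f\<in>E. (h e f)\<^sup>2) \<le> (\<Sum>f\<in>E. 2 / real n * (k e f)\<^sup>2)"
        using n_pos by (intro sum_mono) (auto simp: h_def power_mult_distrib power_divide)
      also have "\<dots> = 2 / real n * (\<Sum>f\<in>E. (k e f)\<^sup>2)"
        by (rule sum_distrib_left[symmetric])
      also have "\<dots> \<le> 2 / real n * (tau / D)"
        using sum_k_square_le[OF e] n_pos by (intro mult_left_mono) auto
      finally show ?thesis unfolding m by simp
    qed
    have 2: "expect (\<lambda>X. (lin E (h e) X)\<^sup>2) \<le> 2 * tau / m\<^sup>2"
      using expect_lin_square_le[OF edges_subset, of "h e"] h2 by simp
    have "(\<Sum>f\<in>E. (h e f)\<^sup>2)\<^sup>2 \<le> (2 * tau / m\<^sup>2)\<^sup>2"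
      using h2 by (intro power_mono sum_nonneg) auto
    then have 4: "expect (\<lambda>X. (lin E (h e) X)^4) \<le> 3 * (2 * tau / m\<^sup>2)\<^sup>2"
      using expect_lin_fourth_le[OF edges_subset, of "h e"] by simp
    have "expect (\<lambda>X. \<bar>lin E (h e) X\<bar>^3) \<le> expect (\<lambda>X. ((lin E (h e) X)\<^sup>2 / m + m * (lin E (h e) X)^4) / 2)"
      by (intro expect_mono abs_cube_le m)
    also have "\<dots> = (expect (\<lambda>X. (lin E (h e) X)\<^sup>2) / m + m * expect (\<lambda>X. (lin E (h e) X)^4)) / 2"
      by simp
    also have "\<dots> \<le> ((2 * tau / m\<^sup>2) / m + m * (3 * (2 * tau / m\<^sup>2)\<^sup>2)) / 2"
      using 2 4 m(1) by (intro divide_right_mono add_mono mult_left_mono) auto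
    also have "\<dots> = K_b / m^3"
      using m(1) by (simp add: K_b_def power2_eq_square power3_eq_cube field_simps)
    finally show "expect (\<lambda>X. \<bar>lin E (h e) X\<bar>^3) \<le> K_b / m^3" .
  qed
  also have "\<dots> \<le> m\<^sup>2 * (K_b / m^3)"
    unfolding m using card_E_le m(1) tau_pos by (intro mult_right_mono) (auto simp: K_b_def)
  also have "\<dots> = K_b / m"
    using m(1) by (simp add: power2_eq_square power3_eq_cube)
  also have "\<dots> \<le> K_b / sqrt (real n)"
  proof (rule divide_left_mono)
    show "sqrt (real n) \<le> m"
      unfolding m_def using D_ge_1 n_pos by simp
    show "0 \<le> K_b" using tau_pos by (simp add: K_b_def)
  qed (use n_pos m in auto)
  finally show ?thesis .
qed

lemma char_Q_le:
  "cmod (expect (\<lambda>X. iexp (t * Q X)) - of_real (exp (- t\<^sup>2 / 2)))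
    \<le> (\<bar>t\<bar> * kap + t\<^sup>2 * K_a + \<bar>t\<bar>^3 * K_b) / sqrt (real n)"
proof -
  have h: "h e f = h f e" "h e e = 0" for e f
    by (auto simp: h_def k_commute)
  have "cmod (expect (\<lambda>X. iexp (t * U X)) - of_real (exp (- t\<^sup>2 / 2)))
      \<le> t\<^sup>2 * (K_a / sqrt (real n)) + \<bar>t\<bar>^3 * (K_b / sqrt (real n))"
    unfolding U_def
    by (rule quadratic_form_char_bound[OF edges_subset h conditional_variance_le third_moment_le])
  moreover have "cmod (expect (\<lambda>X. iexp (t * Q X)) - expect (\<lambda>X. iexp (t * U X))) \<le> \<bar>t\<bar> * (kap / sqrt (real n))"
    by (rule order.trans[OF norm_expect_iexp_diff_le mult_left_mono[OF expect_Q_U_le]]) simp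
  ultimately show ?thesis
    using norm_triangle_ineq[of "expect (\<lambda>X. iexp (t * Q X)) - expect (\<lambda>X. iexp (t * U X))"
        "expect (\<lambda>X. iexp (t * U X)) - of_real (exp (- t\<^sup>2 / 2))"]
    by (simp add: add_divide_distrib)
qed

end

section \<open>Existence and location of the maximum likelihood estimate\<close>

lemma neg_log_lik_cong:
  assumes "\<And>v. v \<in> {1..n} \<Longrightarrow> \<alpha> v = \<beta> v"
  shows "neg_log_lik n s H \<alpha> = neg_log_lik n s H \<beta>"
proof -
  have "(\<Sum>v\<in>e. \<alpha> v) = (\<Sum>v\<in>e. \<beta> v)" if "e \<subseteq> {1..n}" for e
    using assms that by (intro sum.cong) auto
  then show ?thesis
    unfolding neg_log_lik_def using assms by (intro arg_cong2[where f = "(-)"] sum.cong) auto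
qed

lemma quadratic_lower_bound:
  fixes g x m :: real
  assumes "0 < m"
  shows "- g\<^sup>2 / (2 * m) \<le> - g * x + m / 2 * x\<^sup>2"
proof -
  have "0 \<le> (m * x - g)\<^sup>2 / (2 * m)" using assms by simp
  also have "\<dots> = - g * x + m / 2 * x\<^sup>2 + g\<^sup>2 / (2 * m)"
    using assms by (simp add: field_simps power2_eq_square)
  finally show ?thesis by simp
qed

locale layer_graph = layer_size n s for n s +
  fixes H :: hypergraph
  assumes H_subset: "H \<subseteq> Pow {1..n}"
begin

definition grad :: "(nat \<Rightarrow> real) \<Rightarrow> nat \<Rightarrow> real" where
  "grad \<beta> v = (\<Sum>e\<in>{e \<in> E. v \<in> e}. logistic (\<Sum>u\<in>e. \<beta> u) - of_bool (e \<in> H))"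

text \<open>In this form the objective is a sum of one-dimensional convex functions of the linear
  predictors, so the estimates for \<open>softplus\<close> apply hyperedge by hyperedge.\<close>

lemma neg_log_lik_eq:
  "neg_log_lik n s H \<beta> = (\<Sum>e\<in>E. softplus (\<Sum>v\<in>e. \<beta> v) - of_bool (e \<in> H) * (\<Sum>v\<in>e. \<beta> v))"
proof -
  have "(\<Sum>v\<in>{1..n}. \<beta> v * real (s_degree s H v)) = (\<Sum>v\<in>{1..n}. \<Sum>e\<in>{e \<in> E. v \<in> e}. of_bool (e \<in> H) * \<beta> v)"
  proof (intro sum.cong refl)
    fix v
    have "{e \<in> H. card e = s \<and> v \<in> e} = {e \<in> {e \<in> E. v \<in> e}. e \<in> H}"
      using H_subset by (auto simp: edges_def)
    then have "real (s_degree s H v) = (\<Sum>e\<in>{e \<in> E. v \<in> e}. of_bool (e \<in> H))"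
      by (simp add: s_degree_def of_bool_def sum.If_cases Int_def)
    then show "\<beta> v * real (s_degree s H v) = (\<Sum>e\<in>{e \<in> E. v \<in> e}. of_bool (e \<in> H) * \<beta> v)"
      by (simp add: sum_distrib_left mult.commute)
  qed
  also have "\<dots> = (\<Sum>e\<in>E. of_bool (e \<in> H) * (\<Sum>v\<in>e. \<beta> v))"
    unfolding sum_distrib_left by (rule sum_edges_swap[symmetric])
  finally show ?thesis
    by (simp add: neg_log_lik_def softplus_def sum_subtractf edges_def)
qed

text \<open>Each hyperedge has curvature at least \<open>exp (- K) / 4\<close>, and
  \<open>D - D2\<close> bounds the form \<open>\<Sum>e. (\<Sum>v\<in>e. \<delta> v)^2\<close> from
  below.\<close>

lemma neg_log_lik_strongly_convex:
  assumes "\<And>e. e \<in> E \<Longrightarrow> \<bar>\<Sum>v\<in>e. \<beta> v\<bar> + \<bar>\<Sum>v\<in>e. \<delta> v\<bar> \<le> K"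
  shows "neg_log_lik n s H \<beta> + (\<Sum>v\<in>{1..n}. \<delta> v * grad \<beta> v)
      + exp (- K) / 4 * (D - D2) / 2 * (\<Sum>v\<in>{1..n}. (\<delta> v)\<^sup>2)
    \<le> neg_log_lik n s H (\<lambda>v. \<beta> v + \<delta> v)"
proof -
  have "(\<Sum>v\<in>{1..n}. \<delta> v * grad \<beta> v) = (\<Sum>e\<in>E. \<Sum>v\<in>e. \<delta> v * (logistic (\<Sum>u\<in>e. \<beta> u) - of_bool (e \<in> H)))"
    unfolding grad_def sum_edges_swap by (simp add: sum_distrib_left)
  also have "\<dots> = (\<Sum>e\<in>E. (logistic (\<Sum>u\<in>e. \<beta> u) - of_bool (e \<in> H)) * (\<Sum>v\<in>e. \<delta> v))"
    unfolding sum_distrib_left by (simp only: mult.commute)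
  finally have grad: "(\<Sum>v\<in>{1..n}. \<delta> v * grad \<beta> v) = \<dots>" .
  have "exp (- K) / 8 * ((D - D2) * (\<Sum>v\<in>{1..n}. (\<delta> v)\<^sup>2)) \<le> exp (- K) / 8 * (\<Sum>e\<in>E. (\<Sum>v\<in>e. \<delta> v)\<^sup>2)"
    by (intro mult_left_mono sum_edge_squares_ge) simp
  then have "neg_log_lik n s H \<beta> + (\<Sum>v\<in>{1..n}. \<delta> v * grad \<beta> v)
      + exp (- K) / 4 * (D - D2) / 2 * (\<Sum>v\<in>{1..n}. (\<delta> v)\<^sup>2)
    \<le> (\<Sum>e\<in>E. softplus (\<Sum>v\<in>e. \<beta> v) - of_bool (e \<in> H) * (\<Sum>v\<in>e. \<beta> v)
        + (logistic (\<Sum>u\<in>e. \<beta> u) - of_bool (e \<in> H)) * (\<Sum>v\<in>e. \<delta> v) + exp (- K) / 8 * (\<Sum>v\<in>e. \<delta> v)\<^sup>2)"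
    unfolding neg_log_lik_eq grad sum.distrib sum_distrib_left[symmetric] by simp
  also have "\<dots> \<le> neg_log_lik n s H (\<lambda>v. \<beta> v + \<delta> v)"
    unfolding neg_log_lik_eq
  proof (rule sum_mono)
    fix e assume "e \<in> E"
    from softplus_strongly_convex[OF assms[OF this]]
    show "softplus (\<Sum>v\<in>e. \<beta> v) - of_bool (e \<in> H) * (\<Sum>v\<in>e. \<beta> v)
        + (logistic (\<Sum>u\<in>e. \<beta> u) - of_bool (e \<in> H)) * (\<Sum>v\<in>e. \<delta> v) + exp (- K) / 8 * (\<Sum>v\<in>e. \<delta> v)\<^sup>2
      \<le> softplus (\<Sum>v\<in>e. \<beta> v + \<delta> v) - of_bool (e \<in> H) * (\<Sum>v\<in>e. \<beta> v + \<delta> v)"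
      by (simp add: sum.distrib algebra_simps)
  qed
  finally show ?thesis .
qed

text \<open>Plain convexity reaches beyond the box on which the curvature bound is available; it
  carries a strict inequality on the boundary outwards.\<close>

lemma neg_log_lik_convex:
  assumes "0 \<le> t" "t \<le> 1"
  shows "neg_log_lik n s H (\<lambda>v. \<beta> v + t * \<delta> v)
    \<le> (1 - t) * neg_log_lik n s H \<beta> + t * neg_log_lik n s H (\<lambda>v. \<beta> v + \<delta> v)"
proof -
  define f where "f = (\<lambda>\<beta> e. softplus (\<Sum>v\<in>e. \<beta> v) - of_bool (e \<in> H) * (\<Sum>v\<in>e. \<beta> v))"
  have L: "neg_log_lik n s H \<beta> = (\<Sum>e\<in>E. f \<beta> e)" for \<beta>
    by (simp add: neg_log_lik_eq f_def)
  show ?thesis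
    unfolding L sum_distrib_left sum.distrib[symmetric]
  proof (rule sum_mono)
    fix e
    let ?x = "\<Sum>v\<in>e. \<beta> v" and ?y = "\<Sum>v\<in>e. \<delta> v"
    have "softplus ((1 - t) * ?x + t * (?x + ?y)) \<le> (1 - t) * softplus ?x + t * softplus (?x + ?y)"
      using convex_onD[OF softplus_convex, of t ?x "?x + ?y"] assms by simp
    then have "softplus (?x + t * ?y) \<le> (1 - t) * softplus ?x + t * softplus (?x + ?y)"
      by (simp add: algebra_simps)
    then show "f (\<lambda>v. \<beta> v + t * \<delta> v) e \<le> (1 - t) * f \<beta> e + t * f (\<lambda>v. \<beta> v + \<delta> v) e"
      by (simp add: f_def sum.distrib sum_distrib_left[symmetric] algebra_simps)
  qed
qed

text \<open>Vectors are functions on the index set, so the compactness of a box is Tychonoff's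
  theorem for the product topology.\<close>

lemma neg_log_lik_attains_min_on_box:
  assumes "\<And>v. v \<in> {1..n} \<Longrightarrow> l v \<le> u v"
  obtains \<beta> where "\<beta> \<in> (\<Pi>\<^sub>E v\<in>{1..n}. {l v..u v})"
    and "\<And>\<alpha>. \<alpha> \<in> (\<Pi>\<^sub>E v\<in>{1..n}. {l v..u v}) \<Longrightarrow> neg_log_lik n s H \<beta> \<le> neg_log_lik n s H \<alpha>"
proof -
  let ?B = "\<Pi>\<^sub>E v\<in>{1..n}. {l v..u v}"
  let ?T = "product_topology (\<lambda>_. euclideanreal) {1..n}"
  have lin: "continuous_map ?T euclideanreal (\<lambda>\<beta>. \<Sum>v\<in>e. \<beta> v)" if "e \<in> E" for e
    using edgesD[OF that] by (intro continuous_map_sum continuous_map_product_projection) auto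
  have sp: "continuous_map euclideanreal euclideanreal softplus"
    by (simp add: continuous_on_eq_continuous_within DERIV_isCont[OF DERIV_softplus])
  have "continuous_map ?T euclideanreal (\<lambda>\<beta>. softplus (\<Sum>v\<in>e. \<beta> v))" if "e \<in> E" for e
    using continuous_map_compose[OF lin[OF that] sp] by (simp add: o_def)
  then have "continuous_map ?T euclideanreal (neg_log_lik n s H)"
    unfolding neg_log_lik_eq[abs_def] using lin
    by (intro continuous_map_sum[OF finite_edges] continuous_map_diff continuous_map_real_mult_left)
  moreover have "compactin ?T ?B"
    by (subst compactin_PiE) auto
  ultimately have "compact (neg_log_lik n s H ` ?B)"
    using image_compactin compactin_euclidean_iff by blast
  moreover have "(\<lambda>v\<in>{1..n}. l v) \<in> ?B" using assms by auto
  ultimately obtain y where "y \<in> neg_log_lik n s H ` ?B" "\<forall>t\<in>neg_log_lik n s H ` ?B. y \<le> t"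
    using compact_attains_inf[of "neg_log_lik n s H ` ?B"] by blast
  then show ?thesis using that by blast
qed

text \<open>
  Newton--Kantorovich type localisation: if the gradient at \<open>\<beta>\<^sub>0\<close> is small compared with the modulus \<open>m\<close>
  of strong convexity on the unit box around \<open>\<beta>\<^sub>0\<close>, then the negative log-likelihood exceeds its
  value at \<open>\<beta>\<^sub>0\<close> on the boundary of the box, hence outside of it by convexity.
\<close>

lemma ml_estimate_near:
  fixes \<beta>\<^sub>0 :: "nat \<Rightarrow> real" and K :: real
  defines "m \<equiv> exp (- K) / 4 * (D - D2)" and "G \<equiv> \<Sum>v\<in>{1..n}. (grad \<beta>\<^sub>0 v)\<^sup>2"
  assumes K: "\<And>e. e \<in> E \<Longrightarrow> \<bar>\<Sum>v\<in>e. \<beta>\<^sub>0 v\<bar> + 2 * real s \<le> K"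
    and G: "G < (m / 2)\<^sup>2"
  shows "\<exists>!\<beta>. is_ml_estimate n s H \<beta>"
    and "is_ml_estimate n s H \<beta> \<Longrightarrow> neg_log_lik n s H \<beta> \<le> neg_log_lik n s H \<beta>\<^sub>0"
    and "is_ml_estimate n s H \<beta> \<Longrightarrow> neg_log_lik n s H \<beta>\<^sub>0 - G / (2 * m) \<le> neg_log_lik n s H \<beta>"
proof -
  let ?L = "neg_log_lik n s H"
  have m: "0 < m" using two_D2_le D2_ge_1 by (simp add: m_def)
  have G0: "0 \<le> G" by (simp add: G_def sum_nonneg)
  have G_m: "sqrt G < m / 2" using real_sqrt_less_mono[OF G] m by (simp only: real_sqrt_abs)
  have edge_le: "\<bar>\<Sum>v\<in>e. \<delta> v\<bar> \<le> real s" if "e \<in> E" "\<And>v. v \<in> {1..n} \<Longrightarrow> \<bar>\<delta> v\<bar> \<le> 1" for e and \<delta> :: "nat \<Rightarrow> real"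
  proof -
    have "\<bar>\<Sum>v\<in>e. \<delta> v\<bar> \<le> (\<Sum>v\<in>e. \<bar>\<delta> v\<bar>)" by (rule sum_abs)
    also have "\<dots> \<le> real (card e) * 1" using edgesD[OF that(1)] that(2) by (intro sum_bounded_above) auto
    finally show ?thesis using edgesD[OF that(1)] by simp
  qed
  have box: "?L \<beta>\<^sub>0 - sqrt G * sqrt (\<Sum>v\<in>{1..n}. (\<delta> v)\<^sup>2) + m / 2 * (sqrt (\<Sum>v\<in>{1..n}. (\<delta> v)\<^sup>2))\<^sup>2 \<le> ?L (\<lambda>v. \<beta>\<^sub>0 v + \<delta> v)"
    if \<delta>: "\<And>v. v \<in> {1..n} \<Longrightarrow> \<bar>\<delta> v\<bar> \<le> 1" for \<delta>
  proof -
    let ?N = "\<Sum>v\<in>{1..n}. (\<delta> v)\<^sup>2"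
    have N: "0 \<le> ?N" by (rule sum_nonneg) simp
    have "\<bar>\<Sum>v\<in>e. \<beta>\<^sub>0 v\<bar> + \<bar>\<Sum>v\<in>e. \<delta> v\<bar> \<le> K" if "e \<in> E" for e
      using K[OF that] edge_le[of e \<delta>, OF that \<delta>] real_s by linarith
    from neg_log_lik_strongly_convex[of \<beta>\<^sub>0 \<delta> K, OF this]
    have "?L \<beta>\<^sub>0 + (\<Sum>v\<in>{1..n}. \<delta> v * grad \<beta>\<^sub>0 v) + m / 2 * ?N \<le> ?L (\<lambda>v. \<beta>\<^sub>0 v + \<delta> v)"
      by (simp add: m_def)
    moreover have "(\<Sum>v\<in>{1..n}. \<delta> v * grad \<beta>\<^sub>0 v)\<^sup>2 \<le> ?N * G"
      unfolding G_def by (rule Cauchy_Schwarz_ineq_sum)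
    then have "\<bar>\<Sum>v\<in>{1..n}. \<delta> v * grad \<beta>\<^sub>0 v\<bar> \<le> sqrt ?N * sqrt G"
      unfolding real_sqrt_mult[symmetric] by (intro real_le_rsqrt) simp
    ultimately show ?thesis using N by (simp add: mult.commute)
  qed
  \<comment> \<open>On the boundary of the box the Euclidean norm of the displacement is at least 1,
    so with \<open>sqrt G < m / 2\<close> the quadratic term outweighs the gradient term.\<close>
  have boundary: "?L \<beta>\<^sub>0 < ?L (\<lambda>v. \<beta>\<^sub>0 v + \<delta> v)"
    if \<delta>: "\<And>v. v \<in> {1..n} \<Longrightarrow> \<bar>\<delta> v\<bar> \<le> 1" and v: "v \<in> {1..n}" "\<bar>\<delta> v\<bar> = 1" for \<delta> v
  proof -
    let ?x = "sqrt (\<Sum>v\<in>{1..n}. (\<delta> v)\<^sup>2)"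
    have "(\<delta> v)\<^sup>2 \<le> (\<Sum>v\<in>{1..n}. (\<delta> v)\<^sup>2)"
      using v by (intro member_le_sum) auto
    moreover have "(\<delta> v)\<^sup>2 = 1" using v(2) by (metis power2_abs one_power2)
    ultimately have x: "1 \<le> ?x" by simp
    have "m / 2 * 1 \<le> m / 2 * ?x" using x m by (intro mult_left_mono) auto
    then have "0 < ?x * (m / 2 * ?x - sqrt G)" using G_m x by (intro mult_pos_pos) auto
    also have "\<dots> = - (sqrt G * ?x) + m / 2 * ?x\<^sup>2" by (simp only: power2_eq_square) (simp add: algebra_simps)
    finally show ?thesis using box[of \<delta>, OF \<delta>] by linarith
  qed
  have outside: "?L \<beta>\<^sub>0 < ?L (\<lambda>v. \<beta>\<^sub>0 v + \<delta> v)" if u: "u \<in> {1..n}" "1 < \<bar>\<delta> u\<bar>" for \<delta> u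
  proof -
    \<comment> \<open>Dividing the displacement by its largest coordinate brings it to the boundary;
      convexity along the ray then transfers the inequality to the original point.\<close>
    define M where "M = Max ((\<lambda>v. \<bar>\<delta> v\<bar>) ` {1..n})"
    have "M \<in> (\<lambda>v. \<bar>\<delta> v\<bar>) ` {1..n}" unfolding M_def using u by (intro Max_in) auto
    then obtain v where v: "v \<in> {1..n}" "M = \<bar>\<delta> v\<bar>" by blast
    have le: "\<bar>\<delta> x\<bar> \<le> M" if "x \<in> {1..n}" for x unfolding M_def using that by (intro Max_ge) auto
    have M: "1 < M" using le[OF u(1)] u(2) by simp
    have "?L \<beta>\<^sub>0 < ?L (\<lambda>x. \<beta>\<^sub>0 x + 1 / M * \<delta> x)"
    proof (rule boundary)
      show "\<bar>1 / M * \<delta> x\<bar> \<le> 1" if "x \<in> {1..n}" for x using le[OF that] M by (simp add: abs_mult)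
      show "\<bar>1 / M * \<delta> v\<bar> = 1" using v M by (simp add: abs_mult)
    qed (use v in auto)
    also have "\<dots> \<le> (1 - 1 / M) * ?L \<beta>\<^sub>0 + 1 / M * ?L (\<lambda>x. \<beta>\<^sub>0 x + \<delta> x)"
      using M by (intro neg_log_lik_convex) auto
    finally have "1 / M * ?L \<beta>\<^sub>0 < 1 / M * ?L (\<lambda>x. \<beta>\<^sub>0 x + \<delta> x)"
      by (simp only: left_diff_distrib)
    then show ?thesis using M by (simp add: divide_less_cancel)
  qed
  let ?B = "\<Pi>\<^sub>E v\<in>{1..n}. {\<beta>\<^sub>0 v - 1..\<beta>\<^sub>0 v + 1}"
  have \<beta>0_box: "restrict \<beta>\<^sub>0 {1..n} \<in> ?B" by auto
  have L_restrict: "?L (restrict \<beta>\<^sub>0 {1..n}) = ?L \<beta>\<^sub>0" by (rule neg_log_lik_cong) auto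
  have not_box: "?L \<beta>\<^sub>0 < ?L \<beta>" if \<beta>: "\<beta> \<in> extensional {1..n}" "\<beta> \<notin> ?B" for \<beta>
  proof -
    obtain u where "u \<in> {1..n}" "\<not> (\<beta>\<^sub>0 u - 1 \<le> \<beta> u \<and> \<beta> u \<le> \<beta>\<^sub>0 u + 1)"
      using \<beta> by (auto simp: PiE_def Pi_def)
    then have "?L \<beta>\<^sub>0 < ?L (\<lambda>v. \<beta>\<^sub>0 v + (\<beta> v - \<beta>\<^sub>0 v))" by (intro outside[of u]) auto
    then show ?thesis by simp
  qed
  obtain \<beta>1 where \<beta>1: "\<beta>1 \<in> ?B" "\<And>\<alpha>. \<alpha> \<in> ?B \<Longrightarrow> ?L \<beta>1 \<le> ?L \<alpha>"
    by (rule neg_log_lik_attains_min_on_box[of "\<lambda>v. \<beta>\<^sub>0 v - 1" "\<lambda>v. \<beta>\<^sub>0 v + 1"]) auto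
  have min1: "?L \<beta>1 \<le> ?L \<alpha>" if "\<alpha> \<in> extensional {1..n}" for \<alpha>
    using \<beta>1(2)[of \<alpha>] \<beta>1(2)[OF \<beta>0_box] not_box[OF that] L_restrict by (cases "\<alpha> \<in> ?B") auto
  have est1: "is_ml_estimate n s H \<beta>1"
    using \<beta>1(1) min1 by (force simp: is_ml_estimate_def is_arg_min_def PiE_def)
  have est_le: "?L \<beta> \<le> ?L \<beta>\<^sub>0" if "is_ml_estimate n s H \<beta>" for \<beta>
  proof -
    have "\<not> ?L (restrict \<beta>\<^sub>0 {1..n}) < ?L \<beta>"
      using that by (auto simp: is_ml_estimate_def is_arg_min_def)
    then show ?thesis using L_restrict by simp
  qed
  have est_box: "\<beta> \<in> ?B" if "is_ml_estimate n s H \<beta>" for \<beta>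
    using not_box[of \<beta>] est_le[OF that] that by (force simp: is_ml_estimate_def is_arg_min_def)
  have unique: "\<beta> = \<alpha>" if est: "is_ml_estimate n s H \<beta>" "is_ml_estimate n s H \<alpha>" for \<alpha> \<beta>
  proof -
    \<comment> \<open>Expanding around the midpoint of two minimisers in the directions
      \<open>\<delta>\<close> and \<open>- \<delta>\<close> and adding cancels the gradient. On a
      hyperedge the midpoint deviates from \<open>\<beta>\<^sub>0\<close> by at most
      \<open>s\<close> and \<open>\<delta>\<close> adds at most \<open>s\<close>: this is the
      \<open>2 * s\<close> in the assumption on \<open>K\<close>.\<close>
    define \<mu> where "\<mu> = (\<lambda>v. (\<beta> v + \<alpha> v) / 2)"
    define \<delta> where "\<delta> = (\<lambda>v. (\<beta> v - \<alpha> v) / 2)"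
    have near: "\<bar>\<mu> v - \<beta>\<^sub>0 v\<bar> \<le> 1" "\<bar>\<delta> v\<bar> \<le> 1" "\<bar>- \<delta> v\<bar> \<le> 1" if "v \<in> {1..n}" for v
    proof -
      have "\<bar>\<beta> v - \<beta>\<^sub>0 v\<bar> \<le> 1" "\<bar>\<alpha> v - \<beta>\<^sub>0 v\<bar> \<le> 1"
        using est_box[OF est(1)] est_box[OF est(2)] that by (force simp: PiE_def Pi_def abs_le_iff)+
      then show "\<bar>\<mu> v - \<beta>\<^sub>0 v\<bar> \<le> 1" "\<bar>\<delta> v\<bar> \<le> 1" "\<bar>- \<delta> v\<bar> \<le> 1"
        unfolding \<mu>_def \<delta>_def by (simp_all add: abs_le_iff field_simps)
    qed
    have \<mu>K: "\<bar>\<Sum>v\<in>e. \<mu> v\<bar> + \<bar>\<Sum>v\<in>e. \<eta> v\<bar> \<le> K" if e: "e \<in> E" and \<eta>: "\<And>v. v \<in> {1..n} \<Longrightarrow> \<bar>\<eta> v\<bar> \<le> 1" for e \<eta>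
    proof -
      have "(\<Sum>v\<in>e. \<mu> v) = (\<Sum>v\<in>e. \<beta>\<^sub>0 v) + (\<Sum>v\<in>e. \<mu> v - \<beta>\<^sub>0 v)" by (simp flip: sum.distrib)
      then show ?thesis
        using edge_le[OF e, of "\<lambda>v. \<mu> v - \<beta>\<^sub>0 v"] near(1) edge_le[OF e, of \<eta>] \<eta> K[OF e] by fastforce
    qed
    let ?N = "\<Sum>v\<in>{1..n}. (\<delta> v)\<^sup>2"
    have "?L \<mu> + (\<Sum>v\<in>{1..n}. \<delta> v * grad \<mu> v) + m / 2 * ?N \<le> ?L (\<lambda>v. \<mu> v + \<delta> v)"
      using neg_log_lik_strongly_convex[of \<mu> \<delta> K] \<mu>K near by (simp add: m_def)
    moreover have "?L \<mu> - (\<Sum>v\<in>{1..n}. \<delta> v * grad \<mu> v) + m / 2 * ?N \<le> ?L (\<lambda>v. \<mu> v + - \<delta> v)"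
      using neg_log_lik_strongly_convex[of \<mu> "\<lambda>v. - \<delta> v" K] \<mu>K[of _ "\<lambda>v. - \<delta> v"] near
      by (simp add: m_def sum_negf)
    moreover have "(\<lambda>v. \<mu> v + \<delta> v) = \<beta>" "(\<lambda>v. \<mu> v + - \<delta> v) = \<alpha>"
      by (auto simp: \<mu>_def \<delta>_def field_simps)
    moreover have "?L \<beta> \<le> ?L \<mu>" "?L \<alpha> \<le> ?L \<mu>"
    proof -
      have "?L (restrict \<mu> {1..n}) = ?L \<mu>" by (rule neg_log_lik_cong) auto
      moreover have "\<not> ?L (restrict \<mu> {1..n}) < ?L \<beta>" "\<not> ?L (restrict \<mu> {1..n}) < ?L \<alpha>"
        using est by (auto simp: is_ml_estimate_def is_arg_min_def)
      ultimately show "?L \<beta> \<le> ?L \<mu>" "?L \<alpha> \<le> ?L \<mu>" by auto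
    qed
    ultimately have "m * ?N \<le> 0" by simp
    then have "?N \<le> 0" using m by (simp add: mult_le_0_iff)
    then have "?N = 0" by (intro antisym sum_nonneg) auto
    then have "\<beta> v = \<alpha> v" if "v \<in> {1..n}" for v
      using that by (simp add: sum_nonneg_eq_0_iff \<delta>_def)
    moreover have "\<beta> \<in> extensional {1..n}" "\<alpha> \<in> extensional {1..n}"
      using est by (auto simp: is_ml_estimate_def is_arg_min_def)
    ultimately show ?thesis by (intro extensionalityI)
  qed
  show "\<exists>!\<beta>. is_ml_estimate n s H \<beta>"
    using est1 unique by blast
  assume est: "is_ml_estimate n s H \<beta>"
  show "?L \<beta> \<le> ?L \<beta>\<^sub>0" by (rule est_le[OF est])
  have "\<bar>\<beta> v - \<beta>\<^sub>0 v\<bar> \<le> 1" if "v \<in> {1..n}" for v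
    using est_box[OF est] that by (force simp: PiE_def Pi_def abs_le_iff)
  from box[of "\<lambda>v. \<beta> v - \<beta>\<^sub>0 v", OF this]
  have "?L \<beta>\<^sub>0 - sqrt G * sqrt (\<Sum>v\<in>{1..n}. (\<beta> v - \<beta>\<^sub>0 v)\<^sup>2) + m / 2 * (sqrt (\<Sum>v\<in>{1..n}. (\<beta> v - \<beta>\<^sub>0 v)\<^sup>2))\<^sup>2 \<le> ?L \<beta>"
    by simp
  then show "?L \<beta>\<^sub>0 - G / (2 * m) \<le> ?L \<beta>"
    using quadratic_lower_bound[OF m, of "sqrt G" "sqrt (\<Sum>v\<in>{1..n}. (\<beta> v - \<beta>\<^sub>0 v)\<^sup>2)"] G0 by simp
qed

end

section \<open>The likelihood ratio statistic\<close>

locale beta_hypergraph = beta_layer I p n s \<gamma> c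
  for I :: "nat set set" and p n s \<gamma> c +
  fixes M :: real
  assumes index_subset: "I \<subseteq> Pow {1..n}"
    and \<gamma>_le: "v \<in> {1..n} \<Longrightarrow> \<bar>\<gamma> v\<bar> \<le> M"
begin

text \<open>\<open>c' * D\<close> bounds the modulus of strong convexity from below. In the
  exponent, \<open>s * (M + 1)\<close> bounds the linear predictor after a step with coordinates at
  most 1, and \<open>2 * s\<close> is the room for the unit box; the 8 is the 4 of the curvature
  bound times the 2 of \<open>D / 2 \<le> D - D2\<close>.\<close>

definition c' :: real where "c' = exp (- (real s * M + 3 * real s)) / 8"

lemma c'_pos: "0 < c'" by (simp add: c'_def)

definition graph :: "(nat set \<Rightarrow> bool) \<Rightarrow> hypergraph" where
  "graph X = {e \<in> I. X e}"

lemma layer_graph: "layer_graph n s (graph X)"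
  using layer_size_axioms index_subset
  by (auto simp: layer_graph_def layer_graph_axioms_def graph_def)

lemma Z_eq: "Z v X = (\<Sum>e\<in>{e \<in> E. v \<in> e}. of_bool (X e) - logistic (gam e))"
  unfolding Z_def lin_def
  by (rule sum.mono_neutral_cong_right) (auto simp: Y_def p_logistic)

lemma mem_graph: "e \<in> E \<Longrightarrow> e \<in> graph X \<longleftrightarrow> X e"
  using edges_subset by (auto simp: graph_def)

lemma sum_\<gamma>_\<epsilon>: "(\<Sum>v\<in>e. \<gamma> v + \<epsilon> v X) = gam e + \<xi> e X"
  by (simp add: gam_def \<xi>_def sum.distrib)

lemma grad_eq: "layer_graph.grad n s (graph X) (\<lambda>v. \<gamma> v + \<epsilon> v X) v = - r v X"
  unfolding layer_graph.grad_def[OF layer_graph] r_def Z_eq sum_\<gamma>_\<epsilon> sum_subtractf[symmetric] sum_negf[symmetric]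
  by (intro sum.cong refl) (simp add: mem_graph)

text \<open>The part of the gain linear in the step is \<open>\<Sum>v. Z v * \<epsilon> v\<close>.
  Half of it is placed in \<open>F\<close>, where it compensates the second-order loss
  \<open>q / 2\<close>.\<close>

lemma neg_log_lik_step:
  "neg_log_lik n s (graph X) \<gamma> - neg_log_lik n s (graph X) (\<lambda>v. \<gamma> v + \<epsilon> v X)
    = (\<Sum>v\<in>{1..n}. Z v X * \<epsilon> v X) / 2 + F X"
proof -
  have "neg_log_lik n s (graph X) \<gamma> - neg_log_lik n s (graph X) (\<lambda>v. \<gamma> v + \<epsilon> v X)
      = (\<Sum>e\<in>E. Y e X * \<xi> e X - g e (\<xi> e X))"
    unfolding layer_graph.neg_log_lik_eq[OF layer_graph] sum_\<gamma>_\<epsilon> gam_def[symmetric] sum_subtractf[symmetric]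
    by (intro sum.cong refl) (simp add: mem_graph Y_def g_def p_logistic algebra_simps)
  also have "\<dots> = (\<Sum>v\<in>{1..n}. Z v X * \<epsilon> v X) - (\<Sum>e\<in>E. g e (\<xi> e X))"
    by (simp only: sum_subtractf sum_Z_\<epsilon>)
  finally show ?thesis by (simp add: F_def)
qed

lemma log_lik_ratio_approx:
  assumes \<epsilon>: "\<And>v. v \<in> {1..n} \<Longrightarrow> \<bar>\<epsilon> v X\<bar> \<le> 1"
    and r: "(\<Sum>v\<in>{1..n}. (r v X)\<^sup>2) < (c' * D / 2)\<^sup>2"
  shows "\<exists>!\<beta>. is_ml_estimate n s (graph X) \<beta>"
    and "is_ml_estimate n s (graph X) \<beta> \<Longrightarrow>
      \<bar>neg_log_lik n s (graph X) \<gamma> - neg_log_lik n s (graph X) \<beta>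
        - ((\<Sum>v\<in>{1..n}. Z v X * \<epsilon> v X) / 2 + F X)\<bar> \<le> (\<Sum>v\<in>{1..n}. (r v X)\<^sup>2) / (2 * (c' * D))"
proof -
  define K where "K = real s * M + 3 * real s"
  define m where "m = exp (- K) / 4 * (D - D2)"
  let ?G = "\<Sum>v\<in>{1..n}. (r v X)\<^sup>2"
  let ?\<beta> = "\<lambda>v. \<gamma> v + \<epsilon> v X"
  have cD: "0 < c' * D" using c'_pos D_pos by simp
  have "exp (- K) / 4 * (D / 2) \<le> m"
    unfolding m_def using two_D2_le by (intro mult_left_mono) auto
  then have m: "c' * D \<le> m" by (simp add: c'_def K_def)
  have K: "\<bar>\<Sum>v\<in>e. ?\<beta> v\<bar> + 2 * real s \<le> K" if "e \<in> E" for e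
  proof -
    have "\<bar>\<Sum>v\<in>e. ?\<beta> v\<bar> \<le> (\<Sum>v\<in>e. \<bar>?\<beta> v\<bar>)" by (rule sum_abs)
    also have "\<dots> \<le> real (card e) * (M + 1)"
    proof (rule sum_bounded_above)
      fix v assume "v \<in> e"
      then have "v \<in> {1..n}" using edgesD[OF that] by auto
      then show "\<bar>?\<beta> v\<bar> \<le> M + 1" using \<epsilon> \<gamma>_le abs_triangle_ineq[of "\<gamma> v" "\<epsilon> v X"] by fastforce
    qed
    finally show ?thesis using edgesD[OF that] by (simp add: K_def algebra_simps)
  qed
  have G: "(\<Sum>v\<in>{1..n}. (layer_graph.grad n s (graph X) ?\<beta> v)\<^sup>2) = ?G"
    by (simp add: grad_eq)
  have G_m: "?G < (m / 2)\<^sup>2"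
    using r m cD by (elim order.strict_trans2) (intro power_mono; simp)
  note near = layer_graph.ml_estimate_near[OF layer_graph[of X], where K = K and \<beta>\<^sub>0 = ?\<beta>,
      folded m_def, unfolded G]
  show "\<exists>!\<beta>. is_ml_estimate n s (graph X) \<beta>"
    by (rule near(1)) (use K G_m in auto)
  assume est: "is_ml_estimate n s (graph X) \<beta>"
  have "?G / (2 * m) \<le> ?G / (2 * (c' * D))"
    using m cD by (intro divide_left_mono sum_nonneg) auto
  then show "\<bar>neg_log_lik n s (graph X) \<gamma> - neg_log_lik n s (graph X) \<beta>
        - ((\<Sum>v\<in>{1..n}. Z v X * \<epsilon> v X) / 2 + F X)\<bar> \<le> ?G / (2 * (c' * D))"
    using near(2,3)[OF K G_m est] neg_log_lik_step[of X] by linarith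
qed

section \<open>Comparison of characteristic functions\<close>

definition K_step :: real where
  "K_step = 2 * (M_F + sqrt V_F) + C_r / c'"

definition K_bad :: real where
  "K_bad = 2 * (3 * (real s)\<^sup>2 / c^4 + 4 * C_r * real s / c'\<^sup>2)"

lemma char_lr_statistic_Q:
  assumes est: "\<And>X. \<exists>!\<beta>. is_ml_estimate n s (graph X) \<beta> \<Longrightarrow> is_ml_estimate n s (graph X) (est (graph X))"
  shows "cmod (expect (\<lambda>X. iexp (t * lr_statistic n s \<gamma> est (graph X))) - expect (\<lambda>X. iexp (t * Q X)))
    \<le> (\<bar>t\<bar> * K_step + K_bad) / sqrt (real n)"
proof -
  define T where "T = (\<lambda>X. lr_statistic n s \<gamma> est (graph X))"
  define G where "G = (\<lambda>X. \<Sum>v\<in>{1..n}. (r v X)\<^sup>2)"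
  \<comment> \<open>\<open>B\<close> is at least 1 where the step or the remaining score is too
    large; there nothing is known of the estimator and the two exponentials differ by at most 2.
    Fourth powers are essential: a union bound over the vertices with second moments would give
    \<open>n / D\<close>, which does not vanish for \<open>s = 2\<close>, whereas fourth moments
    give \<open>n / D^2\<close>.\<close>
  define B where "B = (\<lambda>X. (\<Sum>v\<in>{1..n}. (\<epsilon> v X)^4) + 4 / (c' * D)\<^sup>2 * G X)"
  \<comment> \<open>On the good set, \<open>R\<close> bounds the distance between the statistic and
    \<open>Q\<close>.\<close>
  define R where "R = (\<lambda>X. (2 * \<bar>F X\<bar> + G X / (c' * D)) / sqrt (2 * real n))"
  have cD: "0 < c' * D" using c'_pos D_pos by simp
  have G0: "0 \<le> G X" for X by (simp add: G_def sum_nonneg)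
  have R0: "0 \<le> R X" for X using G0[of X] cD by (simp add: R_def)
  have B0: "0 \<le> B X" for X using G0[of X] cD by (auto simp: B_def intro!: add_nonneg_nonneg sum_nonneg)
  have pointwise: "cmod (iexp (t * T X) - iexp (t * Q X)) \<le> \<bar>t\<bar> * R X + 2 * B X" for X
  proof (cases "(\<forall>v\<in>{1..n}. \<bar>\<epsilon> v X\<bar> \<le> 1) \<and> G X < (c' * D / 2)\<^sup>2")
    case True
    then have good: "\<And>v. v \<in> {1..n} \<Longrightarrow> \<bar>\<epsilon> v X\<bar> \<le> 1" "(\<Sum>v\<in>{1..n}. (r v X)\<^sup>2) < (c' * D / 2)\<^sup>2"
      by (auto simp: G_def)
    define d where "d = log_lik_ratio n s \<gamma> est (graph X) - ((\<Sum>v\<in>{1..n}. Z v X * \<epsilon> v X) / 2 + F X)"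
    have d: "\<bar>d\<bar> \<le> G X / (2 * (c' * D))"
      using log_lik_ratio_approx(2)[OF good est[OF log_lik_ratio_approx(1)[OF good]]]
      by (simp add: d_def G_def log_lik_ratio_def)
    have eq: "2 * log_lik_ratio n s \<gamma> est (graph X) - real n = (\<Sum>v\<in>{1..n}. Z v X * \<epsilon> v X) - real n + (2 * F X + 2 * d)"
      by (simp add: d_def)
    have TQ: "T X - Q X = (2 * F X + 2 * d) / sqrt (2 * real n)"
      unfolding T_def lr_statistic_def Q_def eq diff_divide_distrib[symmetric] by simp
    have "\<bar>2 * F X + 2 * d\<bar> \<le> 2 * \<bar>F X\<bar> + G X / (c' * D)"
      using d by simp
    then have "\<bar>T X - Q X\<bar> \<le> R X"
      unfolding TQ R_def abs_divide by (simp add: divide_right_mono)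
    then have "\<bar>t * T X - t * Q X\<bar> \<le> \<bar>t\<bar> * R X"
      unfolding right_diff_distrib[symmetric] abs_mult by (rule mult_left_mono) simp
    then show ?thesis
      using norm_iexp_diff_le[of "t * T X" "t * Q X"] B0[of X] by linarith
  next
    case False
    have "1 \<le> B X"
    proof (cases "\<forall>v\<in>{1..n}. \<bar>\<epsilon> v X\<bar> \<le> 1")
      case True
      then have "(c' * D)\<^sup>2 \<le> 4 * G X" using False by (simp add: power_divide not_less)
      then have "1 \<le> (4 * G X) / (c' * D)\<^sup>2"
        using zero_less_power[OF cD, of 2] by (simp only: pos_le_divide_eq mult_1_left)
      then have "1 \<le> 4 / (c' * D)\<^sup>2 * G X" by simp
      then show ?thesis by (simp add: B_def sum_nonneg add_increasing)
    next
      case False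
      then obtain v where v: "v \<in> {1..n}" "1 < \<bar>\<epsilon> v X\<bar>" by force
      have "1 \<le> \<bar>\<epsilon> v X\<bar>^4" using v(2) by (intro one_le_power) simp
      also have "\<dots> = (\<epsilon> v X)^4" by simp
      also have "\<dots> \<le> (\<Sum>v\<in>{1..n}. (\<epsilon> v X)^4)" using v(1) by (intro member_le_sum) auto
      finally show ?thesis using G0[of X] by (simp add: B_def add_increasing2)
    qed
    moreover have "cmod (iexp (t * T X) - iexp (t * Q X)) \<le> 2"
      using norm_triangle_ineq4[of "iexp (t * T X)" "iexp (t * Q X)"] by simp
    moreover have "0 \<le> \<bar>t\<bar> * R X" using R0 by simp
    ultimately show ?thesis by linarith
  qed
  have n1: "1 \<le> sqrt (real n)" using real_n real_s by simp
  have ER: "expect R \<le> K_step / sqrt (real n)"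
  proof -
    have "expect R = (2 * expect (\<lambda>X. \<bar>F X\<bar>) + expect G / (c' * D)) / sqrt (2 * real n)"
      unfolding R_def by simp
    also have "\<dots> \<le> (2 * (M_F + sqrt V_F) + C_r * D / (c' * D)) / sqrt (2 * real n)"
      using expect_abs_F_le expect_sum_r2_le cD unfolding G_def
      by (intro divide_right_mono add_mono mult_left_mono) auto
    also have "\<dots> = K_step / sqrt (2 * real n)"
      using D_pos by (simp add: K_step_def)
    also have "\<dots> \<le> K_step / sqrt (real n)"
    proof (rule divide_left_mono)
      have "0 \<le> expect (\<lambda>X. \<bar>F X\<bar>)" by (rule Bochner_Integration.integral_nonneg) simp
      then have "0 \<le> M_F + sqrt V_F" using expect_abs_F_le by linarith
      then show "0 \<le> K_step"
        using c'_pos by (simp add: K_step_def C_r_def)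
    qed (use n_pos in auto)
    finally show ?thesis .
  qed
  have D_n: "1 / D \<le> real s / sqrt (real n)"
  proof -
    have "sqrt (real n) * 1 \<le> sqrt (real n) * sqrt (real n)" using n1 by (intro mult_left_mono) auto
    then have "sqrt (real n) \<le> real s * D" using n_le by simp
    then show ?thesis using D_pos n_pos by (simp add: field_simps)
  qed
  have EB: "2 * expect B \<le> K_bad / sqrt (real n)"
  proof -
    have "expect B = (\<Sum>v\<in>{1..n}. expect (\<lambda>X. (\<epsilon> v X)^4)) + 4 / (c' * D)\<^sup>2 * expect G"
      unfolding B_def by simp
    also have "\<dots> \<le> real (card {1..n}) * (3 / (c\<^sup>2 * D)\<^sup>2) + 4 / (c' * D)\<^sup>2 * (C_r * D)"
      using expect_sum_r2_le unfolding G_def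
      by (intro add_mono mult_left_mono sum_bounded_above expect_\<epsilon>4_le) auto
    also have "\<dots> \<le> (real s * D) * (3 / (c\<^sup>2 * D)\<^sup>2) + 4 / (c' * D)\<^sup>2 * (C_r * D)"
      using n_le by (intro add_right_mono mult_right_mono) auto
    also have "\<dots> = (3 * real s / c^4 + 4 * C_r / c'\<^sup>2) * (1 / D)"
      using D_pos c_pos c'_pos by (simp add: field_simps power2_eq_square power4_eq_xxxx)
    also have "\<dots> \<le> (3 * real s / c^4 + 4 * C_r / c'\<^sup>2) * (real s / sqrt (real n))"
      using D_n c_pos by (intro mult_left_mono) (auto simp: C_r_def)
    also have "\<dots> = K_bad / 2 / sqrt (real n)"
      by (simp add: K_bad_def ring_distribs add_divide_distrib power2_eq_square mult_ac)
    finally show ?thesis by simp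
  qed
  have "cmod (expect (\<lambda>X. iexp (t * T X) - iexp (t * Q X))) \<le> expect (\<lambda>X. cmod (iexp (t * T X) - iexp (t * Q X)))"
    by (rule integral_norm_bound)
  also have "\<dots> \<le> expect (\<lambda>X. \<bar>t\<bar> * R X + 2 * B X)"
    by (rule expect_mono[OF pointwise])
  also have "\<dots> = \<bar>t\<bar> * expect R + 2 * expect B" by simp
  also have "\<dots> \<le> \<bar>t\<bar> * (K_step / sqrt (real n)) + K_bad / sqrt (real n)"
    using ER EB by (intro add_mono mult_left_mono) auto
  finally show ?thesis
    by (simp add: T_def add_divide_distrib)
qed

definition rate :: "real \<Rightarrow> real" where
  "rate t = (\<bar>t\<bar> * K_step + K_bad) + (\<bar>t\<bar> * kap + t\<^sup>2 * K_a + \<bar>t\<bar>^3 * K_b)"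

theorem char_lr_statistic_le:
  assumes est: "\<And>X. \<exists>!\<beta>. is_ml_estimate n s (graph X) \<beta> \<Longrightarrow> is_ml_estimate n s (graph X) (est (graph X))"
  shows "cmod (expect (\<lambda>X. iexp (t * lr_statistic n s \<gamma> est (graph X))) - of_real (exp (- t\<^sup>2 / 2)))
    \<le> rate t / sqrt (real n)"
proof -
  define a1 where "a1 = expect (\<lambda>X. iexp (t * lr_statistic n s \<gamma> est (graph X)))"
  define a2 where "a2 = expect (\<lambda>X. iexp (t * Q X))"
  have "cmod (a1 - of_real (exp (- t\<^sup>2 / 2))) \<le> cmod (a1 - a2) + cmod (a2 - of_real (exp (- t\<^sup>2 / 2)))"
    using norm_triangle_ineq[of "a1 - a2" "a2 - of_real (exp (- t\<^sup>2 / 2))"] by simp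
  also have "\<dots> \<le> (\<bar>t\<bar> * K_step + K_bad) / sqrt (real n) + (\<bar>t\<bar> * kap + t\<^sup>2 * K_a + \<bar>t\<bar>^3 * K_b) / sqrt (real n)"
    unfolding a1_def a2_def by (intro add_mono char_lr_statistic_Q est char_Q_le)
  finally show ?thesis
    by (simp add: a1_def rate_def add_divide_distrib)
qed

end

text \<open>The lower bound on the weights comes from
  \<open>|\<Sum>v\<in>e. \<gamma> v| \<le> s * M\<close> and is the same for all
  \<open>n\<close>.\<close>

lemma beta_hypergraph_model:
  fixes \<gamma> :: "nat \<Rightarrow> real"
  assumes "2 \<le> s" "s \<le> r" "2 * s \<le> n"
    and \<gamma>: "\<And>v. v \<in> {1..n} \<Longrightarrow> \<bar>\<gamma> v\<bar> \<le> M" and B: "\<And>v. v \<in> {1..n} \<Longrightarrow> B s v = \<gamma> v"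
  shows "beta_hypergraph (layered_hyperedges r n) (hyperedge_prob B) n s \<gamma> (exp (- (real s * M)) / 4) M"
proof -
  let ?I = "layered_hyperedges r n" and ?p = "hyperedge_prob B"
  have p: "?p e = logistic (\<Sum>v\<in>e. B (card e) v)" for e
    by (simp add: hyperedge_prob_def logistic_def)
  have I: "?I \<subseteq> Pow {1..n}" by (auto simp: layered_hyperedges_def)
  then have "finite ?I" by (rule finite_subset) simp
  then interpret bernoulli_family ?I ?p
    by unfold_locales (auto simp: p less_imp_le logistic_pos logistic_less_1)
  interpret layer_size n s using assms by unfold_locales
  have E: "E \<subseteq> ?I" using assms by (auto simp: edges_def layered_hyperedges_def)
  have pE: "?p e = logistic (\<Sum>v\<in>e. \<gamma> v)" if "e \<in> E" for e
    unfolding p using edgesD[OF that] B by (intro arg_cong[where f = logistic] sum.cong) auto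
  show ?thesis
  proof unfold_locales
    fix e assume e: "e \<in> E"
    have "\<bar>\<Sum>v\<in>e. \<gamma> v\<bar> \<le> (\<Sum>v\<in>e. \<bar>\<gamma> v\<bar>)" by (rule sum_abs)
    also have "\<dots> \<le> real (card e) * M" using edgesD[OF e] \<gamma> by (intro sum_bounded_above) auto
    finally have "\<bar>\<Sum>v\<in>e. \<gamma> v\<bar> \<le> real s * M" using edgesD[OF e] by simp
    then show "exp (- (real s * M)) / 4 \<le> w e"
      unfolding w_def pE[OF e] logistic_var_def[symmetric] by (rule logistic_var_ge)
  qed (use E pE I \<gamma> in auto)
qed

theorem theorem3p1:
  fixes r s :: nat and M :: real
    and \<gamma> :: "nat \<Rightarrow> nat \<Rightarrow> real"
    and B :: "nat \<Rightarrow> nat \<Rightarrow> nat \<Rightarrow> real"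
    and mle :: "nat \<Rightarrow> hypergraph \<Rightarrow> nat \<Rightarrow> real"
  assumes "2 \<le> r" and "2 \<le> s" and "s \<le> r" and "0 < M"
    and "\<And>n v. v \<in> {1..n} \<Longrightarrow> \<bar>\<gamma> n v\<bar> \<le> M"
    and "\<And>n v. v \<in> {1..n} \<Longrightarrow> B n s v = \<gamma> n v"
    and "\<And>n. is_ml_estimator r n s (mle n)"
  shows "weak_conv_m
           (\<lambda>n. distr (measure_pmf (hypergraph_beta_model r n (B n))) borel
                  (lr_statistic n s (\<gamma> n) (mle n)))
           std_normal_distribution"
proof (rule levy_continuity)
  define c where "c = exp (- (real s * M)) / 4"
  show "real_distribution (distr (measure_pmf (hypergraph_beta_model r n (B n))) borel
      (lr_statistic n s (\<gamma> n) (mle n)))" for n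
    by (intro prob_space.real_distribution_distr measure_pmf.prob_space_axioms) simp
  show "real_distribution std_normal_distribution"
    by (rule real_dist_normal_dist)
  fix t :: real
  \<comment> \<open>The interpretation varies with \<open>n\<close>, but \<open>rate\<close> depends
    on \<open>s\<close>, \<open>c\<close>, \<open>M\<close> and \<open>t\<close> only, so the
    right-hand side tends to zero.\<close>
  have bound: "cmod (char (distr (measure_pmf (hypergraph_beta_model r n (B n))) borel
        (lr_statistic n s (\<gamma> n) (mle n))) t - char std_normal_distribution t)
      \<le> beta_hypergraph.rate s c M t / sqrt (real n)" if n: "2 * s \<le> n" for n
  proof -
    interpret beta_hypergraph "layered_hyperedges r n" "hyperedge_prob (B n)" n s "\<gamma> n" c M
      unfolding c_def using assms n by (intro beta_hypergraph_model) auto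
    have "char (distr (measure_pmf (hypergraph_beta_model r n (B n))) borel
        (lr_statistic n s (\<gamma> n) (mle n))) t = expect (\<lambda>X. iexp (t * lr_statistic n s (\<gamma> n) (mle n) (graph X)))"
      by (simp add: char_def integral_distr hypergraph_beta_model_def bernoulli_product_def graph_def)
    moreover have "is_ml_estimate n s (graph X) (mle n (graph X))"
      if "\<exists>!\<beta>. is_ml_estimate n s (graph X) \<beta>" for X
      using assms(7)[of n] that by (auto simp: is_ml_estimator_def graph_def)
    ultimately show ?thesis
      using char_lr_statistic_le[of "mle n" t] by (simp add: char_std_normal_distribution)
  qed
  show "(\<lambda>n. char (distr (measure_pmf (hypergraph_beta_model r n (B n))) borel
      (lr_statistic n s (\<gamma> n) (mle n))) t) \<longlonglongrightarrow> char std_normal_distribution t"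
  proof (rule Lim_transform2[OF tendsto_const], rule Lim_null_comparison)
    show "\<forall>\<^sub>F n in sequentially. norm (char std_normal_distribution t
        - char (distr (measure_pmf (hypergraph_beta_model r n (B n))) borel
          (lr_statistic n s (\<gamma> n) (mle n))) t) \<le> beta_hypergraph.rate s c M t / sqrt (real n)"
      using eventually_ge_at_top[of "2 * s"] by eventually_elim (subst norm_minus_commute, rule bound)
    show "(\<lambda>n. beta_hypergraph.rate s c M t / sqrt (real n)) \<longlonglongrightarrow> 0"
      by (intro real_tendsto_divide_at_top[OF tendsto_const] filterlim_compose[OF sqrt_at_top filterlim_real_sequentially])
  qed
qed

end
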